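(* For all $n\ge 4$ the knot diagram invariants $A_n$ and $D_n$, and for all odd $n\ge 3$ the knot diagram invariant $W_n$, do not change under $\Omega_1$- and $\Omega_2$-moves. $A_n$ does not change under descending $\Omega_3$-moves, and $D_n$ does not change under ascending $\Omega_3$-moves.
   Context: A knot diagram is the image of an immersion of the oriented circle $S^1$ in $\mathbb{R}^2$ whose only multiple points are transversal double points (crossings), together with the induced orientation and over/under information at each crossing. The sign of a crossing is $+1$ if (direction of overpassing strand, direction of underpassing strand) is a positively oriented basis of $\mathbb{R}^2$, and $-1$ otherwise. The Gauss diagram $G_k$ of a knot diagram $k$ is the immersing oriented circle with, for each crossing, the two preimages connected by an arrow pointing from the overpass (tail) to the underpass (head) and carrying the sign of the crossing; it is considered up to orientation-preserving diffeomorphism of the circle. A subdiagram of $G_k$ is obtained by removing arrows (i.e. it is given by a subset of the arrows); its sign is the product of the signs of its arrows. Arrow diagrams (unsigned), with $2n$ endpoints placed at positions $0,1,\dots,2n-1$ (mod $2n$) in the order of the orientation of the circle: $a_n$ ($n\ge4$) has $n$ arrows, the $i$-th with head at position $2i$ and tail at position $2i+3$, for $i=0,\dots,n-1$. $d_n$ ($n\ge4$) has $n$ arrows, the $i$-th with tail at position $2i$ and head at position $2i+3$. $w_n$ ($n\geq 3$ odd) has $n$ arrows that are diameters (joining positions $p$ and $p+n$) directed so that no two heads are adjacent, i.e. heads and tails alternate around the circle. $A_n(k)$, $D_n(k)$, $W_n(k)$ are the sums of the signs of all subdiagrams of $G_k$ which, disregarding signs of arrows, are of the form $a_n$, $d_n$,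 $w_n$ respectively (up to orientation-preserving diffeomorphism of the circle). A Reidemeister move changes a knot diagram only inside a disk (the changing disk); up to diffeomorphism (possibly orientation-reversing) of the disk it is one of the following, in either direction. $\Omega_1$: an embedded arc is replaced by an arc with a single kink (one crossing, of either type). $\Omega_2$: two disjoint arcs are replaced by two arcs crossing each other in exactly two points and bounding a bigon, one of the arcs being over at both crossings. $\Omega_3$: three arcs crossing pairwise exactly once, one of which (the top strand) is over at both its crossings, one (the bottom strand) under at both, and the remaining one (the middle strand) under the top and over the bottom, are replaced by the configuration obtained by sliding one strand across the crossing of the other two, with over/under relations kept. An $\Omega_3$-move is descending if, moving along the knot in the direction of its orientation, the three strands are passed in the cyclic order top-middle-bottom; otherwise it is ascending. *)

theory Defs
  imports "HOL-Analysis.Analysis"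
begin

text \<open>
  The plane is \<^typ>\<open>complex\<close>. The circle is the quotient of the reals by the integers: maps on it
  are 1-periodic maps on the reals, and its points are named by their representatives in
  \<open>{0..<1}\<close> (via \<^const>\<open>frac\<close>). Smoothness is C1 throughout.
\<close>


section \<open>Knot diagrams\<close>

text \<open>The determinant of the matrix with columns \<open>u\<close> and \<open>v\<close>.\<close>

definition plane_det :: "complex \<Rightarrow> complex \<Rightarrow> real" where
  "plane_det u v = Im (cnj u * v)"

text \<open>\<open>over\<close> is the set of all parameters at which the curve overpasses at a crossing.\<close>

record diagram =
  curve :: "real \<Rightarrow> complex"
  over :: "real set"

definition velocity :: "diagram \<Rightarrow> real \<Rightarrow> complex" where
  "velocity k t = vector_derivative (curve k) (at t)"

definition crossing :: "diagram \<Rightarrow> real \<Rightarrow> real \<Rightarrow> bool" where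
  "crossing k s t \<longleftrightarrow> frac s \<noteq> frac t \<and> curve k s = curve k t"

definition knot_diagram :: "diagram \<Rightarrow> bool" where
  "knot_diagram k \<longleftrightarrow>
     (\<forall>t. curve k (t + 1) = curve k t) \<and>
     curve k C1_differentiable_on UNIV \<and>
     (\<forall>t. velocity k t \<noteq> 0) \<and>
     (\<forall>r s t. \<not> (crossing k r s \<and> crossing k s t \<and> crossing k r t)) \<and>
     (\<forall>s t. crossing k s t \<longrightarrow> plane_det (velocity k s) (velocity k t) \<noteq> 0) \<and>
     (\<forall>t. t + 1 \<in> over k \<longleftrightarrow> t \<in> over k) \<and>
     (\<forall>s\<in>over k. \<exists>t. crossing k s t) \<and>
     (\<forall>s t. crossing k s t \<longrightarrow> (s \<in> over k \<longleftrightarrow> t \<notin> over k))"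

text \<open>Lifts to the reals of the orientation-preserving diffeomorphisms of the circle.\<close>

definition circle_diffeo :: "(real \<Rightarrow> real) \<Rightarrow> bool" where
  "circle_diffeo \<theta> \<longleftrightarrow>
     \<theta> C1_differentiable_on UNIV \<and> (\<forall>t. deriv \<theta> t > 0) \<and> (\<forall>t. \<theta> (t + 1) = \<theta> t + 1)"

text \<open>A knot diagram is an oriented image, so it is determined by a parametrization only up to
  the following operation.\<close>

definition reparam :: "(real \<Rightarrow> real) \<Rightarrow> diagram \<Rightarrow> diagram" where
  "reparam \<theta> k = \<lparr>curve = curve k \<circ> \<theta>, over = \<theta> -` over k\<rparr>"


section \<open>Gauss diagrams and the invariants\<close>

text \<open>Arrows are triples (tail, head, sign).\<close>

definition gauss_diagram :: "diagram \<Rightarrow> (real \<times> real \<times> int) set" where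
  "gauss_diagram k =
     {(t, h, if plane_det (velocity k t) (velocity k h) > 0 then 1 else -1) | t h.
        t \<in> {0..<1} \<and> h \<in> {0..<1} \<and> crossing k t h \<and> t \<in> over k}"

definition sign_of :: "(real \<times> real \<times> int) set \<Rightarrow> int" where
  "sign_of S = (\<Prod>(t, h, e)\<in>S. e)"

definition unsigned :: "(real \<times> real \<times> int) set \<Rightarrow> (real \<times> real) set" where
  "unsigned S = (\<lambda>(t, h, e). (t, h)) ` S"

text \<open>An arrow diagram with \<open>2 * n\<close> endpoints is a set of pairs (tail position, head position),
  position \<open>p\<close> being the point \<open>p / (2 * n)\<close> of the circle.\<close>

definition has_form :: "nat \<Rightarrow> (nat \<times> nat) set \<Rightarrow> (real \<times> real \<times> int) set \<Rightarrow> bool" where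
  "has_form n X S \<longleftrightarrow>
     (\<exists>\<theta>. circle_diffeo \<theta> \<and>
        (\<lambda>(t, h). (frac (\<theta> t), frac (\<theta> h))) ` unsigned S =
        (\<lambda>(p, q). (real p / real (2 * n), real q / real (2 * n))) ` X)"

definition signed_count :: "nat \<Rightarrow> (nat \<times> nat) set \<Rightarrow> diagram \<Rightarrow> int" where
  "signed_count n X k = (\<Sum>S | S \<subseteq> gauss_diagram k \<and> has_form n X S. sign_of S)"

definition a_arrows :: "nat \<Rightarrow> (nat \<times> nat) set" where
  "a_arrows n = {((2 * i + 3) mod (2 * n), 2 * i) | i. i < n}"

definition d_arrows :: "nat \<Rightarrow> (nat \<times> nat) set" where
  "d_arrows n = {(2 * i, (2 * i + 3) mod (2 * n)) | i. i < n}"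

text \<open>For odd \<open>n\<close> opposite positions have different parity, so up to a rotation the alternating
  directions of the diameters are those with all tails at even positions.\<close>

definition w_arrows :: "nat \<Rightarrow> (nat \<times> nat) set" where
  "w_arrows n = {(2 * i, (2 * i + n) mod (2 * n)) | i. i < n}"

definition A_inv :: "nat \<Rightarrow> diagram \<Rightarrow> int" where
  "A_inv n k = signed_count n (a_arrows n) k"

definition D_inv :: "nat \<Rightarrow> diagram \<Rightarrow> int" where
  "D_inv n k = signed_count n (d_arrows n) k"

definition W_inv :: "nat \<Rightarrow> diagram \<Rightarrow> int" where
  "W_inv n k = signed_count n (w_arrows n) k"


section \<open>Reidemeister moves\<close>

text \<open>Diffeomorphisms of the closed unit disk onto a disk in the plane, preserving
  (\<open>\<epsilon> = 1\<close>) or reversing (\<open>\<epsilon> = -1\<close>) the orientation.\<close>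

definition disk_diffeo :: "real \<Rightarrow> (complex \<Rightarrow> complex) \<Rightarrow> bool" where
  "disk_diffeo \<epsilon> \<Phi> \<longleftrightarrow>
     (\<exists>U (\<Phi>' :: complex \<Rightarrow> complex \<Rightarrow>\<^sub>L complex).
        open U \<and> cball 0 1 \<subseteq> U \<and> inj_on \<Phi> U \<and>
        (\<forall>z\<in>U. (\<Phi> has_derivative blinfun_apply (\<Phi>' z)) (at z)) \<and>
        continuous_on U \<Phi>' \<and>
        (\<forall>z\<in>U. \<epsilon> * plane_det (\<Phi>' z 1) (\<Phi>' z \<i>) > 0))"

text \<open>
  The strands inside the changing disk are the arcs of the circle given by the intervals
  \<open>{a j..b j}\<close> for \<open>j < m\<close>, all chosen in one period starting at \<open>a 0\<close>.
\<close>

definition strand_intervals :: "nat \<Rightarrow> (nat \<Rightarrow> real) \<Rightarrow> (nat \<Rightarrow> real) \<Rightarrow> bool" where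
  "strand_intervals m a b \<longleftrightarrow>
     (\<forall>j<m. a 0 \<le> a j \<and> a j < b j \<and> b j < a 0 + 1) \<and>
     (\<forall>i<m. \<forall>j<m. i \<noteq> j \<longrightarrow> {a i..b i} \<inter> {a j..b j} = {})"

definition on_strand :: "nat \<Rightarrow> (nat \<Rightarrow> real) \<Rightarrow> (nat \<Rightarrow> real) \<Rightarrow> real \<Rightarrow> bool" where
  "on_strand m a b t \<longleftrightarrow> (\<exists>j<m. \<exists>z::int. t + of_int z \<in> {a j..b j})"

text \<open>
  A picture consists of curves \<open>c j : {-1..1} \<rightarrow> cball 0 1\<close>. Strand \<open>j\<close> runs through the image
  of \<open>c j\<close> under \<open>\<Phi>\<close>, forwards or backwards according to \<open>\<delta> j\<close>; where two different
  strands cross, the one of smaller index is over.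
\<close>

definition shows_picture ::
  "nat \<Rightarrow> (nat \<Rightarrow> real \<Rightarrow> complex) \<Rightarrow> (nat \<Rightarrow> real) \<Rightarrow> (complex \<Rightarrow> complex) \<Rightarrow>
   (nat \<Rightarrow> real) \<Rightarrow> (nat \<Rightarrow> real) \<Rightarrow> diagram \<Rightarrow> bool" where
  "shows_picture m c \<delta> \<Phi> a b k \<longleftrightarrow>
     (\<forall>j<m. \<exists>\<sigma>. \<sigma> (a j) = -1 \<and> \<sigma> (b j) = 1 \<and>
        (\<forall>t\<in>{a j..b j}. \<exists>d>0. (\<sigma> has_real_derivative d) (at t within {a j..b j})) \<and>
        (\<forall>t\<in>{a j..b j}. curve k t = \<Phi> (c j (\<delta> j * \<sigma> t)))) \<and>
     (\<forall>i j s t. i < j \<longrightarrow> j < m \<longrightarrow> s \<in> {a i..b i} \<longrightarrow> t \<in> {a j..b j} \<longrightarrow>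
        curve k s = curve k t \<longrightarrow> s \<in> over k)"

text \<open>
  \<open>k'\<close> arises from \<open>k\<close> by replacing the picture \<open>c\<close> in a disk by the picture \<open>c'\<close>. The
  diffeomorphisms \<open>\<Phi>\<close> and \<open>\<Phi>'\<close> have the same image, orientation behaviour and directions
  of strands, but may differ otherwise, because the pictures below do not match at the boundary
  of the disk.
\<close>

definition replaces_picture ::
  "nat \<Rightarrow> (nat \<Rightarrow> real \<Rightarrow> complex) \<Rightarrow> (nat \<Rightarrow> real \<Rightarrow> complex) \<Rightarrow>
   (nat \<Rightarrow> real) \<Rightarrow> (nat \<Rightarrow> real) \<Rightarrow> diagram \<Rightarrow> diagram \<Rightarrow> bool" where
  "replaces_picture m c c' a b k k' \<longleftrightarrow>
     strand_intervals m a b \<and>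
     (\<exists>\<epsilon> \<delta> \<Phi> \<Phi>'.
        \<epsilon> \<in> {-1, 1} \<and> (\<forall>j<m. \<delta> j \<in> {-1, 1}) \<and>
        disk_diffeo \<epsilon> \<Phi> \<and> disk_diffeo \<epsilon> \<Phi>' \<and> \<Phi> ` cball 0 1 = \<Phi>' ` cball 0 1 \<and>
        (\<forall>t. \<not> on_strand m a b t \<longrightarrow>
           curve k t \<notin> \<Phi> ` cball 0 1 \<and> curve k' t = curve k t \<and>
           (t \<in> over k' \<longleftrightarrow> t \<in> over k)) \<and>
        shows_picture m c \<delta> \<Phi> a b k \<and> shows_picture m c' \<delta> \<Phi>' a b k')"

text \<open>The kink crosses itself at the parameters \<open>-1/2\<close> and \<open>1/2\<close> only.\<close>

definition straight_arc :: "nat \<Rightarrow> real \<Rightarrow> complex" where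
  "straight_arc j t = of_real t"

definition kinked_arc :: "nat \<Rightarrow> real \<Rightarrow> complex" where
  "kinked_arc j t = Complex (t * (4 * t\<^sup>2 - 1) / 5) (4 * t\<^sup>2 / 5)"

text \<open>The two parabolas meet at the parameters \<open>-1/2\<close> and \<open>1/2\<close>, between which they bound a
  bigon.\<close>

definition disjoint_arcs :: "nat \<Rightarrow> real \<Rightarrow> complex" where
  "disjoint_arcs j t = Complex (4 * t / 5) (if j = 0 then 3 / 5 else - 3 / 5)"

definition bigon_arcs :: "nat \<Rightarrow> real \<Rightarrow> complex" where
  "bigon_arcs j t =
     Complex (4 * t / 5) (if j = 0 then (4 * t\<^sup>2 - 1) / 5 else - (4 * t\<^sup>2 - 1) / 5)"

text \<open>Strand 0 (top) lies above (\<open>y = 3 / 5\<close>) or below (\<open>y = - 3 / 5\<close>) the crossing at the origin of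
  strands 1 (middle) and 2 (bottom). By the symmetry of the triangle it does not matter which
  strand is the one that slides.\<close>

definition triangle_arcs :: "real \<Rightarrow> nat \<Rightarrow> real \<Rightarrow> complex" where
  "triangle_arcs y j t =
     (if j = 0 then Complex (4 * t / 5) y
      else if j = 1 then Complex (3 * t / 5) (4 * t / 5)
      else Complex (3 * t / 5) (- 4 * t / 5))"

text \<open>Strands 0, 1, 2 start at \<open>a 0\<close>, \<open>a 1\<close>, \<open>a 2\<close>, all in one period starting with strand 0.\<close>

definition passes_descending :: "(nat \<Rightarrow> real) \<Rightarrow> bool" where
  "passes_descending a \<longleftrightarrow> a 0 < a 1 \<and> a 1 < a 2"

definition up_to_direction_and_param ::
  "(diagram \<Rightarrow> diagram \<Rightarrow> bool) \<Rightarrow> diagram \<Rightarrow> diagram \<Rightarrow> bool" where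
  "up_to_direction_and_param R k k' \<longleftrightarrow>
     (\<exists>\<theta>. circle_diffeo \<theta> \<and> (R k (reparam \<theta> k') \<or> R (reparam \<theta> k') k))"

definition omega1 :: "diagram \<Rightarrow> diagram \<Rightarrow> bool" where
  "omega1 = up_to_direction_and_param
     (\<lambda>k k'. \<exists>a b. replaces_picture 1 straight_arc kinked_arc a b k k')"

definition omega2 :: "diagram \<Rightarrow> diagram \<Rightarrow> bool" where
  "omega2 = up_to_direction_and_param
     (\<lambda>k k'. \<exists>a b. replaces_picture 2 disjoint_arcs bigon_arcs a b k k')"

definition descending_omega3 :: "diagram \<Rightarrow> diagram \<Rightarrow> bool" where
  "descending_omega3 = up_to_direction_and_param
     (\<lambda>k k'. \<exists>a b. passes_descending a \<and>
        replaces_picture 3 (triangle_arcs (3 / 5)) (triangle_arcs (- 3 / 5)) a b k k')"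

definition ascending_omega3 :: "diagram \<Rightarrow> diagram \<Rightarrow> bool" where
  "ascending_omega3 = up_to_direction_and_param
     (\<lambda>k k'. \<exists>a b. \<not> passes_descending a \<and>
        replaces_picture 3 (triangle_arcs (3 / 5)) (triangle_arcs (- 3 / 5)) a b k k')"

end

theory Submission
  imports Defs
begin

text \<open>
  In \<open>a\<^sub>n\<close>, \<open>d\<^sub>n\<close> and \<open>w\<^sub>n\<close> heads and tails alternate, and no arrow joins neighbouring endpoints. A move
  changes only the arrows of crossings inside the disk. The arrow of a kink is isolated, so it occurs in
  no subdiagram of the given form. The two arrows of a bigon have neighbouring tails, so at most one
  of them occurs; exchanging them preserves the form and reverses the sign. Of the three arrows of a
  triangle, two can occur together only if they are top-to-middle and middle-to-bottom, since otherwise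
  they have neighbouring tails or heads. In \<open>a\<^sub>n\<close> (\<open>d\<^sub>n\<close>) two arrows whose head and tail are neighbours have
  their other endpoints three steps away in opposite directions, which for \<open>n \<ge> 4\<close> forces the strands to be
  passed in ascending (descending) order. Hence at most one arrow of the triangle occurs, and its
  endpoints may be slid along the strands to those of the corresponding arrow after the move.
\<close>


section \<open>Diffeomorphisms of the circle\<close>

text \<open>The obstacle is that \<open>has_form\<close> only asserts that some diffeomorphism of
  the circle exists, so both halves of the argument must pass through it. To exclude a subdiagram,
  that diffeomorphism is rescaled by \<open>2 * n\<close> on the line, where neighbouring endpoints
  carry neighbouring integers; the exclusions become arithmetic modulo \<open>2 * n\<close>. To
  slide an endpoint, a diffeomorphism supported in a single strand has to be produced and composed
  with the given one. The pictures before and after a move are images under different disk maps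
  \<Phi> and \<Phi>' with different parametrizations of the strands, so crossings cannot be matched
  by position. For moves with several strands each count is therefore brought to a form that depends
  only on shared data: the arrows outside the disk, the intervals, \<epsilon>, \<delta> and the
  explicit plane curves, with local endpoints slid to the midpoints of strands. Splitting the sum
  over subdiagrams requires a finite Gauss diagram, which comes from transversality, the immersion
  condition and compactness.\<close>

lemma circle_diffeoI:
  assumes "\<And>t. (\<theta> has_real_derivative D t) (at t)" "continuous_on UNIV D" "\<And>t. D t > 0"
    "\<And>t. \<theta> (t + 1) = \<theta> t + 1"
  shows "circle_diffeo \<theta>"
  unfolding circle_diffeo_def C1_differentiable_on_def
  using assms DERIV_imp_deriv[OF assms(1)]
  by (auto simp: has_real_derivative_iff_has_vector_derivative)

lemma circle_diffeo_deriv: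
  assumes "circle_diffeo \<theta>"
  shows "(\<theta> has_real_derivative deriv \<theta> t) (at t)" "deriv \<theta> t > 0" "continuous_on UNIV (deriv \<theta>)"
proof -
  obtain D where D: "\<And>x. (\<theta> has_vector_derivative D x) (at x)" "continuous_on UNIV D"
    using assms unfolding circle_diffeo_def C1_differentiable_on_def by auto
  have eq: "deriv \<theta> x = D x" for x
    using D(1)[of x] by (simp add: DERIV_imp_deriv has_real_derivative_iff_has_vector_derivative)
  show "(\<theta> has_real_derivative deriv \<theta> t) (at t)"
    using D(1)[of t] eq by (simp add: has_real_derivative_iff_has_vector_derivative)
  show "deriv \<theta> t > 0" using assms unfolding circle_diffeo_def by auto
  show "continuous_on UNIV (deriv \<theta>)" using D(2) eq by (simp cong: continuous_on_cong)
qed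

lemma circle_diffeo_strict_mono:
  assumes "circle_diffeo \<theta>"
  shows "strict_mono \<theta>"
proof (rule strict_monoI)
  fix x y :: real assume "x < y"
  then show "\<theta> x < \<theta> y"
    by (rule DERIV_pos_imp_increasing) (use circle_diffeo_deriv[OF assms] in blast)
qed

lemma circle_diffeo_isCont:
  assumes "circle_diffeo \<theta>"
  shows "isCont \<theta> x"
  using circle_diffeo_deriv(1)[OF assms] DERIV_isCont by blast

lemma circle_diffeo_add_int:
  assumes "circle_diffeo \<theta>"
  shows "\<theta> (x + of_int z) = \<theta> x + of_int z"
proof -
  have one: "\<theta> (t + 1) = \<theta> t + 1" for t using assms unfolding circle_diffeo_def by auto
  have nat: "\<theta> (t + of_nat n) = \<theta> t + of_nat n" for t n
  proof (induction n)
    case (Suc n)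
    show ?case using one[of "t + of_nat n"] Suc by (simp add: algebra_simps)
  qed simp
  show ?thesis
  proof (cases "z \<ge> 0")
    case True
    then show ?thesis using nat[of x "nat z"] by simp
  next
    case False
    then show ?thesis using nat[of "x + of_int z" "nat (- z)"] by simp
  qed
qed

lemma circle_diffeo_surj:
  assumes "circle_diffeo \<theta>"
  obtains x where "\<theta> x = y"
proof -
  define z where "z = \<lfloor>y - \<theta> 0\<rfloor>"
  have "\<theta> (0 + of_int z) \<le> y" "y \<le> \<theta> (0 + of_int (z + 1))"
    unfolding circle_diffeo_add_int[OF assms] z_def by linarith+
  then have "\<exists>x\<ge>0 + of_int z. x \<le> 0 + of_int (z + 1) \<and> \<theta> x = y"
    by (intro IVT) (auto intro: circle_diffeo_isCont[OF assms])
  then show thesis using that by blast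
qed

lemma circle_diffeo_comp:
  assumes "circle_diffeo \<theta>" "circle_diffeo \<psi>"
  shows "circle_diffeo (\<theta> \<circ> \<psi>)"
proof (rule circle_diffeoI)
  fix t
  show "(\<theta> \<circ> \<psi> has_real_derivative deriv \<theta> (\<psi> t) * deriv \<psi> t) (at t)"
    by (intro DERIV_chain circle_diffeo_deriv assms)
  show "0 < deriv \<theta> (\<psi> t) * deriv \<psi> t"
    by (intro mult_pos_pos circle_diffeo_deriv assms)
  show "(\<theta> \<circ> \<psi>) (t + 1) = (\<theta> \<circ> \<psi>) t + 1"
    using assms unfolding circle_diffeo_def by auto
next
  have "continuous_on UNIV \<psi>"
    using circle_diffeo_isCont[OF assms(2)] by (simp add: continuous_at_imp_continuous_on)
  then show "continuous_on UNIV (\<lambda>t. deriv \<theta> (\<psi> t) * deriv \<psi> t)"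
    by (intro continuous_on_mult circle_diffeo_deriv(3) assms
        continuous_on_compose2[OF circle_diffeo_deriv(3)[OF assms(1)]]) auto
qed

lemma circle_diffeo_inverse:
  assumes "circle_diffeo \<theta>"
  shows "\<exists>\<psi>. circle_diffeo \<psi> \<and> (\<forall>x. \<psi> (\<theta> x) = x) \<and> (\<forall>x. \<theta> (\<psi> x) = x)"
proof -
  define \<psi> where "\<psi> = inv \<theta>"
  have inj: "inj \<theta>" using circle_diffeo_strict_mono[OF assms] by (rule strict_mono_imp_inj_on)
  have "surj \<theta>" unfolding surj_def by (metis circle_diffeo_surj[OF assms])
  then have r: "\<theta> (\<psi> x) = x" for x unfolding \<psi>_def by (rule surj_f_inv_f)
  have l: "\<psi> (\<theta> x) = x" for x unfolding \<psi>_def using inj by simp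
  have cont: "isCont \<psi> x" for x
    using isCont_inverse_function[where f = \<theta> and g = \<psi> and x = "\<psi> x" and d = 1]
      l r circle_diffeo_isCont[OF assms] by auto
  have "circle_diffeo \<psi>"
  proof (rule circle_diffeoI)
    fix t
    show "(\<psi> has_real_derivative inverse (deriv \<theta> (\<psi> t))) (at t)"
    proof (rule DERIV_inverse_function[where a = "t - 1" and b = "t + 1"])
      show "(\<theta> has_real_derivative deriv \<theta> (\<psi> t)) (at (\<psi> t))"
        using circle_diffeo_deriv[OF assms] by blast
      show "deriv \<theta> (\<psi> t) \<noteq> 0" using circle_diffeo_deriv(2)[OF assms] by (metis less_irrefl)
    qed (auto simp: r cont)
    show "0 < inverse (deriv \<theta> (\<psi> t))" using circle_diffeo_deriv[OF assms] by auto
    have "\<theta> (\<psi> (t + 1)) = \<theta> (\<psi> t + 1)" using assms r unfolding circle_diffeo_def by metis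
    then show "\<psi> (t + 1) = \<psi> t + 1" using inj by (auto dest: injD)
  next
    have "continuous_on UNIV \<psi>" using cont by (simp add: continuous_at_imp_continuous_on)
    moreover have "deriv \<theta> (\<psi> t) \<noteq> 0" for t
      using circle_diffeo_deriv(2)[OF assms] by (metis less_irrefl)
    ultimately show "continuous_on UNIV (\<lambda>t. inverse (deriv \<theta> (\<psi> t)))"
      by (intro continuous_on_inverse continuous_on_compose2[OF circle_diffeo_deriv(3)[OF assms]])
        auto
  qed
  then show ?thesis using l r by blast
qed

lemma frac_eq_iff_add_int: "frac x = frac y \<longleftrightarrow> (\<exists>z::int. x = y + of_int z)" for x y :: real
proof
  assume "frac x = frac y"
  then have "x = y + of_int (\<lfloor>x\<rfloor> - \<lfloor>y\<rfloor>)" by (simp add: frac_def)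
  then show "\<exists>z::int. x = y + of_int z" ..
qed (auto simp: frac_def)

lemma frac_add_int [simp]: "frac (x + of_int z) = frac x" for x :: real
  by (simp add: frac_def)

lemma circle_diffeo_frac_eq_iff:
  assumes "circle_diffeo \<theta>"
  shows "frac (\<theta> x) = frac (\<theta> y) \<longleftrightarrow> frac x = frac y"
proof -
  have "\<theta> x = \<theta> y + of_int z \<longleftrightarrow> x = y + of_int z" for z
    using strict_mono_eq[OF circle_diffeo_strict_mono[OF assms], of x "y + of_int z"]
    by (simp add: circle_diffeo_add_int[OF assms])
  then show ?thesis by (simp add: frac_eq_iff_add_int)
qed

lemma circle_diffeo_frac:
  assumes "circle_diffeo \<theta>"
  shows "frac (\<theta> (frac x)) = frac (\<theta> x)"
  using circle_diffeo_frac_eq_iff[OF assms] by simp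

section \<open>Diffeomorphisms supported in an arc\<close>

text \<open>Squaring the positive part removes its corner at 0. This makes the bump function below
  C1 at the ends of its arc.\<close>

lemma DERIV_max_0_power2: "((\<lambda>x. (max 0 x)\<^sup>2) has_real_derivative 2 * max 0 x) (at x)"
proof (cases "x = 0")
  case True
  have "(\<lambda>h. ((max 0 (0 + h))\<^sup>2 - (max 0 0)\<^sup>2) / h) \<midarrow>0\<rightarrow> (0::real)"
  proof (rule Lim_null_comparison)
    show "\<forall>\<^sub>F h in at 0. norm (((max 0 (0 + h))\<^sup>2 - (max 0 0)\<^sup>2) / h) \<le> \<bar>h\<bar>"
      by (auto simp: max_def power2_eq_square)
  qed (auto intro!: tendsto_eq_intros)
  then show ?thesis using True by (simp add: DERIV_def)
next
  case False
  define f :: "real \<Rightarrow> real" where "f = (if x > 0 then (\<lambda>x. x\<^sup>2) else (\<lambda>x. 0))"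
  have "(f has_real_derivative 2 * max 0 x) (at x)"
    unfolding f_def by (auto intro!: derivative_eq_intros)
  then show ?thesis
    by (rule has_field_derivative_transform_within_open[where S = "if x > 0 then {0<..} else {..<0}"])
      (use False in \<open>auto simp: f_def split: if_splits\<close>)
qed

text \<open>On the period centred at the midpoint of the arc, this cosine decreases with the
  distance from the midpoint, and at both ends of the arc it equals
  \<open>cos (pi * (d - c))\<close>. As \<open>d - c < 1\<close>, this value separates the arc from
  the rest of the circle.\<close>

lemma cos_le_outside_arc:
  assumes "\<And>z::int. x + of_int z \<notin> {c<..<d}" "c < d" "d < c + 1"
  shows "cos (2 * pi * (x - (c + d) / 2)) \<le> cos (pi * (d - c))"
proof -
  \<comment> \<open>The translate of \<open>x\<close> in the period starting at \<open>c\<close>;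
    outside the arc it is either \<open>c\<close> itself or at least \<open>d\<close>.\<close>
  define y where "y = c + frac (x - c)"
  have y: "y = x + of_int (- \<lfloor>x - c\<rfloor>)" unfolding y_def frac_def by simp
  have "c \<le> y" "y < c + 1" unfolding y_def using frac_lt_1[of "x - c"] frac_ge_0[of "x - c"] by linarith+
  moreover have "y \<notin> {c<..<d}" unfolding y by (rule assms)
  moreover have "cos (2 * pi * (x - (c + d) / 2)) = cos (2 * pi * (y - (c + d) / 2))"
  proof -
    have "2 * pi * (y - (c + d) / 2) = 2 * pi * (x - (c + d) / 2) + of_int (- \<lfloor>x - c\<rfloor>) * (2 * pi)"
      unfolding y by (simp add: algebra_simps)
    then show ?thesis
      using cos.plus_of_int[of "2 * pi * (x - (c + d) / 2)" "- \<lfloor>x - c\<rfloor>"] by (simp only: of_real_eq_id id_apply)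
  qed
  moreover have "cos (2 * pi * (y - (c + d) / 2)) \<le> cos (pi * (d - c))" if "d \<le> y" "y < c + 1"
  proof (cases "2 * (y - (c + d) / 2) \<le> 1")
    case True
    have "pi * (d - c) \<le> pi * (2 * (y - (c + d) / 2))"
      by (intro mult_left_mono) (use that in \<open>auto simp: field_simps\<close>)
    moreover have "pi * (2 * (y - (c + d) / 2)) \<le> pi * 1"
      by (intro mult_left_mono) (use True in auto)
    moreover have "0 \<le> pi * (d - c)" using assms by simp
    ultimately have "cos (pi * (2 * (y - (c + d) / 2))) \<le> cos (pi * (d - c))"
      by (intro cos_monotone_0_pi_le) auto
    then show ?thesis by (simp add: mult_ac)
  next
    case False
    \<comment> \<open>Beyond the antipode of the midpoint the angle exceeds \<open>pi\<close>;
      replacing it by \<open>2 * pi\<close> minus itself keeps the cosine and returns to the range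
      where the cosine decreases.\<close>
    have "pi * (d - c) \<le> pi * (2 - 2 * (y - (c + d) / 2))"
      by (intro mult_left_mono) (use that in \<open>auto simp: field_simps\<close>)
    moreover have "pi * (2 - 2 * (y - (c + d) / 2)) \<le> pi * 1"
      by (intro mult_left_mono) (use False in auto)
    moreover have "0 \<le> pi * (d - c)" using assms by simp
    ultimately have "cos (pi * (2 - 2 * (y - (c + d) / 2))) \<le> cos (pi * (d - c))"
      by (intro cos_monotone_0_pi_le) auto
    moreover have "cos (pi * (2 - 2 * (y - (c + d) / 2))) = cos (2 * pi * (y - (c + d) / 2))"
    proof -
      have "pi * (2 - 2 * (y - (c + d) / 2)) = 2 * pi - 2 * pi * (y - (c + d) / 2)"
        by (simp add: algebra_simps)
      then show ?thesis by (simp add: cos_diff)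
    qed
    ultimately show ?thesis by simp
  qed
  moreover have "cos (2 * pi * (y - (c + d) / 2)) \<le> cos (pi * (d - c))" if "y = c"
  proof -
    have "2 * pi * (y - (c + d) / 2) = - (pi * (d - c))" using that by (simp add: field_simps)
    then show ?thesis by (metis cos_minus order_refl)
  qed
  ultimately show ?thesis by force
qed

lemma cos_gt_inside_arc:
  assumes "x \<in> {c<..<d}" "d < c + (1::real)"
  shows "cos (pi * (d - c)) < cos (2 * pi * (x - (c + d) / 2))"
proof -
  have "cos (pi * (d - c)) < cos (pi * \<bar>2 * (x - (c + d) / 2)\<bar>)"
  proof (rule cos_monotone_0_pi)
    show "pi * \<bar>2 * (x - (c + d) / 2)\<bar> < pi * (d - c)"
      using assms by (intro mult_strict_left_mono) (auto simp: abs_if field_simps)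
    show "pi * (d - c) \<le> pi" using assms by simp
  qed simp
  also have "pi * \<bar>2 * (x - (c + d) / 2)\<bar> = \<bar>2 * pi * (x - (c + d) / 2)\<bar>"
    by (simp only: abs_mult) simp
  finally show ?thesis by simp
qed

text \<open>A small multiple of the periodic \<open>C\<^sup>1\<close> bump function
  \<open>max 0 (cos (2 \<pi> (x - (c + d) / 2)) - cos (\<pi> (d - c)))\<^sup>2\<close> is added to the identity.\<close>

lemma circle_diffeo_push:
  assumes "c < d" "d < c + 1" "p \<in> {c<..<d}"
  obtains r where "r > 0"
    "\<And>q. \<bar>q - p\<bar> < r \<Longrightarrow> \<exists>\<psi>. circle_diffeo \<psi> \<and> \<psi> p = q \<and> (\<forall>x. (\<forall>z::int. x + of_int z \<notin> {c<..<d}) \<longrightarrow> \<psi> x = x)"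
proof -
  define m where "m = (c + d) / 2"
  define w where "w = (\<lambda>x. cos (2 * pi * (x - m)) - cos (pi * (d - c)))"
  define g where "g = (\<lambda>x. (max 0 (w x))\<^sup>2)"
  define g' where "g' = (\<lambda>x. 2 * max 0 (w x) * (- (sin (2 * pi * (x - m)) * (2 * pi))))"
  have g: "(g has_real_derivative g' x) (at x)" for x
  proof -
    have "(w has_real_derivative - (sin (2 * pi * (x - m)) * (2 * pi))) (at x)"
      unfolding w_def by (auto intro!: derivative_eq_intros)
    from DERIV_chain[OF DERIV_max_0_power2 this] show ?thesis
      unfolding g_def g'_def comp_def .
  qed
  \<comment> \<open>Since \<open>w x \<le> 2\<close> and a sine is at most 1 in absolute value, the
    constant is \<open>2 * 2 * (2 * pi)\<close>.\<close>
  have g'_bound: "\<bar>g' x\<bar> \<le> 8 * pi" for x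
  proof -
    have "w x \<le> 2" unfolding w_def
      using cos_le_one[of "2 * pi * (x - m)"] cos_ge_minus_one[of "pi * (d - c)"] by linarith
    then have "\<bar>2 * max 0 (w x)\<bar> \<le> 4" by auto
    moreover have "\<bar>- (sin (2 * pi * (x - m)) * (2 * pi))\<bar> \<le> 2 * pi"
      by (simp add: abs_mult)
    ultimately have "\<bar>2 * max 0 (w x)\<bar> * \<bar>- (sin (2 * pi * (x - m)) * (2 * pi))\<bar> \<le> 4 * (2 * pi)"
      by (intro mult_mono) auto
    then show ?thesis unfolding g'_def by (simp only: abs_mult[symmetric])
  qed
  have gp: "g p > 0" unfolding g_def w_def m_def using cos_gt_inside_arc[OF assms(3,2)] by simp
  \<comment> \<open>The radius is the displacement of \<open>p\<close> for the coefficient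
    \<open>1 / (8 * pi + 1)\<close>; every smaller coefficient \<open>s\<close> keeps the derivative
    \<open>1 + s * g' t\<close> positive.\<close>
  define r where "r = g p / (8 * pi + 1)"
  have pos: "8 * pi + 1 > 0" by (simp add: add_pos_pos)
  have "r > 0" unfolding r_def using gp pos by simp
  moreover have "\<exists>\<psi>. circle_diffeo \<psi> \<and> \<psi> p = q \<and> (\<forall>x. (\<forall>z::int. x + of_int z \<notin> {c<..<d}) \<longrightarrow> \<psi> x = x)"
    if q: "\<bar>q - p\<bar> < r" for q
  proof (intro exI conjI allI impI)
    define s where "s = (q - p) / g p"
    define \<psi> where "\<psi> = (\<lambda>x. x + s * g x)"
    have s: "\<bar>s\<bar> < 1 / (8 * pi + 1)"
    proof -
      have "\<bar>s\<bar> = \<bar>q - p\<bar> / g p" unfolding s_def using gp by simp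
      also have "\<dots> < r / g p" using q gp by (rule divide_strict_right_mono)
      also have "\<dots> = 1 / (8 * pi + 1)" unfolding r_def using gp by simp
      finally show ?thesis .
    qed
    show "circle_diffeo \<psi>"
    proof (rule circle_diffeoI)
      fix t
      show "(\<psi> has_real_derivative 1 + s * g' t) (at t)"
        unfolding \<psi>_def by (auto intro!: derivative_eq_intros g)
      have "\<bar>s * g' t\<bar> \<le> \<bar>s\<bar> * (8 * pi)" unfolding abs_mult using g'_bound by (intro mult_left_mono) auto
      also have "\<dots> \<le> 1 / (8 * pi + 1) * (8 * pi)" using s by (intro mult_right_mono) auto
      also have "\<dots> < 1" using pos by (simp add: field_simps)
      finally show "0 < 1 + s * g' t" by linarith
      have "2 * pi * (t + 1 - m) = 2 * pi * (t - m) + 2 * pi" by (simp add: algebra_simps)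
      then show "\<psi> (t + 1) = \<psi> t + 1" unfolding \<psi>_def g_def w_def by simp
    next
      show "continuous_on UNIV (\<lambda>t. 1 + s * g' t)"
        unfolding g'_def w_def by (intro continuous_intros)
    qed
    show "\<psi> p = q" unfolding \<psi>_def s_def using gp by simp
    fix x assume "\<forall>z::int. x + of_int z \<notin> {c<..<d}"
    then have "w x \<le> 0" unfolding w_def m_def
      using cos_le_outside_arc[OF _ assms(1,2), of x] by auto
    then show "\<psi> x = x" unfolding \<psi>_def g_def by (simp add: max_def)
  qed
  ultimately show thesis using that by blast
qed

text \<open>A single push reaches only nearby points, as the derivative must stay positive. Being
  joined by a diffeomorphism that fixes the complement of the arc is an equivalence relation on the
  arc; its classes are open by pushing, so connectedness leaves only one.\<close>

lemma circle_diffeo_move: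
  assumes "d < c + 1" "p \<in> {c<..<d}" "q \<in> {c<..<d}"
  shows "\<exists>\<psi>. circle_diffeo \<psi> \<and> \<psi> p = q \<and> (\<forall>x. (\<forall>z::int. x + of_int z \<notin> {c<..<d}) \<longrightarrow> \<psi> x = x)"
proof -
  define fixes_outside where
    "fixes_outside \<psi> \<longleftrightarrow> (\<forall>x. (\<forall>z::int. x + of_int z \<notin> {c<..<d}) \<longrightarrow> \<psi> x = x)" for \<psi>
  define R where "R x y \<longleftrightarrow> (\<exists>\<psi>. circle_diffeo \<psi> \<and> \<psi> x = y \<and> fixes_outside \<psi>)" for x y
  have "R p q"
  proof (rule connected_equivalence_relation[where S = "{c<..<d}"])
    fix x y assume "R x y"
    then obtain \<psi> where \<psi>: "circle_diffeo \<psi>" "\<psi> x = y" "fixes_outside \<psi>" unfolding R_def by blast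
    obtain \<phi> where \<phi>: "circle_diffeo \<phi>" "\<forall>x. \<phi> (\<psi> x) = x"
      using circle_diffeo_inverse[OF \<psi>(1)] by blast
    have "\<phi> x = x" if "\<psi> x = x" for x using \<phi>(2) that by metis
    then have "fixes_outside \<phi>" using \<psi>(3) unfolding fixes_outside_def by blast
    then show "R y x" using \<phi> \<psi>(2) unfolding R_def by blast
  next
    fix x y z assume "R x y" "R y z"
    then obtain \<psi> \<phi> where "circle_diffeo \<psi>" "\<psi> x = y" "fixes_outside \<psi>"
      "circle_diffeo \<phi>" "\<phi> y = z" "fixes_outside \<phi>" unfolding R_def by blast
    then have "circle_diffeo (\<phi> \<circ> \<psi>)" "(\<phi> \<circ> \<psi>) x = z" "fixes_outside (\<phi> \<circ> \<psi>)"
      by (auto simp: circle_diffeo_comp fixes_outside_def)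
    then show "R x z" unfolding R_def by blast
  next
    fix x assume x: "x \<in> {c<..<d}"
    then have "c < d" by auto
    obtain r where r: "r > 0" "\<And>y. \<bar>y - x\<bar> < r \<Longrightarrow> R x y"
      using circle_diffeo_push[OF \<open>c < d\<close> assms(1) x] unfolding R_def fixes_outside_def by metis
    have "openin (top_of_set {c<..<d}) ({c<..<d} \<inter> ball x r)"
      by (intro openin_open_Int) auto
    then show "\<exists>T. openin (top_of_set {c<..<d}) T \<and> x \<in> T \<and> (\<forall>y\<in>T. R x y)"
      using r x by (intro exI[of _ "{c<..<d} \<inter> ball x r"]) (auto simp: dist_real_def abs_minus_commute)
  qed (use assms in auto)
  then show ?thesis unfolding R_def fixes_outside_def .
qed


section \<open>Moving endpoints of arrows\<close>

definition push_arrows :: "(real \<Rightarrow> real) \<Rightarrow> (real \<times> real \<times> int) set \<Rightarrow> (real \<times> real \<times> int) set" where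
  "push_arrows \<phi> S = (\<lambda>(t, h, e). (frac (\<phi> t), frac (\<phi> h), e)) ` S"

lemma unsigned_push_arrows:
  "unsigned (push_arrows \<phi> S) = (\<lambda>(t, h). (frac (\<phi> t), frac (\<phi> h))) ` unsigned S"
  unfolding push_arrows_def unsigned_def by (force simp: image_image)

lemma has_form_cong_unsigned: "unsigned S = unsigned T \<Longrightarrow> has_form n X S \<longleftrightarrow> has_form n X T"
  by (simp add: has_form_def)

lemma has_form_push_arrowsD:
  assumes "circle_diffeo \<phi>" "has_form n X (push_arrows \<phi> S)"
  shows "has_form n X S"
proof -
  obtain \<theta> where \<theta>: "circle_diffeo \<theta>"
    "(\<lambda>(t, h). (frac (\<theta> t), frac (\<theta> h))) ` unsigned (push_arrows \<phi> S) =
     (\<lambda>(p, q). (real p / real (2 * n), real q / real (2 * n))) ` X"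
    using assms(2) unfolding has_form_def by blast
  have "(\<lambda>(t, h). (frac (\<theta> t), frac (\<theta> h))) ` unsigned (push_arrows \<phi> S) =
    (\<lambda>(t, h). (frac ((\<theta> \<circ> \<phi>) t), frac ((\<theta> \<circ> \<phi>) h))) ` unsigned S"
    unfolding unsigned_push_arrows image_image
    by (intro image_cong) (auto simp: circle_diffeo_frac[OF \<theta>(1)])
  then show ?thesis using \<theta>(2) circle_diffeo_comp[OF \<theta>(1) assms(1)] unfolding has_form_def by (metis (no_types))
qed

lemma has_form_push_arrows_iff:
  assumes "circle_diffeo \<phi>"
  shows "has_form n X (push_arrows \<phi> S) \<longleftrightarrow> has_form n X S"
proof
  assume form: "has_form n X S"
  obtain \<psi> where \<psi>: "circle_diffeo \<psi>" "\<forall>x. \<psi> (\<phi> x) = x"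
    using circle_diffeo_inverse[OF assms] by blast
  obtain \<theta> where \<theta>: "circle_diffeo \<theta>"
    "(\<lambda>(t, h). (frac (\<theta> t), frac (\<theta> h))) ` unsigned S =
     (\<lambda>(p, q). (real p / real (2 * n), real q / real (2 * n))) ` X"
    using form unfolding has_form_def by blast
  \<comment> \<open>The integer parts discarded by \<open>push_arrows\<close> are harmless because
    \<open>\<theta> \<circ> \<psi>\<close> commutes with integer translations.\<close>
  have frac: "frac ((\<theta> \<circ> \<psi>) (frac (\<phi> t))) = frac (\<theta> t)" for t
    using circle_diffeo_frac[OF circle_diffeo_comp[OF \<theta>(1) \<psi>(1)], of "\<phi> t"] \<psi>(2) by simp
  have "(\<lambda>(t, h). (frac ((\<theta> \<circ> \<psi>) t), frac ((\<theta> \<circ> \<psi>) h))) ` unsigned (push_arrows \<phi> S) =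
    (\<lambda>(t, h). (frac (\<theta> t), frac (\<theta> h))) ` unsigned S"
    unfolding unsigned_push_arrows image_image
    by (intro image_cong) (auto simp: frac simp del: comp_apply)
  then show "has_form n X (push_arrows \<phi> S)"
    using \<theta>(2) circle_diffeo_comp[OF \<theta>(1) \<psi>(1)] unfolding has_form_def by (metis (no_types))
qed (rule has_form_push_arrowsD[OF assms])

definition ends :: "(real \<times> real \<times> int) set \<Rightarrow> real set" where
  "ends S = (\<Union>(t, h, e)\<in>S. {frac t, frac h})"

lemma ends_Un [simp]: "ends (S \<union> T) = ends S \<union> ends T"
  by (simp add: ends_def)

lemma ends_mono: "S \<subseteq> T \<Longrightarrow> ends S \<subseteq> ends T"
  by (auto simp: ends_def)

lemma endsI: "(t, h, e) \<in> S \<Longrightarrow> frac t \<in> ends S" "(t, h, e) \<in> S \<Longrightarrow> frac h \<in> ends S"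
  by (force simp: ends_def)+

text \<open>One diffeomorphism is supported in the arc of the tails, a second in the arc of the
  heads. The arcs are disjoint on the circle, so neither disturbs the point moved by the other, and
  the endpoints of \<open>S\<close> lie outside both. As these endpoints are representatives in
  \<open>{0..<1}\<close>, the arrows of \<open>S\<close> stay literally the same. The sign may pass
  from \<open>e\<close> to \<open>e'\<close> since forms disregard it.\<close>

lemma has_form_insert_move:
  assumes "d < c + 1" "d' < c' + 1"
    and tails: "p \<in> {c<..<d}" "p' \<in> {c<..<d}" and heads: "q \<in> {c'<..<d'}" "q' \<in> {c'<..<d'}"
    and disj: "frac ` {c<..<d} \<inter> frac ` {c'<..<d'} = {}"
    and S: "\<forall>(t, h, e)\<in>S. frac t = t \<and> frac h = h"
      "ends S \<inter> frac ` {c<..<d} = {}" "ends S \<inter> frac ` {c'<..<d'} = {}"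
    and form: "has_form n X (insert (frac p, frac q, e) S)"
  shows "has_form n X (insert (frac p', frac q', e') S)"
proof -
  obtain \<phi> where \<phi>: "circle_diffeo \<phi>" "\<phi> p = p'"
    "\<And>x. (\<And>z::int. x + of_int z \<notin> {c<..<d}) \<Longrightarrow> \<phi> x = x"
    using circle_diffeo_move[OF assms(1) tails] by blast
  obtain \<psi> where \<psi>: "circle_diffeo \<psi>" "\<psi> q = q'"
    "\<And>x. (\<And>z::int. x + of_int z \<notin> {c'<..<d'}) \<Longrightarrow> \<psi> x = x"
    using circle_diffeo_move[OF assms(2) heads] by blast
  have out: "x + of_int z \<notin> I" if "frac x \<notin> frac ` I" for x :: real and z :: int and I
    using that frac_add_int[of x z] by (metis image_eqI)
  have "frac p' \<notin> frac ` {c'<..<d'}" "frac q \<notin> frac ` {c<..<d}"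
    using disj tails heads by blast+
  then have "\<psi> p' = p'" "\<phi> q = q"
    using out \<phi>(3) \<psi>(3) by metis+
  have push: "frac ((\<psi> \<circ> \<phi>) (frac p)) = frac p'" "frac ((\<psi> \<circ> \<phi>) (frac q)) = frac q'"
    unfolding circle_diffeo_frac[OF circle_diffeo_comp[OF \<psi>(1) \<phi>(1)]]
    using \<phi>(2) \<psi>(2) \<open>\<psi> p' = p'\<close> \<open>\<phi> q = q\<close> by simp_all
  have fix_ends: "(\<psi> \<circ> \<phi>) x = x" if "x \<in> ends S" "frac x = x" for x
  proof -
    have "\<phi> x = x" by (rule \<phi>(3), rule out) (use that S(2) in auto)
    moreover have "\<psi> x = x" by (rule \<psi>(3), rule out) (use that S(3) in auto)
    ultimately show ?thesis by simp
  qed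
  have "push_arrows (\<psi> \<circ> \<phi>) S = id ` S"
    unfolding push_arrows_def
  proof (rule image_cong)
    fix x assume "x \<in> S"
    obtain t h e where x: "x = (t, h, e)" by (cases x)
    have "frac t = t" "frac h = h" using S(1) \<open>x \<in> S\<close> x by auto
    then have "(\<psi> \<circ> \<phi>) t = t" "(\<psi> \<circ> \<phi>) h = h"
      using endsI[OF \<open>x \<in> S\<close>[unfolded x]] by (auto intro!: fix_ends simp del: comp_apply)
    then show "(\<lambda>(t, h, e). (frac ((\<psi> \<circ> \<phi>) t), frac ((\<psi> \<circ> \<phi>) h), e)) x = id x"
      using \<open>frac t = t\<close> \<open>frac h = h\<close> by (simp add: x)
  qed simp
  then have "push_arrows (\<psi> \<circ> \<phi>) (insert (frac p, frac q, e) S) = insert (frac p', frac q', e) S"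
    using push by (simp add: push_arrows_def)
  then have "has_form n X (insert (frac p', frac q', e) S)"
    using has_form_push_arrows_iff[OF circle_diffeo_comp[OF \<psi>(1) \<phi>(1)]] form by metis
  then show ?thesis
    by (subst has_form_cong_unsigned[where T = "insert (frac p', frac q', e) S"]) (auto simp: unsigned_def)
qed


section \<open>Cyclic order of the endpoints\<close>

text \<open>By the last clause no arrow joins neighbouring positions; \<open>z\<close> accounts for the wrap-around.\<close>

definition alternating :: "nat \<Rightarrow> (nat \<times> nat) set \<Rightarrow> bool" where
  "alternating n X \<longleftrightarrow> n > 0 \<and> (\<forall>p<2 * n. \<exists>(t, h)\<in>X. p = t \<or> p = h) \<and>
     (\<exists>r. \<forall>(t, h)\<in>X. (even t \<longleftrightarrow> r) \<and> (even h \<longleftrightarrow> \<not> r)) \<and>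
     (\<forall>(t, h)\<in>X. \<forall>z. int t - int h + 2 * int n * z \<notin> {1, -1})"

lemma alternatingD:
  assumes "alternating n X"
  shows "n > 0" and "p < 2 * n \<Longrightarrow> \<exists>(t, h)\<in>X. p = t \<or> p = h"
    and "\<exists>r. \<forall>(t, h)\<in>X. (even t \<longleftrightarrow> r) \<and> (even h \<longleftrightarrow> \<not> r)"
    and "(t, h) \<in> X \<Longrightarrow> int t - int h + 2 * int n * z \<notin> {1, -1}"
proof -
  note A = assms[unfolded alternating_def]
  show "n > 0" by (rule A[THEN conjunct1])
  show "\<exists>(t, h)\<in>X. p = t \<or> p = h" if "p < 2 * n"
    by (rule A[THEN conjunct2, THEN conjunct1, rule_format, OF that])
  show "\<exists>r. \<forall>(t, h)\<in>X. (even t \<longleftrightarrow> r) \<and> (even h \<longleftrightarrow> \<not> r)"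
    by (rule A[THEN conjunct2, THEN conjunct2, THEN conjunct1])
  show "int t - int h + 2 * int n * z \<notin> {1, -1}" if "(t, h) \<in> X"
  proof -
    have "\<forall>z. int t - int h + 2 * int n * z \<notin> {1, -1}"
      using bspec[OF A[THEN conjunct2, THEN conjunct2, THEN conjunct2] that] unfolding prod.case .
    then show ?thesis by (rule spec)
  qed
qed

text \<open>Stated for lifts, so that the two points single out one of the arcs between them;
  \<open>min\<close> and \<open>max\<close> leave open in which direction a picture traverses the
  strand.\<close>

definition consecutive :: "(real \<times> real \<times> int) set \<Rightarrow> real \<Rightarrow> real \<Rightarrow> bool" where
  "consecutive S x y \<longleftrightarrow> x \<noteq> y \<and> (\<forall>w. min x y < w \<longrightarrow> w < max x y \<longrightarrow> frac w \<notin> ends S)"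

text \<open>This is all that the exclusion arguments retain of the diffeomorphism. Arrows are given
  by arbitrary lifts of their endpoints, so positions are recovered only modulo
  \<open>2 * n\<close>, independently for tail and head.\<close>

definition labelling :: "nat \<Rightarrow> (nat \<times> nat) set \<Rightarrow> (real \<times> real \<times> int) set \<Rightarrow> (real \<Rightarrow> real) \<Rightarrow> bool" where
  "labelling n X S \<Lambda> \<longleftrightarrow> strict_mono \<Lambda> \<and> (\<forall>x. \<Lambda> (x + 1) = \<Lambda> x + 2 * real n) \<and>
     (\<forall>x y e. (frac x, frac y, e) \<in> S \<longrightarrow>
        (\<exists>(p, q)\<in>X. \<exists>z w. \<Lambda> x = of_int (int p + 2 * int n * z) \<and> \<Lambda> y = of_int (int q + 2 * int n * w))) \<and>
     (\<forall>x y. consecutive S x y \<longrightarrow> \<Lambda> x \<in> \<int> \<longrightarrow> \<Lambda> y \<in> \<int> \<longrightarrow> \<Lambda> y = \<Lambda> x + 1 \<or> \<Lambda> x = \<Lambda> y + 1)"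

lemma labellingD:
  assumes "labelling n X S \<Lambda>"
  shows "strict_mono \<Lambda>"
    and "\<And>x. \<Lambda> (x + 1) = \<Lambda> x + 2 * real n"
    and "\<And>x y e. (frac x, frac y, e) \<in> S \<Longrightarrow>
      \<exists>(p, q)\<in>X. \<exists>z w. \<Lambda> x = of_int (int p + 2 * int n * z) \<and> \<Lambda> y = of_int (int q + 2 * int n * w)"
    and "\<And>x y. consecutive S x y \<Longrightarrow> \<Lambda> x \<in> \<int> \<Longrightarrow> \<Lambda> y \<in> \<int> \<Longrightarrow> \<Lambda> y = \<Lambda> x + 1 \<or> \<Lambda> x = \<Lambda> y + 1"
proof -
  note L = assms[unfolded labelling_def]
  show "strict_mono \<Lambda>" by (rule L[THEN conjunct1])
  show "\<Lambda> (x + 1) = \<Lambda> x + 2 * real n" for x by (rule L[THEN conjunct2, THEN conjunct1, rule_format])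
  show "\<exists>(p, q)\<in>X. \<exists>z w. \<Lambda> x = of_int (int p + 2 * int n * z) \<and> \<Lambda> y = of_int (int q + 2 * int n * w)"
    if "(frac x, frac y, e) \<in> S" for x y e
    by (rule L[THEN conjunct2, THEN conjunct2, THEN conjunct1, rule_format, OF that])
  show "\<Lambda> y = \<Lambda> x + 1 \<or> \<Lambda> x = \<Lambda> y + 1" if "consecutive S x y" "\<Lambda> x \<in> \<int>" "\<Lambda> y \<in> \<int>" for x y
    by (rule L[THEN conjunct2, THEN conjunct2, THEN conjunct2, rule_format, OF that])
qed

text \<open>The diffeomorphism, scaled by \<open>2 * n\<close>, labels the lifts of the endpoints by consecutive integers.\<close>

lemma has_form_labelling:
  assumes form: "has_form n X S" and n: "n > 0"
    and cover: "\<And>p. p < 2 * n \<Longrightarrow> \<exists>(t, h)\<in>X. p = t \<or> p = h"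
  shows "\<exists>\<Lambda>. labelling n X S \<Lambda>"
proof -
  obtain \<theta> where \<theta>: "circle_diffeo \<theta>" and eq:
    "(\<lambda>(t, h). (frac (\<theta> t), frac (\<theta> h))) ` unsigned S =
     (\<lambda>(p, q). (real p / real (2 * n), real q / real (2 * n))) ` X"
    using form unfolding has_form_def by blast
  define \<Lambda> where "\<Lambda> x = 2 * real n * \<theta> x" for x
  have mono: "strict_mono \<Lambda>"
    unfolding \<Lambda>_def using strict_monoD[OF circle_diffeo_strict_mono[OF \<theta>]] n
    by (intro strict_monoI) simp
  have label: "\<Lambda> x = of_int (int p + 2 * int n * \<lfloor>\<theta> x\<rfloor>)" if "frac (\<theta> x) = real p / real (2 * n)" for x p
  proof -
    have "\<theta> x = real p / real (2 * n) + of_int \<lfloor>\<theta> x\<rfloor>" using that by (simp add: frac_def)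
    then have "\<Lambda> x = 2 * real n * (real p / real (2 * n) + of_int \<lfloor>\<theta> x\<rfloor>)" unfolding \<Lambda>_def by simp
    also have "\<dots> = of_int (int p + 2 * int n * \<lfloor>\<theta> x\<rfloor>)" using n by (simp add: field_simps)
    finally show ?thesis .
  qed
  have arrows: "\<exists>(p, q)\<in>X. \<exists>z w. \<Lambda> x = of_int (int p + 2 * int n * z) \<and> \<Lambda> y = of_int (int q + 2 * int n * w)"
    if "(frac x, frac y, e) \<in> S" for x y e
  proof -
    have "(frac x, frac y) \<in> unsigned S" using that unfolding unsigned_def by force
    then have "(frac (\<theta> x), frac (\<theta> y)) \<in> (\<lambda>(t, h). (frac (\<theta> t), frac (\<theta> h))) ` unsigned S"
      by (intro image_eqI[where x = "(frac x, frac y)"]) (simp_all add: circle_diffeo_frac[OF \<theta>])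
    then obtain p q where "(p, q) \<in> X" "frac (\<theta> x) = real p / real (2 * n)" "frac (\<theta> y) = real q / real (2 * n)"
      unfolding eq by auto
    then show ?thesis using label by blast
  qed
  \<comment> \<open>Here the covering assumption enters: every integer is the residue of a position
    used by \<open>X\<close>, so no label is left without an endpoint.\<close>
  have labels_are_ends: "frac w \<in> ends S" if int: "\<Lambda> w = of_int P" for w P
  proof -
    define p where "p = nat (P mod (2 * int n))"
    have p: "p < 2 * n" "int p = P mod (2 * int n)" using n by (auto simp: p_def nat_less_iff)
    have "real_of_int P = of_int (int p + 2 * int n * (P div (2 * int n)))" using p(2) by simp
    then have "\<theta> w = real p / real (2 * n) + of_int (P div (2 * int n))"
      using int n unfolding \<Lambda>_def by (simp add: field_simps)
    then have "frac (\<theta> w) = frac (real p / real (2 * n))" by (simp only: frac_add_int)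
    also have "\<dots> = real p / real (2 * n)" using p(1) by (simp add: frac_eq)
    finally have w: "frac (\<theta> w) = real p / real (2 * n)" .
    obtain a b where "(a, b) \<in> X" "p = a \<or> p = b" using cover[OF p(1)] by auto
    then have "(real a / real (2 * n), real b / real (2 * n)) \<in> (\<lambda>(t, h). (frac (\<theta> t), frac (\<theta> h))) ` unsigned S"
      unfolding eq by force
    then obtain t h where th: "(t, h) \<in> unsigned S" "frac (\<theta> t) = real a / real (2 * n)"
      "frac (\<theta> h) = real b / real (2 * n)" by auto
    then have "frac (\<theta> w) = frac (\<theta> t) \<or> frac (\<theta> w) = frac (\<theta> h)" using w \<open>p = a \<or> p = b\<close> by auto
    then have "frac w = frac t \<or> frac w = frac h" by (simp add: circle_diffeo_frac_eq_iff[OF \<theta>])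
    moreover obtain e where "(t, h, e) \<in> S" using th(1) unfolding unsigned_def by auto
    ultimately show ?thesis using endsI by metis
  qed
  have gap: "\<Lambda> y = \<Lambda> x + 1"
    if "x < y" "\<Lambda> x \<in> \<int>" "\<Lambda> y \<in> \<int>" and gap: "\<And>w. x < w \<Longrightarrow> w < y \<Longrightarrow> frac w \<notin> ends S" for x y
  proof -
    obtain P Q where PQ: "\<Lambda> x = of_int P" "\<Lambda> y = of_int Q" using \<open>\<Lambda> x \<in> \<int>\<close> \<open>\<Lambda> y \<in> \<int>\<close> by (auto elim!: Ints_cases)
    have "P < Q" using strict_monoD[OF mono \<open>x < y\<close>] PQ by simp
    moreover have False if "P + 1 < Q"
    proof -
      \<comment> \<open>An integer strictly between the two labels would belong to an endpoint
        inside the gap.\<close>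
      obtain w where "\<theta> w = of_int (P + 1) / (2 * real n)" using circle_diffeo_surj[OF \<theta>] .
      then have w: "\<Lambda> w = of_int (P + 1)" unfolding \<Lambda>_def using n by simp
      have "\<Lambda> x < \<Lambda> w" "\<Lambda> w < \<Lambda> y" using w PQ that by simp_all
      then have "x < w" "w < y" using strict_mono_less[OF mono] by blast+
      then show False using gap labels_are_ends[OF w] by blast
    qed
    ultimately have "Q = P + 1" by (cases "P + 1 < Q") auto
    then show ?thesis using PQ by simp
  qed
  have "\<Lambda> y = \<Lambda> x + 1 \<or> \<Lambda> x = \<Lambda> y + 1" if "consecutive S x y" "\<Lambda> x \<in> \<int>" "\<Lambda> y \<in> \<int>" for x y
  proof (cases "x < y")
    case True
    then show ?thesis using gap[of x y] that unfolding consecutive_def by (simp add: min_def max_def)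
  next
    case False
    then have "y < x" using that(1) unfolding consecutive_def by simp
    then show ?thesis using gap[of y x] that unfolding consecutive_def by (simp add: min_def max_def)
  qed
  moreover have "\<Lambda> (x + 1) = \<Lambda> x + 2 * real n" for x
    using circle_diffeo_add_int[OF \<theta>, of x 1] unfolding \<Lambda>_def by (simp add: distrib_left)
  ultimately show ?thesis unfolding labelling_def using mono arrows
    by (intro exI[of _ \<Lambda>] conjI allI impI)
qed

lemma alternating_labelling:
  assumes "has_form n X S" "alternating n X"
  shows "\<exists>\<Lambda>. labelling n X S \<Lambda>"
proof (rule has_form_labelling[OF assms(1)])
  show "n > 0" by (rule alternatingD(1)[OF assms(2)])
  show "\<exists>(t, h)\<in>X. p = t \<or> p = h" if "p < 2 * n" for p by (rule alternatingD(2)[OF assms(2) that])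
qed

text \<open>Neighbours have labels differing by 1, hence of opposite parity, and reduction modulo
  the even number \<open>2 * n\<close> preserves parity; but all tails sit at positions of one
  parity.\<close>

lemma no_consecutive_tails:
  assumes form: "has_form n X S" and alt: "alternating n X"
    and arrows: "(frac x, h, e) \<in> S" "(frac x', h', e') \<in> S" and h: "frac h = h" "frac h' = h'"
  shows "\<not> consecutive S x x'"
proof
  assume cons: "consecutive S x x'"
  obtain \<Lambda> where \<Lambda>: "labelling n X S \<Lambda>" using alternating_labelling[OF form alt] by blast
  note arrow = labellingD(3)[OF \<Lambda>] and adj = labellingD(4)[OF \<Lambda>]
  obtain r where "\<forall>(t, h)\<in>X. (even t \<longleftrightarrow> r) \<and> (even h \<longleftrightarrow> \<not> r)" using alternatingD(3)[OF alt] by blast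
  then have r: "\<And>t h. (t, h) \<in> X \<Longrightarrow> even t \<longleftrightarrow> r" by auto
  obtain p q z where 1: "(p, q) \<in> X" "\<Lambda> x = of_int (int p + 2 * int n * z)"
    using arrow[of x h e] arrows h by auto
  obtain p' q' z' where 2: "(p', q') \<in> X" "\<Lambda> x' = of_int (int p' + 2 * int n * z')"
    using arrow[of x' h' e'] arrows h by auto
  have "\<Lambda> x' = \<Lambda> x + 1 \<or> \<Lambda> x = \<Lambda> x' + 1" by (rule adj[OF cons]) (simp_all only: 1 2 Ints_of_int)
  then have "real_of_int (int p' + 2 * int n * z') = of_int (int p + 2 * int n * z + 1) \<or>
     real_of_int (int p + 2 * int n * z) = of_int (int p' + 2 * int n * z' + 1)" unfolding 1 2 by simp
  then have "int p' + 2 * int n * z' = int p + 2 * int n * z + 1 \<or>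
     int p + 2 * int n * z = int p' + 2 * int n * z' + 1" by (simp only: of_int_eq_iff)
  then have "even (int p' + 2 * int n * z') \<noteq> even (int p + 2 * int n * z)" by (metis even_plus_one_iff)
  moreover have "even (int p) \<longleftrightarrow> even (int p')" using r[OF 1(1)] r[OF 2(1)] by simp
  ultimately show False by simp
qed

lemma no_consecutive_heads:
  assumes form: "has_form n X S" and alt: "alternating n X"
    and arrows: "(t, frac x, e) \<in> S" "(t', frac x', e') \<in> S" and t: "frac t = t" "frac t' = t'"
  shows "\<not> consecutive S x x'"
proof
  assume cons: "consecutive S x x'"
  obtain \<Lambda> where \<Lambda>: "labelling n X S \<Lambda>" using alternating_labelling[OF form alt] by blast
  note arrow = labellingD(3)[OF \<Lambda>] and adj = labellingD(4)[OF \<Lambda>]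
  obtain r where "\<forall>(t, h)\<in>X. (even t \<longleftrightarrow> r) \<and> (even h \<longleftrightarrow> \<not> r)" using alternatingD(3)[OF alt] by blast
  then have r: "\<And>t h. (t, h) \<in> X \<Longrightarrow> even h \<longleftrightarrow> \<not> r" by auto
  obtain p q z where 1: "(q, p) \<in> X" "\<Lambda> x = of_int (int p + 2 * int n * z)"
    using arrow[of t x e] arrows t by auto
  obtain p' q' z' where 2: "(q', p') \<in> X" "\<Lambda> x' = of_int (int p' + 2 * int n * z')"
    using arrow[of t' x' e'] arrows t by auto
  have "\<Lambda> x' = \<Lambda> x + 1 \<or> \<Lambda> x = \<Lambda> x' + 1" by (rule adj[OF cons]) (simp_all only: 1 2 Ints_of_int)
  then have "real_of_int (int p' + 2 * int n * z') = of_int (int p + 2 * int n * z + 1) \<or>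
     real_of_int (int p + 2 * int n * z) = of_int (int p' + 2 * int n * z' + 1)" unfolding 1 2 by simp
  then have "int p' + 2 * int n * z' = int p + 2 * int n * z + 1 \<or>
     int p + 2 * int n * z = int p' + 2 * int n * z' + 1" by (simp only: of_int_eq_iff)
  then have "even (int p' + 2 * int n * z') \<noteq> even (int p + 2 * int n * z)" by (metis even_plus_one_iff)
  moreover have "even (int p) \<longleftrightarrow> even (int p')" using r[OF 1(1)] r[OF 2(1)] by simp
  ultimately show False by simp
qed

text \<open>Neighbouring ends would put tail and head at positions differing by 1 or -1 modulo
  \<open>2 * n\<close>, against the last clause of \<open>alternating\<close>.\<close>

lemma no_isolated_arrow:
  assumes form: "has_form n X S" and alt: "alternating n X" and arrow_in: "(frac x, frac y, e) \<in> S"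
  shows "\<not> consecutive S x y"
proof
  assume cons: "consecutive S x y"
  obtain \<Lambda> where \<Lambda>: "labelling n X S \<Lambda>" using alternating_labelling[OF form alt] by blast
  note arrow = labellingD(3)[OF \<Lambda>] and adj = labellingD(4)[OF \<Lambda>]
  obtain p q z w where 1: "(p, q) \<in> X" "\<Lambda> x = of_int (int p + 2 * int n * z)" "\<Lambda> y = of_int (int q + 2 * int n * w)"
    using arrow[OF arrow_in] by auto
  have "\<Lambda> y = \<Lambda> x + 1 \<or> \<Lambda> x = \<Lambda> y + 1" by (rule adj[OF cons]) (simp_all only: 1 Ints_of_int)
  then have "real_of_int (int q + 2 * int n * w) = of_int (int p + 2 * int n * z + 1) \<or>
     real_of_int (int p + 2 * int n * z) = of_int (int q + 2 * int n * w + 1)" unfolding 1 by simp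
  then have "int q + 2 * int n * w = int p + 2 * int n * z + 1 \<or>
     int p + 2 * int n * z = int q + 2 * int n * w + 1" by (simp only: of_int_eq_iff)
  then have "int p - int q + 2 * int n * (z - w) \<in> {1, -1}" by (auto simp: algebra_simps)
  then show False using alternatingD(4)[OF alt 1(1)] by (rule notE[rotated])
qed

text \<open>Between 0 and \<open>N\<close> each residue class has at most one member. This turns the
  cyclic order of the strands into exact values for label differences known only modulo
  \<open>2 * n\<close>.\<close>

lemma mult_int_cases:
  fixes N k a :: int
  assumes "0 < a + N * k" "a + N * k < N" "0 < a" "a < N"
  shows "k = 0"
proof -
  have "k < 1"
  proof (rule ccontr)
    assume "\<not> k < 1"
    then have "N * 1 \<le> N * k" using assms by (intro mult_left_mono) auto
    then show False using assms by linarith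
  qed
  moreover have "-1 < k"
  proof (rule ccontr)
    assume "\<not> -1 < k"
    then have "N * k \<le> N * -1" using assms by (intro mult_left_mono) auto
    then show False using assms by linarith
  qed
  ultimately show ?thesis by linarith
qed

lemma int_mod_eq: "int (m mod N) = int m - int N * int (m div N)"
  by (simp add: of_nat_mod of_nat_div minus_mult_div_eq_mod)

text \<open>In these two lemmas \<open>t\<close>, \<open>m\<close>, \<open>m'\<close>, \<open>b\<close> are the endpoints, on the top, middle, middle and bottom
  strand, of the arrows from top to middle and from middle to bottom.\<close>

lemma no_descending_pair_a:
  assumes form: "has_form n (a_arrows n) S" and alt: "alternating n (a_arrows n)" and n: "n \<ge> 4"
    and arrows: "(frac t, frac m, e) \<in> S" "(frac m', frac b, e') \<in> S"
    and order: "t < m" "t < m'" "m < b" "m' < b" "b < t + 1" and cons: "consecutive S m m'"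
  shows False
proof -
  obtain \<Lambda> where \<Lambda>: "labelling n (a_arrows n) S \<Lambda>" using alternating_labelling[OF form alt] by blast
  note mono = labellingD(1)[OF \<Lambda>] and shift = labellingD(2)[OF \<Lambda>]
    and arrow = labellingD(3)[OF \<Lambda>] and adj = labellingD(4)[OF \<Lambda>]
  have rel: "\<exists>P Q k. \<Lambda> x = of_int P \<and> \<Lambda> y = of_int Q \<and> P = Q + 3 + 2 * int n * k"
    if arrow_in: "(frac x, frac y, e) \<in> S" for x y e
  proof -
    obtain i z w where *: "\<Lambda> x = of_int (int ((2 * i + 3) mod (2 * n)) + 2 * int n * z)"
      "\<Lambda> y = of_int (int (2 * i) + 2 * int n * w)"
      using arrow[OF arrow_in] unfolding a_arrows_def by auto
    have "int ((2 * i + 3) mod (2 * n)) = int (2 * i) + 3 - 2 * int n * int ((2 * i + 3) div (2 * n))"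
      unfolding int_mod_eq[of "2 * i + 3" "2 * n"] by simp
    then have "int ((2 * i + 3) mod (2 * n)) + 2 * int n * z
      = (int (2 * i) + 2 * int n * w) + 3 + 2 * int n * (z - w - int ((2 * i + 3) div (2 * n)))"
      by (simp add: algebra_simps)
    then show ?thesis using * by blast
  qed
  obtain T M k where TM: "\<Lambda> t = of_int T" "\<Lambda> m = of_int M" "T = M + 3 + 2 * int n * k"
    using rel[OF arrows(1)] by blast
  obtain M' B l where MB: "\<Lambda> m' = of_int M'" "\<Lambda> b = of_int B" "M' = B + 3 + 2 * int n * l"
    using rel[OF arrows(2)] by blast
  have "\<Lambda> m' = \<Lambda> m + 1 \<or> \<Lambda> m = \<Lambda> m' + 1" by (rule adj[OF cons]) (simp_all only: TM MB Ints_of_int)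
  then have "real_of_int M' = of_int (M + 1) \<or> real_of_int M = of_int (M' + 1)" unfolding TM MB by simp
  then have MM: "M' = M + 1 \<or> M = M' + 1" by (simp only: of_int_eq_iff)
  have "\<Lambda> b < \<Lambda> (t + 1)" using strict_monoD[OF mono order(5)] .
  then have "real_of_int B < of_int (T + 2 * int n)" unfolding shift TM MB by simp
  then have ord: "T < M" "T < M'" "M < B" "M' < B" "B < T + 2 * int n"
    using order[THEN strict_monoD[OF mono]] unfolding TM MB by linarith+
  \<comment> \<open>Since \<open>M - T = 2 * n - 3 + 2 * n * (- 1 - k)\<close> lies between 0 and
    \<open>2 * n\<close>, it equals \<open>2 * n - 3\<close>; likewise
    \<open>B - M'\<close>.\<close>
  have "- 1 - k = 0" using ord TM n by (intro mult_int_cases[of "2 * int n - 3" "2 * int n"]) (auto simp: algebra_simps)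
  moreover have "- 1 - l = 0" using ord MB n by (intro mult_int_cases[of "2 * int n - 3" "2 * int n"]) (auto simp: algebra_simps)
  ultimately have "k = -1" "l = -1" by auto
  then have "T = M + 3 - 2 * int n" "B = M' - 3 + 2 * int n" using TM(3) MB(3) by auto
  \<comment> \<open>Now \<open>B - T = 4 * n - 6 + (M' - M) \<ge> 4 * n - 7\<close>, which is at
    least a full turn \<open>2 * n\<close> once \<open>n \<ge> 4\<close>.\<close>
  then show False using ord MM n by linarith
qed

lemma no_ascending_pair_d:
  assumes form: "has_form n (d_arrows n) S" and alt: "alternating n (d_arrows n)" and n: "n \<ge> 4"
    and arrows: "(frac t, frac m, e) \<in> S" "(frac m', frac b, e') \<in> S"
    and order: "t < b" "b < m" "b < m'" "m < t + 1" "m' < t + 1" and cons: "consecutive S m m'"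
  shows False
proof -
  obtain \<Lambda> where \<Lambda>: "labelling n (d_arrows n) S \<Lambda>" using alternating_labelling[OF form alt] by blast
  note mono = labellingD(1)[OF \<Lambda>] and shift = labellingD(2)[OF \<Lambda>]
    and arrow = labellingD(3)[OF \<Lambda>] and adj = labellingD(4)[OF \<Lambda>]
  have rel: "\<exists>P Q k. \<Lambda> x = of_int P \<and> \<Lambda> y = of_int Q \<and> Q = P + 3 + 2 * int n * k"
    if arrow_in: "(frac x, frac y, e) \<in> S" for x y e
  proof -
    obtain i z w where *: "\<Lambda> y = of_int (int ((2 * i + 3) mod (2 * n)) + 2 * int n * z)"
      "\<Lambda> x = of_int (int (2 * i) + 2 * int n * w)"
      using arrow[OF arrow_in] unfolding d_arrows_def by auto
    have "int ((2 * i + 3) mod (2 * n)) = int (2 * i) + 3 - 2 * int n * int ((2 * i + 3) div (2 * n))"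
      unfolding int_mod_eq[of "2 * i + 3" "2 * n"] by simp
    then have "int ((2 * i + 3) mod (2 * n)) + 2 * int n * z
      = (int (2 * i) + 2 * int n * w) + 3 + 2 * int n * (z - w - int ((2 * i + 3) div (2 * n)))"
      by (simp add: algebra_simps)
    then show ?thesis using * by blast
  qed
  obtain T M k where TM: "\<Lambda> t = of_int T" "\<Lambda> m = of_int M" "M = T + 3 + 2 * int n * k"
    using rel[OF arrows(1)] by blast
  obtain M' B l where MB: "\<Lambda> m' = of_int M'" "\<Lambda> b = of_int B" "B = M' + 3 + 2 * int n * l"
    using rel[OF arrows(2)] by blast
  have "\<Lambda> m' = \<Lambda> m + 1 \<or> \<Lambda> m = \<Lambda> m' + 1" by (rule adj[OF cons]) (simp_all only: TM MB Ints_of_int)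
  then have "real_of_int M' = of_int (M + 1) \<or> real_of_int M = of_int (M' + 1)" unfolding TM MB by simp
  then have MM: "M' = M + 1 \<or> M = M' + 1" by (simp only: of_int_eq_iff)
  have "\<Lambda> m < \<Lambda> (t + 1)" "\<Lambda> m' < \<Lambda> (t + 1)" using strict_monoD[OF mono] order by blast+
  then have "real_of_int M < of_int (T + 2 * int n)" "real_of_int M' < of_int (T + 2 * int n)"
    unfolding shift TM MB by simp_all
  then have ord: "T < B" "B < M" "B < M'" "M < T + 2 * int n" "M' < T + 2 * int n"
    using order[THEN strict_monoD[OF mono]] unfolding TM MB by linarith+
  \<comment> \<open>The step of 3 now runs from tail to head, so the order gives
    \<open>M - T = 3\<close> and \<open>M' - B = 2 * n - 3\<close>.\<close>
  have "k = 0" using ord TM n by (intro mult_int_cases[of "3" "2 * int n"]) (auto simp: algebra_simps)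
  moreover have "- 1 - l = 0" using ord MB n by (intro mult_int_cases[of "2 * int n - 3" "2 * int n"]) (auto simp: algebra_simps)
  ultimately have "k = 0" "l = -1" by auto
  then have "M = T + 3" "B = M' + 3 - 2 * int n" using TM(3) MB(3) by auto
  \<comment> \<open>\<open>T < B\<close> would require \<open>M' - M > 2 * n - 6 \<ge> 2\<close>,
    but the two labels on the middle strand differ by 1.\<close>
  then show False using ord MM n by linarith
qed

lemma alternating_a_arrows:
  assumes "n \<ge> 4"
  shows "alternating n (a_arrows n)"
proof -
  have "\<exists>(t, h)\<in>a_arrows n. p = t \<or> p = h" if p: "p < 2 * n" for p
  proof (cases "even p")
    case True
    then obtain i where "p = 2 * i" by blast
    then have "((2 * i + 3) mod (2 * n), p) \<in> a_arrows n" using p unfolding a_arrows_def by auto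
    then show ?thesis by blast
  next
    case False
    then obtain i where i: "p = 2 * i + 1" using oddE by blast
    \<comment> \<open>The tail at \<open>p\<close> belongs to the head three positions earlier, at
      \<open>2 * (i - 1)\<close>; for \<open>p = 1\<close> this wraps around to
      \<open>2 * n - 2\<close>.\<close>
    define j where "j = (if i \<ge> 1 then i - 1 else n - 1)"
    have "2 * j + 3 = p + (if i \<ge> 1 then 0 else 2 * n)" using i assms unfolding j_def by auto
    then have "(2 * j + 3) mod (2 * n) = p" using p by simp
    moreover have "j < n" using p i assms unfolding j_def by auto
    ultimately have "(p, 2 * j) \<in> a_arrows n" unfolding a_arrows_def by auto
    then show ?thesis by blast
  qed
  moreover have "\<forall>(t, h)\<in>a_arrows n. (even t \<longleftrightarrow> False) \<and> (even h \<longleftrightarrow> \<not> False)"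
    unfolding a_arrows_def by (auto simp: dvd_mod_iff)
  moreover have "\<forall>(t, h)\<in>a_arrows n. \<forall>z. int t - int h + 2 * int n * z \<notin> {1, -1}"
  proof clarify
    fix t h z assume "(t, h) \<in> a_arrows n" and d: "int t - int h + 2 * int n * z \<in> {1, - 1}"
    then obtain i where i: "t = (2 * i + 3) mod (2 * n)" "h = 2 * i" unfolding a_arrows_def by auto
    have "int t = int h + 3 - 2 * int n * int ((2 * i + 3) div (2 * n))"
      unfolding i int_mod_eq[of "2 * i + 3" "2 * n"] by simp
    \<comment> \<open>The difference is 3 modulo \<open>2 * n\<close>; if it were 1 or -1, then
      \<open>2 * n\<close> would divide 2 or 4.\<close>
    then have "2 * int n * (int ((2 * i + 3) div (2 * n)) - z) \<in> {2, 4}" using d by (auto simp: algebra_simps)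
    then have "2 * int n dvd 2 \<or> 2 * int n dvd 4" by (metis dvd_triv_left insert_iff singletonD)
    then show False using assms zdvd_imp_le[of "2 * int n" 2] zdvd_imp_le[of "2 * int n" 4] by auto
  qed
  ultimately show ?thesis using assms unfolding alternating_def by (intro conjI allI impI exI[of _ False]) auto
qed

text \<open>Reversing all arrows exchanges the two parity classes, hence the witness
  \<open>\<not> r\<close>, and negates the differences, under which \<open>{1, -1}\<close> is
  symmetric. It reduces \<open>d_arrows\<close> to \<open>a_arrows\<close>.\<close>

lemma alternating_swap:
  assumes "alternating n X"
  shows "alternating n (prod.swap ` X)"
proof -
  obtain r where r: "\<forall>(t, h)\<in>X. (even t \<longleftrightarrow> r) \<and> (even h \<longleftrightarrow> \<not> r)"
    using alternatingD(3)[OF assms] by blast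
  have "\<forall>(t, h)\<in>prod.swap ` X. (even t \<longleftrightarrow> \<not> r) \<and> (even h \<longleftrightarrow> \<not> \<not> r)" using r by auto
  moreover have "int a - int b + 2 * int n * z \<notin> {1, -1}" if "(b, a) \<in> X" for a b z
  proof
    assume "int a - int b + 2 * int n * z \<in> {1, - 1}"
    then have "int b - int a + 2 * int n * (- z) \<in> {1, -1}" by auto
    then show False using alternatingD(4)[OF assms that] by (rule notE[rotated])
  qed
  then have "\<forall>(t, h)\<in>prod.swap ` X. \<forall>z. int t - int h + 2 * int n * z \<notin> {1, -1}" by auto
  moreover have "\<exists>(t, h)\<in>prod.swap ` X. p = t \<or> p = h" if "p < 2 * n" for p
    using alternatingD(2)[OF assms that] by fastforce
  moreover have "n > 0" by (rule alternatingD(1)[OF assms])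
  ultimately show ?thesis unfolding alternating_def by (intro conjI allI impI exI[of _ "\<not> r"])
qed

lemma alternating_d_arrows:
  assumes "n \<ge> 4"
  shows "alternating n (d_arrows n)"
proof -
  have "d_arrows n = prod.swap ` a_arrows n"
    unfolding d_arrows_def a_arrows_def by (auto simp: image_iff)
  then show ?thesis using alternating_swap[OF alternating_a_arrows[OF assms]] by simp
qed

lemma alternating_w_arrows:
  assumes "n \<ge> 3" "odd n"
  shows "alternating n (w_arrows n)"
proof -
  have "\<exists>(t, h)\<in>w_arrows n. p = t \<or> p = h" if p: "p < 2 * n" for p
  proof (cases "even p")
    case True
    then obtain i where "p = 2 * i" by blast
    then have "(p, (2 * i + n) mod (2 * n)) \<in> w_arrows n" using p unfolding w_arrows_def by auto
    then show ?thesis by blast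
  next
    case False
    \<comment> \<open>The tail opposite to an odd head: \<open>p\<close> and \<open>n\<close> are
      both odd, so their sum and difference are even.\<close>
    then obtain j where j: "2 * j = (if p \<ge> n then p - n else p + n)" using assms(2)
      by (metis dvd_def even_add even_diff_nat)
    have "2 * j + n = p \<or> 2 * j + n = p + 2 * n" using j by (auto split: if_splits)
    then have "(2 * j + n) mod (2 * n) = p"
      by (elim disjE) (simp_all only: mod_add_self2 mod_less p)
    moreover have "j < n" using j p by (auto split: if_splits)
    ultimately have "(2 * j, p) \<in> w_arrows n" unfolding w_arrows_def by auto
    then show ?thesis by blast
  qed
  moreover have "\<forall>(t, h)\<in>w_arrows n. (even t \<longleftrightarrow> True) \<and> (even h \<longleftrightarrow> \<not> True)"
    using assms unfolding w_arrows_def by (auto simp: dvd_mod_iff)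
  moreover have "\<forall>(t, h)\<in>w_arrows n. \<forall>z. int t - int h + 2 * int n * z \<notin> {1, -1}"
  proof clarify
    fix t h z assume "(t, h) \<in> w_arrows n" and d: "int t - int h + 2 * int n * z \<in> {1, - 1}"
    then obtain i where i: "h = (2 * i + n) mod (2 * n)" "t = 2 * i" unfolding w_arrows_def by auto
    have "int h = int t + int n - 2 * int n * int ((2 * i + n) div (2 * n))"
      unfolding i int_mod_eq[of "2 * i + n" "2 * n"] by simp
    \<comment> \<open>Opposite positions differ by an odd multiple of \<open>n\<close>, so
      \<open>n\<close> would divide 1.\<close>
    then have "int n * (2 * int ((2 * i + n) div (2 * n)) - 1 + 2 * z) \<in> {1, -1}" using d by (auto simp: algebra_simps)
    then have "int n dvd 1 \<or> int n dvd -1" by (metis dvd_triv_left insert_iff singletonD)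
    then show False using assms(1) zdvd_imp_le[of "int n" 1] by auto
  qed
  ultimately show ?thesis using assms unfolding alternating_def by (intro conjI allI impI exI[of _ True]) auto
qed

section \<open>Splitting the sum over subdiagrams\<close>

lemma sign_of_insert:
  assumes "finite S" "(t, h, e) \<notin> S"
  shows "sign_of (insert (t, h, e) S) = e * sign_of S"
  using assms by (simp add: sign_of_def)

text \<open>By \<open>single\<close> a subdiagram of the form has at most one arrow in
  \<open>L\<close>. Those containing \<open>x\<close> are the sets \<open>insert x S\<close> with
  \<open>S\<close> inside \<open>U\<close>, and \<open>snd (snd x)\<close> is the sign that
  \<open>x\<close> contributes. Finiteness matters because sums over infinite sets default to
  0.\<close>

lemma sum_forms_split:
  assumes fin: "finite U" "finite L" and disj: "U \<inter> L = {}"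
    and single: "\<And>S x y. S \<subseteq> U \<union> L \<Longrightarrow> has_form n X S \<Longrightarrow> x \<in> S \<inter> L \<Longrightarrow> y \<in> S \<inter> L \<Longrightarrow> x = y"
  shows "(\<Sum>S | S \<subseteq> U \<union> L \<and> has_form n X S. sign_of S) = (\<Sum>S | S \<subseteq> U \<and> has_form n X S. sign_of S) +
    (\<Sum>x\<in>L. snd (snd x) * (\<Sum>S | S \<subseteq> U \<and> has_form n X (insert x S). sign_of S))"
proof -
  define F where "F = {S. S \<subseteq> U \<and> has_form n X S}"
  define E where "E x = {S. S \<subseteq> U \<and> has_form n X (insert x S)}" for x
  have finF: "finite F" "finite (E x)" for x
    unfolding F_def E_def using fin(1) by auto
  have notin: "x \<notin> S" if "x \<in> L" "S \<in> E x" for x S using that disj unfolding E_def by blast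
  have eq: "{S. S \<subseteq> U \<union> L \<and> has_form n X S} = F \<union> (\<Union>x\<in>L. insert x ` E x)" (is "?l = ?r")
  proof
    show "?l \<subseteq> ?r"
    proof
      fix S assume S: "S \<in> ?l"
      show "S \<in> ?r"
      proof (cases "S \<inter> L = {}")
        case True
        then show ?thesis using S unfolding F_def by blast
      next
        case False
        then obtain x where x: "x \<in> S \<inter> L" by blast
        then have "S \<inter> L = {x}" using single[of S] S by blast
        then have "S = insert x (S - {x})" "S - {x} \<subseteq> U" using S by auto
        moreover from this have "S - {x} \<in> E x" using S unfolding E_def by auto
        ultimately show ?thesis using x by blast
      qed
    qed
    show "?r \<subseteq> ?l" unfolding F_def E_def by auto
  qed
  have "(\<Sum>S\<in>(\<Union>x\<in>L. insert x ` E x). sign_of S) = (\<Sum>x\<in>L. \<Sum>S\<in>insert x ` E x. sign_of S)"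
  proof (rule sum.UNION_disjoint)
    show "\<forall>x\<in>L. \<forall>y\<in>L. x \<noteq> y \<longrightarrow> insert x ` E x \<inter> insert y ` E y = {}"
      using disj unfolding E_def by blast
  qed (use fin finF in auto)
  also have "\<dots> = (\<Sum>x\<in>L. snd (snd x) * (\<Sum>S\<in>E x. sign_of S))"
  proof (rule sum.cong)
    fix x assume x: "x \<in> L"
    obtain t h e where xe: "x = (t, h, e)" by (cases x)
    have "inj_on (insert x) (E x)" using notin[OF x] unfolding inj_on_def by (metis insert_ident)
    then have "(\<Sum>S\<in>insert x ` E x. sign_of S) = (\<Sum>S\<in>E x. sign_of (insert x S))"
      by (simp add: sum.reindex)
    also have "\<dots> = (\<Sum>S\<in>E x. e * sign_of S)"
    proof (rule sum.cong)
      fix S assume S: "S \<in> E x"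
      then have "finite S" using fin(1) finite_subset unfolding E_def by blast
      then show "sign_of (insert x S) = e * sign_of S"
        using sign_of_insert notin[OF x S] unfolding xe by blast
    qed simp
    finally show "(\<Sum>S\<in>insert x ` E x. sign_of S) = snd (snd x) * (\<Sum>S\<in>E x. sign_of S)"
      by (simp add: sum_distrib_left xe)
  qed simp
  finally have loc: "(\<Sum>S\<in>(\<Union>x\<in>L. insert x ` E x). sign_of S)
    = (\<Sum>x\<in>L. snd (snd x) * (\<Sum>S\<in>E x. sign_of S))" .
  have "(\<Sum>S\<in>F \<union> (\<Union>x\<in>L. insert x ` E x). sign_of S)
    = (\<Sum>S\<in>F. sign_of S) + (\<Sum>S\<in>(\<Union>x\<in>L. insert x ` E x). sign_of S)"
  proof (rule sum.union_disjoint)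
    show "F \<inter> (\<Union>x\<in>L. insert x ` E x) = {}" using disj unfolding F_def by blast
  qed (use fin finF in auto)
  then show ?thesis unfolding eq loc by (simp add: F_def E_def)
qed


section \<open>Gauss diagrams of knot diagrams\<close>

lemma has_velocity:
  assumes "knot_diagram k"
  shows "(curve k has_vector_derivative velocity k t) (at t)" "continuous_on UNIV (velocity k)"
proof -
  obtain D where D: "\<And>x. (curve k has_vector_derivative D x) (at x)" "continuous_on UNIV D"
    using assms unfolding knot_diagram_def C1_differentiable_on_def by auto
  have "velocity k = D" unfolding velocity_def using vector_derivative_at[OF D(1)] by auto
  then show "(curve k has_vector_derivative velocity k t) (at t)" "continuous_on UNIV (velocity k)"
    using D by auto
qed

lemma curve_isCont: "knot_diagram k \<Longrightarrow> isCont (curve k) t"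
  using has_velocity(1) has_vector_derivative_continuous by blast

lemma knot_diagram_periodic:
  assumes "knot_diagram k"
  shows "curve k (t + of_int z) = curve k t" "t + of_int z \<in> over k \<longleftrightarrow> t \<in> over k"
    "velocity k (t + of_int z) = velocity k t"
proof -
  have curve1: "curve k (t + 1) = curve k t" for t using assms unfolding knot_diagram_def by blast
  have over1: "(t + 1 \<in> over k) = (t \<in> over k)" for t using assms unfolding knot_diagram_def by blast
  have "velocity k (t + 1) = velocity k t" for t
  proof -
    have "((\<lambda>t::real. t + 1) has_vector_derivative 1) (at t)"
      by (auto intro!: derivative_eq_intros)
    from vector_diff_chain_at[OF this has_velocity(1)[OF assms]]
    have "(curve k has_vector_derivative velocity k (t + 1)) (at t)"
      by (simp add: comp_def curve1)
    from vector_derivative_at[OF this] show ?thesis by (simp add: velocity_def[of k t])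
  qed
  then interpret v: periodic_fun_simple' "velocity k" by unfold_locales
  interpret c: periodic_fun_simple' "curve k" by unfold_locales (rule curve1)
  interpret o: periodic_fun_simple' "\<lambda>t. t \<in> over k" by unfold_locales (rule over1)
  show "curve k (t + of_int z) = curve k t" by (rule c.plus_of_int)
  show "t + of_int z \<in> over k \<longleftrightarrow> t \<in> over k" by (rule o.plus_of_int)
  show "velocity k (t + of_int z) = velocity k t" by (rule v.plus_of_int)
qed

lemma knot_diagram_frac:
  assumes "knot_diagram k"
  shows "curve k (frac t) = curve k t" "frac t \<in> over k \<longleftrightarrow> t \<in> over k" "velocity k (frac t) = velocity k t"
  using knot_diagram_periodic[OF assms, of t "- \<lfloor>t\<rfloor>"] by (simp_all add: frac_def)

lemma crossing_over: "knot_diagram k \<Longrightarrow> crossing k s t \<Longrightarrow> s \<in> over k \<longleftrightarrow> t \<notin> over k"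
  by (simp add: knot_diagram_def)

text \<open>Accepts arbitrary lifts and reduces only the result, so that strands passing through an
  integer need no case distinction.\<close>

definition arrow :: "diagram \<Rightarrow> real \<Rightarrow> real \<Rightarrow> real \<times> real \<times> int" where
  "arrow k t h = (frac t, frac h, if plane_det (velocity k t) (velocity k h) > 0 then 1 else -1)"

lemma gauss_diagram_eq:
  assumes "knot_diagram k"
  shows "gauss_diagram k = {arrow k t h | t h. crossing k t h \<and> t \<in> over k}"
proof (intro set_eqI iffI)
  fix x assume "x \<in> gauss_diagram k"
  then obtain t h where x: "x = (t, h, if plane_det (velocity k t) (velocity k h) > 0 then 1 else -1)"
    "t \<in> {0..<1}" "h \<in> {0..<1}" "crossing k t h" "t \<in> over k"
    unfolding gauss_diagram_def by blast
  then have "x = arrow k t h" unfolding arrow_def by (simp add: frac_eq)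
  then show "x \<in> {arrow k t h | t h. crossing k t h \<and> t \<in> over k}" using x by blast
next
  fix x assume "x \<in> {arrow k t h | t h. crossing k t h \<and> t \<in> over k}"
  then obtain t h where x: "x = arrow k t h" "crossing k t h" "t \<in> over k" by blast
  then have "crossing k (frac t) (frac h)" "frac t \<in> over k"
    by (simp_all add: crossing_def knot_diagram_frac[OF assms])
  then show "x \<in> gauss_diagram k"
    unfolding gauss_diagram_def x(1) arrow_def
    using frac_ge_0 frac_lt_1 by (force simp: knot_diagram_frac[OF assms])
qed

section \<open>Behaviour under reparametrization\<close>

lemma velocity_reparam:
  assumes "knot_diagram k" "circle_diffeo \<theta>"
  shows "(curve (reparam \<theta> k) has_vector_derivative deriv \<theta> t *\<^sub>R velocity k (\<theta> t)) (at t)"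
    "velocity (reparam \<theta> k) t = deriv \<theta> t *\<^sub>R velocity k (\<theta> t)"
proof -
  have "(\<theta> has_vector_derivative deriv \<theta> t) (at t)"
    using circle_diffeo_deriv(1)[OF assms(2)] by (simp add: has_real_derivative_iff_has_vector_derivative)
  from vector_diff_chain_at[OF this has_velocity(1)[OF assms(1)]]
  show *: "(curve (reparam \<theta> k) has_vector_derivative deriv \<theta> t *\<^sub>R velocity k (\<theta> t)) (at t)"
    by (simp add: reparam_def)
  show "velocity (reparam \<theta> k) t = deriv \<theta> t *\<^sub>R velocity k (\<theta> t)"
    unfolding velocity_def[of "reparam \<theta> k"] by (rule vector_derivative_at[OF *])
qed

lemma plane_det_scaleR: "plane_det (r *\<^sub>R x) (s *\<^sub>R y) = r * s * plane_det x y"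
  by (simp add: plane_det_def algebra_simps)

lemma crossing_reparam:
  assumes "circle_diffeo \<theta>"
  shows "crossing (reparam \<theta> k) s t \<longleftrightarrow> crossing k (\<theta> s) (\<theta> t)"
  using circle_diffeo_frac_eq_iff[OF assms, of s t] by (auto simp: crossing_def reparam_def)

lemma over_reparam: "t \<in> over (reparam \<theta> k) \<longleftrightarrow> \<theta> t \<in> over k"
  by (simp add: reparam_def)

lemma knot_diagram_reparam:
  assumes k: "knot_diagram k" and \<theta>: "circle_diffeo \<theta>"
  shows "knot_diagram (reparam \<theta> k)"
  unfolding knot_diagram_def crossing_reparam[OF \<theta>] over_reparam velocity_reparam(2)[OF k \<theta>] plane_det_scaleR
proof (intro conjI)
  have \<theta>1: "\<theta> (t + 1) = \<theta> t + 1" for t using circle_diffeo_add_int[OF \<theta>, of t 1] by simp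
  have pos: "deriv \<theta> t \<noteq> 0" for t using circle_diffeo_deriv(2)[OF \<theta>, of t] by simp
  show "\<forall>t. curve (reparam \<theta> k) (t + 1) = curve (reparam \<theta> k) t"
    using knot_diagram_periodic(1)[OF k, of _ 1] by (simp add: reparam_def \<theta>1)
  show "curve (reparam \<theta> k) C1_differentiable_on UNIV"
    unfolding C1_differentiable_on_def
  proof (intro exI conjI ballI)
    show "(curve (reparam \<theta> k) has_vector_derivative deriv \<theta> t *\<^sub>R velocity k (\<theta> t)) (at t)" for t
      by (rule velocity_reparam(1)[OF k \<theta>])
    have "continuous_on UNIV \<theta>"
      using circle_diffeo_isCont[OF \<theta>] by (simp add: continuous_at_imp_continuous_on)
    then show "continuous_on UNIV (\<lambda>t. deriv \<theta> t *\<^sub>R velocity k (\<theta> t))"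
      by (intro continuous_on_scaleR circle_diffeo_deriv(3)[OF \<theta>]
          continuous_on_compose2[OF has_velocity(2)[OF k]]) auto
  qed
  show "\<forall>t. deriv \<theta> t *\<^sub>R velocity k (\<theta> t) \<noteq> 0" using k pos unfolding knot_diagram_def by auto
  show "\<forall>r s t. \<not> (crossing k (\<theta> r) (\<theta> s) \<and> crossing k (\<theta> s) (\<theta> t) \<and> crossing k (\<theta> r) (\<theta> t))"
    using k unfolding knot_diagram_def by blast
  show "\<forall>s t. crossing k (\<theta> s) (\<theta> t) \<longrightarrow>
      deriv \<theta> s * deriv \<theta> t * plane_det (velocity k (\<theta> s)) (velocity k (\<theta> t)) \<noteq> 0"
    using k pos unfolding knot_diagram_def by auto
  show "\<forall>t. (\<theta> (t + 1) \<in> over k) = (\<theta> t \<in> over k)"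
    using k \<theta>1 unfolding knot_diagram_def by auto
  show "\<forall>s\<in>over (reparam \<theta> k). \<exists>t. crossing k (\<theta> s) (\<theta> t)"
  proof
    fix s assume "s \<in> over (reparam \<theta> k)"
    then have "\<theta> s \<in> over k" by (simp add: over_reparam)
    then obtain t where "crossing k (\<theta> s) t" using k unfolding knot_diagram_def by blast
    then show "\<exists>t. crossing k (\<theta> s) (\<theta> t)" using circle_diffeo_surj[OF \<theta>, of t] by metis
  qed
  show "\<forall>s t. crossing k (\<theta> s) (\<theta> t) \<longrightarrow> (\<theta> s \<in> over k) = (\<theta> t \<notin> over k)"
    using k unfolding knot_diagram_def by blast
qed

text \<open>Velocities of the reparametrized curve are positive multiples of the original ones, so
  the signs of crossings persist; surjectivity of \<open>\<theta>\<close> matches the crossings on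
  the two sides.\<close>

lemma push_arrows_gauss_diagram:
  assumes k: "knot_diagram k" and \<theta>: "circle_diffeo \<theta>"
  shows "push_arrows \<theta> (gauss_diagram (reparam \<theta> k)) = gauss_diagram k"
proof -
  have push: "(\<lambda>(t, h, e). (frac (\<theta> t), frac (\<theta> h), e)) (arrow (reparam \<theta> k) t h) = arrow k (\<theta> t) (\<theta> h)" for t h
  proof -
    have "0 < r * d \<longleftrightarrow> 0 < d" if "r > 0" for r d :: real using that by (simp add: zero_less_mult_iff)
    moreover have "deriv \<theta> t * deriv \<theta> h > 0" by (intro mult_pos_pos circle_diffeo_deriv(2)[OF \<theta>])
    ultimately show ?thesis
      by (simp only: arrow_def prod.case circle_diffeo_frac[OF \<theta>] velocity_reparam(2)[OF k \<theta>] plane_det_scaleR)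
  qed
  have "gauss_diagram k = {arrow k (\<theta> t) (\<theta> h) | t h. crossing k (\<theta> t) (\<theta> h) \<and> \<theta> t \<in> over k}"
  proof -
    have "\<exists>t' h'. \<theta> t' = t \<and> \<theta> h' = h" for t h
      using circle_diffeo_surj[OF \<theta>, of t] circle_diffeo_surj[OF \<theta>, of h] by metis
    note lift = this
    show ?thesis unfolding gauss_diagram_eq[OF k]
    proof (intro set_eqI iffI)
      fix x assume "x \<in> {arrow k t h | t h. crossing k t h \<and> t \<in> over k}"
      then obtain t h where x: "x = arrow k t h" "crossing k t h" "t \<in> over k" by blast
      obtain t' h' where "\<theta> t' = t" "\<theta> h' = h" using lift by blast
      then show "x \<in> {arrow k (\<theta> t) (\<theta> h) | t h. crossing k (\<theta> t) (\<theta> h) \<and> \<theta> t \<in> over k}"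
        using x by blast
    qed blast
  qed
  also have "\<dots> = push_arrows \<theta> (gauss_diagram (reparam \<theta> k))"
    unfolding gauss_diagram_eq[OF knot_diagram_reparam[OF k \<theta>]] crossing_reparam[OF \<theta>] over_reparam
      push_arrows_def push[symmetric] by blast
  finally show ?thesis ..
qed

text \<open>Pushing endpoints forward is a bijection of Gauss diagrams preserving signs and forms,
  so it induces a bijection of the subdiagrams that are counted.\<close>

lemma signed_count_reparam:
  assumes k: "knot_diagram k" and \<theta>: "circle_diffeo \<theta>"
  shows "signed_count n X (reparam \<theta> k) = signed_count n X k"
proof -
  define p where "p = (\<lambda>(t, h, e :: int). (frac (\<theta> t), frac (\<theta> h), e))"
  let ?G = "gauss_diagram (reparam \<theta> k)"
  \<comment> \<open>The push retains endpoints only modulo 1; this suffices because endpoints of a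
    Gauss diagram are representatives in \<open>{0..<1}\<close>.\<close>
  have inj: "inj_on p ?G"
  proof (rule inj_onI)
    fix x y assume xy: "x \<in> ?G" "y \<in> ?G" "p x = p y"
    obtain t h e t' h' e' where [simp]: "x = (t, h, e)" "y = (t', h', e')" by (cases x, cases y)
    have "frac t = t" "frac h = h" "frac t' = t'" "frac h' = h'"
      using xy(1,2) unfolding gauss_diagram_def by (auto simp: frac_eq)
    then show "x = y" using xy(3) by (simp add: p_def circle_diffeo_frac_eq_iff[OF \<theta>])
  qed
  have pG: "p ` ?G = gauss_diagram k"
    using push_arrows_gauss_diagram[OF k \<theta>] unfolding push_arrows_def p_def .
  have sgn: "sign_of (p ` S) = sign_of S" if "S \<subseteq> ?G" for S
  proof -
    have "sign_of (p ` S) = (\<Prod>x\<in>S. (\<lambda>(t, h, e). e) (p x))"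
      unfolding sign_of_def by (subst prod.reindex) (use inj_on_subset[OF inj that] in auto)
    also have "\<dots> = sign_of S" unfolding sign_of_def p_def by (intro prod.cong) auto
    finally show ?thesis .
  qed
  have form: "has_form n X (p ` S) \<longleftrightarrow> has_form n X S" for S
    using has_form_push_arrows_iff[OF \<theta>] unfolding push_arrows_def p_def .
  have "signed_count n X k = (\<Sum>S\<in>(`) p ` {S. S \<subseteq> ?G \<and> has_form n X S}. sign_of S)"
    unfolding signed_count_def
  proof (rule sum.cong)
    show "{S. S \<subseteq> gauss_diagram k \<and> has_form n X S} = (`) p ` {S. S \<subseteq> ?G \<and> has_form n X S}"
    proof (intro set_eqI iffI)
      fix S assume S: "S \<in> {S. S \<subseteq> gauss_diagram k \<and> has_form n X S}"
      then obtain T where "T \<subseteq> ?G" "S = p ` T" unfolding pG[symmetric] by (auto elim: subset_imageE)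
      then show "S \<in> (`) p ` {S. S \<subseteq> ?G \<and> has_form n X S}" using S form by blast
    next
      fix S assume "S \<in> (`) p ` {S. S \<subseteq> ?G \<and> has_form n X S}"
      then show "S \<in> {S. S \<subseteq> gauss_diagram k \<and> has_form n X S}" unfolding pG[symmetric] using form by blast
    qed
  qed simp
  also have "\<dots> = (\<Sum>S | S \<subseteq> ?G \<and> has_form n X S. sign_of (p ` S))"
    by (subst sum.reindex) (use inj in \<open>auto intro!: inj_onI simp: inj_on_image_eq_iff\<close>)
  also have "\<dots> = signed_count n X (reparam \<theta> k)"
    unfolding signed_count_def by (rule sum.cong) (auto simp: sgn)
  finally show ?thesis ..
qed

section \<open>Finiteness of the Gauss diagram\<close>

lemma vector_derivative_remainder_bound:
  fixes f :: "real \<Rightarrow> complex"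
  assumes "(f has_vector_derivative v) (at x)" "\<eta> > 0"
  shows "\<exists>d>0. \<forall>y. \<bar>y - x\<bar> < d \<longrightarrow> cmod (f y - f x - (y - x) *\<^sub>R v) \<le> \<eta> * \<bar>y - x\<bar>"
proof -
  have "\<forall>e>0. \<exists>d>0. \<forall>y. norm (y - x) < d \<longrightarrow> norm (f y - f x - (y - x) *\<^sub>R v) \<le> e * norm (y - x)"
    using assms(1) unfolding has_vector_derivative_def has_derivative_at_alt by (rule conjunct2)
  from this[rule_format, OF assms(2)] show ?thesis unfolding real_norm_def .
qed

text \<open>Pairing the combination with \<open>v\<close> isolates \<open>b\<close> times the
  determinant, pairing it with \<open>w\<close> isolates \<open>a\<close> times the determinant. For
  independent vectors this bounds the coefficients by the size of the combination.\<close>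

lemma plane_det_bound:
  "(\<bar>a\<bar> + \<bar>b\<bar>) * \<bar>plane_det v w\<bar> \<le> (cmod v + cmod w) * cmod (a *\<^sub>R v - b *\<^sub>R w)"
proof -
  have "Im (cnj v * (a *\<^sub>R v - b *\<^sub>R w)) = - b * plane_det v w"
    by (simp add: plane_det_def algebra_simps)
  then have "\<bar>b\<bar> * \<bar>plane_det v w\<bar> \<le> cmod (cnj v * (a *\<^sub>R v - b *\<^sub>R w))"
    by (metis abs_Im_le_cmod abs_minus_cancel abs_mult mult_minus_left)
  moreover have "Im (cnj w * (a *\<^sub>R v - b *\<^sub>R w)) = - a * plane_det v w"
    by (simp add: plane_det_def algebra_simps)
  then have "\<bar>a\<bar> * \<bar>plane_det v w\<bar> \<le> cmod (cnj w * (a *\<^sub>R v - b *\<^sub>R w))"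
    by (metis abs_Im_le_cmod abs_minus_cancel abs_mult mult_minus_left)
  ultimately show ?thesis unfolding norm_mult complex_mod_cnj distrib_right by linarith
qed

text \<open>Distinct image points are separated by continuity, a crossing is isolated by
  transversality, and near two parameters of the same point of the circle the immersion is
  injective.\<close>

lemma crossings_isolated:
  assumes k: "knot_diagram k"
  shows "\<exists>d>0. \<forall>s t. \<bar>s - s0\<bar> < d \<longrightarrow> \<bar>t - t0\<bar> < d \<longrightarrow> crossing k s t \<longrightarrow> s = s0 \<and> t = t0"
proof -
  consider (apart) "curve k s0 \<noteq> curve k t0" | (cross) "crossing k s0 t0" | (diag) "frac t0 = frac s0"
    unfolding crossing_def by metis
  then show ?thesis
  proof cases
    case apart
    define e where "e = dist (curve k s0) (curve k t0) / 2"
    have "e > 0" using apart unfolding e_def by simp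
    obtain d1 where d1: "d1 > 0" "\<And>s. dist s s0 < d1 \<Longrightarrow> dist (curve k s) (curve k s0) < e"
      using curve_isCont[OF k, of s0] \<open>e > 0\<close> unfolding continuous_at_eps_delta by blast
    obtain d2 where d2: "d2 > 0" "\<And>t. dist t t0 < d2 \<Longrightarrow> dist (curve k t) (curve k t0) < e"
      using curve_isCont[OF k, of t0] \<open>e > 0\<close> unfolding continuous_at_eps_delta by blast
    have "\<not> crossing k s t" if "\<bar>s - s0\<bar> < min d1 d2" "\<bar>t - t0\<bar> < min d1 d2" for s t
    proof
      assume "crossing k s t"
      then have "dist (curve k s) (curve k s0) < e" "dist (curve k s) (curve k t0) < e"
        using d1(2)[of s] d2(2)[of t] that by (auto simp: dist_real_def crossing_def)
      then have "dist (curve k s0) (curve k t0) < 2 * e"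
        by (metis dist_commute dist_triangle_half_l e_def mult_2 field_sum_of_halves nonzero_mult_div_cancel_left zero_neq_numeral)
      then show False unfolding e_def by simp
    qed
    then show ?thesis using d1(1) d2(1) by (intro exI[of _ "min d1 d2"]) auto
  next
    case cross
    let ?v = "velocity k s0" and ?w = "velocity k t0"
    have det: "plane_det ?v ?w \<noteq> 0" using k cross unfolding knot_diagram_def by blast
    define c where "c = cmod ?v + cmod ?w + 1"
    \<comment> \<open>Chosen so that \<open>c * \<eta>\<close> is half of the absolute determinant;
      the remainders then cannot make up for the lower bound \<open>plane_det_bound\<close>.\<close>
    define \<eta> where "\<eta> = \<bar>plane_det ?v ?w\<bar> / (2 * c)"
    have c: "c > 0" unfolding c_def by (simp add: add_nonneg_pos)
    have "\<eta> > 0" unfolding \<eta>_def using det c by simp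
    obtain d1 where d1: "d1 > 0" "\<forall>s. \<bar>s - s0\<bar> < d1 \<longrightarrow>
        cmod (curve k s - curve k s0 - (s - s0) *\<^sub>R ?v) \<le> \<eta> * \<bar>s - s0\<bar>"
      using vector_derivative_remainder_bound[OF has_velocity(1)[OF k] \<open>\<eta> > 0\<close>] by blast
    obtain d2 where d2: "d2 > 0" "\<forall>t. \<bar>t - t0\<bar> < d2 \<longrightarrow>
        cmod (curve k t - curve k t0 - (t - t0) *\<^sub>R ?w) \<le> \<eta> * \<bar>t - t0\<bar>"
      using vector_derivative_remainder_bound[OF has_velocity(1)[OF k] \<open>\<eta> > 0\<close>] by blast
    have "s = s0 \<and> t = t0" if near: "\<bar>s - s0\<bar> < min d1 d2" "\<bar>t - t0\<bar> < min d1 d2" and st: "crossing k s t" for s t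
    proof -
      let ?a = "s - s0" and ?b = "t - t0"
      \<comment> \<open>The curve points coincide for \<open>s\<close> and \<open>t\<close> as well
        as for \<open>s0\<close> and \<open>t0\<close>, so the linear parts differ only by the two
        remainders.\<close>
      have "?a *\<^sub>R ?v - ?b *\<^sub>R ?w = (curve k t - curve k t0 - ?b *\<^sub>R ?w) - (curve k s - curve k s0 - ?a *\<^sub>R ?v)"
        using st cross unfolding crossing_def by simp
      then have "cmod (?a *\<^sub>R ?v - ?b *\<^sub>R ?w) \<le>
          cmod (curve k t - curve k t0 - ?b *\<^sub>R ?w) + cmod (curve k s - curve k s0 - ?a *\<^sub>R ?v)"
        by (metis norm_triangle_ineq4)
      also have "\<dots> \<le> \<eta> * \<bar>?b\<bar> + \<eta> * \<bar>?a\<bar>" using d1(2) d2(2) near by (intro add_mono) auto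
      finally have *: "cmod (?a *\<^sub>R ?v - ?b *\<^sub>R ?w) \<le> \<eta> * (\<bar>?a\<bar> + \<bar>?b\<bar>)" by (simp add: algebra_simps)
      have "(\<bar>?a\<bar> + \<bar>?b\<bar>) * \<bar>plane_det ?v ?w\<bar> \<le> (cmod ?v + cmod ?w) * cmod (?a *\<^sub>R ?v - ?b *\<^sub>R ?w)"
        by (rule plane_det_bound)
      also have "\<dots> \<le> c * (\<eta> * (\<bar>?a\<bar> + \<bar>?b\<bar>))"
        using * by (intro mult_mono) (auto simp: c_def)
      also have "\<dots> = (\<bar>?a\<bar> + \<bar>?b\<bar>) * (\<bar>plane_det ?v ?w\<bar> / 2)" using c by (simp add: \<eta>_def)
      finally have "(\<bar>?a\<bar> + \<bar>?b\<bar>) * (\<bar>plane_det ?v ?w\<bar> / 2) \<le> 0" by (simp add: mult.commute)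
      moreover have "\<bar>plane_det ?v ?w\<bar> / 2 > 0" using det by simp
      ultimately have "\<bar>?a\<bar> + \<bar>?b\<bar> \<le> 0" by (simp add: mult_le_0_iff)
      then have "\<bar>?a\<bar> = 0" "\<bar>?b\<bar> = 0" by linarith+
      then show ?thesis by simp
    qed
    then show ?thesis using d1(1) d2(1) by (intro exI[of _ "min d1 d2"]) auto
  next
    case diag
    then obtain z where z: "t0 = s0 + of_int z" unfolding frac_eq_iff_add_int by blast
    \<comment> \<open>The component along the velocity at \<open>s0\<close> has the squared speed as
      derivative there, so it is strictly increasing nearby.\<close>
    define f where "f x = Re (cnj (velocity k s0) * curve k x)" for x
    define f' where "f' x = Re (cnj (velocity k s0) * velocity k x)" for x
    have f: "(f has_real_derivative f' x) (at x)" for x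
      unfolding f_def f'_def has_real_derivative_iff_has_vector_derivative
      by (rule bounded_linear.has_vector_derivative[OF bounded_linear_Re,
          OF has_vector_derivative_mult_right[OF has_velocity(1)[OF k]]])
    have "velocity k s0 \<noteq> 0" using k unfolding knot_diagram_def by blast
    moreover have "f' s0 = (cmod (velocity k s0))\<^sup>2"
      unfolding f'_def unfolding cmod_power2 by (simp add: power2_eq_square)
    ultimately have "f' s0 > 0" by simp
    have "isCont (velocity k) s0" using has_velocity(2)[OF k] by (simp add: continuous_on_eq_continuous_at)
    then have "isCont f' s0" unfolding f'_def by (auto intro!: continuous_intros)
    then obtain d where d: "d > 0" "\<And>x. dist x s0 < d \<Longrightarrow> dist (f' x) (f' s0) < f' s0"
      using \<open>f' s0 > 0\<close> unfolding continuous_at_eps_delta by blast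
    then have f'_pos: "f' x > 0" if "\<bar>x - s0\<bar> < d" for x using that by (force simp: dist_real_def abs_less_iff)
    have "\<not> crossing k s t" if "\<bar>s - s0\<bar> < d" "\<bar>t - t0\<bar> < d" for s t
    proof
      assume st: "crossing k s t"
      define t' where "t' = t + of_int (- z)"
      have "\<bar>t' - s0\<bar> < d" using that(2) z unfolding t'_def by simp
      have "frac t' = frac t" "curve k t' = curve k t"
        unfolding t'_def using knot_diagram_periodic(1)[OF k] by (simp_all only: frac_add_int)
      then have "s \<noteq> t'" "f s = f t'" using st unfolding crossing_def f_def by auto
      have less: "f x < f y" if "x < y" "\<bar>x - s0\<bar> < d" "\<bar>y - s0\<bar> < d" for x y
        by (rule DERIV_pos_imp_increasing[OF that(1)]) (use f f'_pos that in force)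
      show False
        using less[of s t'] less[of t' s] \<open>s \<noteq> t'\<close> \<open>f s = f t'\<close> \<open>\<bar>t' - s0\<bar> < d\<close> that(1) by linarith
    qed
    then show ?thesis using d(1) by blast
  qed
qed

text \<open>Infinitely many crossings in the unit square would accumulate, contradicting their
  isolation. The closed square is used for compactness, although arrows only need parameters in
  \<open>{0..<1}\<close>.\<close>

lemma finite_gauss_diagram:
  assumes k: "knot_diagram k"
  shows "finite (gauss_diagram k)"
proof -
  define C where "C = {(s, t). s \<in> {0..1} \<and> t \<in> {0..1} \<and> crossing k s t}"
  have "finite C"
  proof (rule ccontr)
    assume "infinite C"
    moreover have "compact ({0..1::real} \<times> {0..1::real})" by (intro compact_Times compact_Icc)
    moreover have "C \<subseteq> {0..1} \<times> {0..1}" unfolding C_def by auto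
    ultimately obtain x where x: "x islimpt C" unfolding compact_eq_Bolzano_Weierstrass by blast
    obtain s0 t0 where x0: "x = (s0, t0)" by (cases x)
    obtain d where d: "d > 0" "\<And>s t. \<bar>s - s0\<bar> < d \<Longrightarrow> \<bar>t - t0\<bar> < d \<Longrightarrow> crossing k s t \<Longrightarrow> s = s0 \<and> t = t0"
      using crossings_isolated[OF k] by metis
    obtain y where y: "y \<in> C" "y \<noteq> x" "dist y x < d" using x d(1) unfolding islimpt_approachable by blast
    obtain s t where y0: "y = (s, t)" by (cases y)
    have "\<bar>s - s0\<bar> < d" "\<bar>t - t0\<bar> < d"
      using y(3) dist_fst_le[of y x] dist_snd_le[of y x] unfolding y0 x0 dist_real_def by simp_all
    then show False using d(2) y(1,2) unfolding y0 x0 C_def by blast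
  qed
  moreover have "gauss_diagram k \<subseteq> (\<lambda>(t, h). arrow k t h) ` C"
    unfolding gauss_diagram_def arrow_def C_def by (force simp: frac_eq)
  ultimately show ?thesis using finite_surj by blast
qed


section \<open>Pictures inside the changing disk\<close>

text \<open>Multiplicativity of the determinant: \<open>plane_det (L 1) (L \<i>)\<close> is the
  determinant of \<open>L\<close>.\<close>

lemma plane_det_bounded_linear:
  assumes "bounded_linear L"
  shows "plane_det (L x) (L y) = plane_det (L 1) (L \<i>) * plane_det x y"
proof -
  have L: "L z = Re z *\<^sub>R L 1 + Im z *\<^sub>R L \<i>" for z
  proof -
    have "z = Re z *\<^sub>R 1 + Im z *\<^sub>R \<i>" by (simp add: complex_eq_iff)
    then have "L z = L (Re z *\<^sub>R 1 + Im z *\<^sub>R \<i>)" by simp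
    then show ?thesis
      using bounded_linear.linear[OF assms] by (simp add: linear_add linear_scale)
  qed
  show ?thesis unfolding L[of x] L[of y] by (simp add: plane_det_def algebra_simps)
qed

text \<open>The positive derivative, one-sided at the ends, makes \<open>\<sigma>\<close> an
  increasing bijection onto \<open>{-1..1}\<close>; \<open>\<tau>\<close> inverts
  \<open>\<delta> * \<sigma>\<close>, where \<open>\<delta> * \<delta> = 1\<close>.\<close>

lemma strand_parameter:
  fixes \<sigma> :: "real \<Rightarrow> real"
  assumes "a < b" "\<sigma> a = -1" "\<sigma> b = 1" "\<delta> \<in> {-1, 1}"
    and deriv: "\<And>t. t \<in> {a..b} \<Longrightarrow> \<exists>d>0. (\<sigma> has_real_derivative d) (at t within {a..b})"
  shows "\<exists>\<tau>. (\<forall>u\<in>{-1..1}. \<tau> u \<in> {a..b} \<and> \<delta> * \<sigma> (\<tau> u) = u) \<and>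
    (\<forall>t\<in>{a..b}. \<delta> * \<sigma> t \<in> {-1..1} \<and> \<tau> (\<delta> * \<sigma> t) = t)"
proof -
  have cont: "continuous_on {a..b} \<sigma>"
    unfolding continuous_on_eq_continuous_within using deriv DERIV_continuous by blast
  have mono: "\<sigma> s < \<sigma> t" if "s < t" "s \<in> {a..b}" "t \<in> {a..b}" for s t
  proof (rule DERIV_pos_imp_increasing_open[OF that(1)])
    fix x assume "s < x" "x < t"
    then have "x \<in> {a<..<b}" using that by auto
    moreover from this have "at x within {a..b} = at x" by (simp add: at_within_Icc_at)
    ultimately show "\<exists>y. DERIV \<sigma> x :> y \<and> 0 < y" using deriv[of x] by auto
  next
    show "continuous_on {s..t} \<sigma>" by (rule continuous_on_subset[OF cont]) (use that in auto)
  qed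
  have inj: "s = t" if "\<sigma> s = \<sigma> t" "s \<in> {a..b}" "t \<in> {a..b}" for s t
    using mono[of s t] mono[of t s] that by (cases s t rule: linorder_cases) auto
  have range: "\<sigma> t \<in> {-1..1}" if "t \<in> {a..b}" for t
    using mono[of a t] mono[of t b] that assms by (cases "t = a"; cases "t = b") auto
  have \<delta>2: "\<delta> * (\<delta> * x) = x" for x using assms(4) by auto
  have \<delta>in: "\<delta> * x \<in> {-1..1}" if "x \<in> {-1..1}" for x using assms(4) that by auto
  have "\<exists>t\<in>{a..b}. \<sigma> t = \<delta> * u" if "u \<in> {-1..1}" for u
    using IVT'[of \<sigma> a "\<delta> * u" b] assms cont \<delta>in[OF that] by auto
  then obtain \<tau> where \<tau>: "\<And>u. u \<in> {-1..1} \<Longrightarrow> \<tau> u \<in> {a..b} \<and> \<sigma> (\<tau> u) = \<delta> * u" by metis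
  have "\<tau> (\<delta> * \<sigma> t) = t" if t: "t \<in> {a..b}" for t
    using \<tau>[OF \<delta>in[OF range[OF t]]] t \<delta>2[of "\<sigma> t"] by - (rule inj, simp_all)
  then show ?thesis
    using \<tau> \<delta>in range \<delta>2 by (intro exI[of _ \<tau>] conjI ballI) simp_all
qed

text \<open>\<open>\<tau> j\<close> is the lift of the parameter of the \<open>j\<close>-th curve of the picture to strand \<open>j\<close>.\<close>

definition traces ::
  "nat \<Rightarrow> (nat \<Rightarrow> real \<Rightarrow> complex) \<Rightarrow> real \<Rightarrow> (nat \<Rightarrow> real) \<Rightarrow> (nat \<Rightarrow> real) \<Rightarrow> (nat \<Rightarrow> real) \<Rightarrow>
   diagram \<Rightarrow> (nat \<Rightarrow> real \<Rightarrow> real) \<Rightarrow> bool" where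
  "traces m c \<epsilon> \<delta> a b k \<tau> \<longleftrightarrow>
     (\<forall>j<m. (\<forall>u\<in>{-1..1}. \<tau> j u \<in> {a j..b j}) \<and> (\<forall>u\<in>{-1<..<1}. \<tau> j u \<in> {a j<..<b j}) \<and>
        {a j..b j} \<subseteq> \<tau> j ` {-1..1} \<and> inj_on (\<tau> j) {-1..1}) \<and>
     (\<forall>i<m. \<forall>j<m. \<forall>u\<in>{-1..1}. \<forall>v\<in>{-1..1}. curve k (\<tau> i u) = curve k (\<tau> j v) \<longleftrightarrow> c i u = c j v) \<and>
     (\<forall>i j u v. i < j \<longrightarrow> j < m \<longrightarrow> u \<in> {-1..1} \<longrightarrow> v \<in> {-1..1} \<longrightarrow> c i u = c j v \<longrightarrow> \<tau> i u \<in> over k) \<and>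
     (\<forall>i j u v p q. i < m \<longrightarrow> j < m \<longrightarrow> u \<in> {-1<..<1} \<longrightarrow> v \<in> {-1<..<1} \<longrightarrow> c i u = c j v \<longrightarrow>
        (c i has_vector_derivative p) (at u) \<longrightarrow> (c j has_vector_derivative q) (at v) \<longrightarrow>
        (plane_det (velocity k (\<tau> i u)) (velocity k (\<tau> j v)) > 0 \<longleftrightarrow> \<epsilon> * \<delta> i * \<delta> j * plane_det p q > 0))"

text \<open>The chain rule through parameter, picture and disk map. At an interior point the
  derivative within the closed interval is an ordinary one.\<close>

lemma velocity_on_strand:
  assumes \<sigma>: "(\<sigma> has_real_derivative d) (at t within {a..b})" and t: "t \<in> {a<..<b}"
    and curve: "\<And>s. s \<in> {a..b} \<Longrightarrow> curve k s = \<Phi> (c (\<delta> * \<sigma> s))"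
    and c: "(c has_vector_derivative p) (at (\<delta> * \<sigma> t))"
    and \<Phi>: "(\<Phi> has_derivative L) (at (c (\<delta> * \<sigma> t)))"
  shows "velocity k t = (\<delta> * d) *\<^sub>R L p"
proof -
  have "at t within {a..b} = at t" using t by (simp add: at_within_Icc_at)
  then have "((\<lambda>s. \<delta> * \<sigma> s) has_vector_derivative \<delta> * d) (at t)"
    using DERIV_cmult[OF \<sigma>, of \<delta>] by (simp add: has_real_derivative_iff_has_vector_derivative)
  from vector_diff_chain_at[OF this c] have "(c \<circ> (\<lambda>s. \<delta> * \<sigma> s) has_vector_derivative (\<delta> * d) *\<^sub>R p) (at t)" .
  from vector_derivative_diff_chain_within[OF this, of \<Phi> L] \<Phi>
  have "(\<Phi> \<circ> (c \<circ> (\<lambda>s. \<delta> * \<sigma> s)) has_vector_derivative L ((\<delta> * d) *\<^sub>R p)) (at t)"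
    by (simp add: has_derivative_at_withinI)
  then have "(curve k has_vector_derivative L ((\<delta> * d) *\<^sub>R p)) (at t)"
    by (rule has_vector_derivative_transform_within_open[where S = "{a<..<b}"]) (use t curve in auto)
  then have "velocity k t = L ((\<delta> * d) *\<^sub>R p)"
    unfolding velocity_def by (rule vector_derivative_at)
  then show ?thesis using has_derivative_linear[OF \<Phi>] by (simp add: linear_scale)
qed

text \<open>Injectivity of \<open>\<Phi>\<close> identifies coincidences on the strands with those
  in the picture. A determinant of velocities is that of the picture times two positive speeds, the
  two directions and the Jacobian of \<open>\<Phi>\<close>, whose sign is
  \<open>\<epsilon>\<close>.\<close>

lemma shows_picture_traces:
  assumes ab: "\<And>j. j < m \<Longrightarrow> a j < b j" and \<delta>: "\<And>j. j < m \<Longrightarrow> \<delta> j \<in> {-1, 1}" and \<epsilon>: "\<epsilon> \<in> {-1, 1}"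
    and disk: "disk_diffeo \<epsilon> \<Phi>" and pic: "shows_picture m c \<delta> \<Phi> a b k"
    and inside: "\<And>j u. j < m \<Longrightarrow> u \<in> {-1..1} \<Longrightarrow> c j u \<in> cball 0 1"
  shows "\<exists>\<tau>. traces m c \<epsilon> \<delta> a b k \<tau>"
proof -
  have "\<forall>j. \<exists>\<sigma>. j < m \<longrightarrow> \<sigma> (a j) = -1 \<and> \<sigma> (b j) = 1 \<and>
        (\<forall>t\<in>{a j..b j}. \<exists>d>0. (\<sigma> has_real_derivative d) (at t within {a j..b j})) \<and>
        (\<forall>t\<in>{a j..b j}. curve k t = \<Phi> (c j (\<delta> j * \<sigma> t)))"
    using pic unfolding shows_picture_def by blast
  then obtain \<sigma> where \<sigma>: "\<And>j. j < m \<Longrightarrow> \<sigma> j (a j) = -1" "\<And>j. j < m \<Longrightarrow> \<sigma> j (b j) = 1"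
    "\<And>j t. j < m \<Longrightarrow> t \<in> {a j..b j} \<Longrightarrow> \<exists>d>0. (\<sigma> j has_real_derivative d) (at t within {a j..b j})"
    "\<And>j t. j < m \<Longrightarrow> t \<in> {a j..b j} \<Longrightarrow> curve k t = \<Phi> (c j (\<delta> j * \<sigma> j t))"
    by metis
  have "\<forall>j. \<exists>\<tau>. j < m \<longrightarrow> (\<forall>u\<in>{-1..1}. \<tau> u \<in> {a j..b j} \<and> \<delta> j * \<sigma> j (\<tau> u) = u) \<and>
    (\<forall>t\<in>{a j..b j}. \<delta> j * \<sigma> j t \<in> {-1..1} \<and> \<tau> (\<delta> j * \<sigma> j t) = t)"
  proof
    fix j
    show "\<exists>\<tau>. j < m \<longrightarrow> (\<forall>u\<in>{-1..1}. \<tau> u \<in> {a j..b j} \<and> \<delta> j * \<sigma> j (\<tau> u) = u) \<and>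
      (\<forall>t\<in>{a j..b j}. \<delta> j * \<sigma> j t \<in> {-1..1} \<and> \<tau> (\<delta> j * \<sigma> j t) = t)"
    proof (cases "j < m")
      case True
      from strand_parameter[OF ab[OF True] \<sigma>(1)[OF True] \<sigma>(2)[OF True] \<delta>[OF True] \<sigma>(3)[OF True]]
      show ?thesis by blast
    qed simp
  qed
  then obtain \<tau> where "\<forall>j. j < m \<longrightarrow> (\<forall>u\<in>{-1..1}. \<tau> j u \<in> {a j..b j} \<and> \<delta> j * \<sigma> j (\<tau> j u) = u) \<and>
    (\<forall>t\<in>{a j..b j}. \<delta> j * \<sigma> j t \<in> {-1..1} \<and> \<tau> j (\<delta> j * \<sigma> j t) = t)"
    unfolding choice_iff by blast
  then have \<tau>: "\<And>j u. j < m \<Longrightarrow> u \<in> {-1..1} \<Longrightarrow> \<tau> j u \<in> {a j..b j}"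
      "\<And>j u. j < m \<Longrightarrow> u \<in> {-1..1} \<Longrightarrow> \<delta> j * \<sigma> j (\<tau> j u) = u"
    and \<tau>': "\<And>j t. j < m \<Longrightarrow> t \<in> {a j..b j} \<Longrightarrow> \<delta> j * \<sigma> j t \<in> {-1..1}"
      "\<And>j t. j < m \<Longrightarrow> t \<in> {a j..b j} \<Longrightarrow> \<tau> j (\<delta> j * \<sigma> j t) = t"
    by blast+
  have curve: "curve k (\<tau> j u) = \<Phi> (c j u)" if "j < m" "u \<in> {-1..1}" for j u
    using \<sigma>(4)[OF that(1) \<tau>(1)[OF that]] \<tau>(2)[OF that] by simp
  obtain U L where U: "cball 0 1 \<subseteq> U" "inj_on \<Phi> U"
    and L: "\<And>z. z \<in> U \<Longrightarrow> (\<Phi> has_derivative blinfun_apply (L z)) (at z)"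
    "\<And>z. z \<in> U \<Longrightarrow> \<epsilon> * plane_det (blinfun_apply (L z) 1) (blinfun_apply (L z) \<i>) > 0"
    using disk unfolding disk_diffeo_def by blast
  have interior: "\<tau> j u \<in> {a j<..<b j}" if "j < m" "u \<in> {-1<..<1}" for j u
  proof -
    have u: "u \<in> {-1..1}" using that by auto
    have "\<tau> j u \<noteq> a j" "\<tau> j u \<noteq> b j"
      using \<tau>(2)[OF that(1) u] \<sigma>(1,2)[OF that(1)] \<delta>[OF that(1)] that(2) by auto
    then show ?thesis using \<tau>(1)[OF that(1) u] by auto
  qed
  have velocity: "\<exists>d>0. velocity k (\<tau> j u) = (\<delta> j * d) *\<^sub>R blinfun_apply (L (c j u)) p"
    if j: "j < m" and u: "u \<in> {-1<..<1}" and p: "(c j has_vector_derivative p) (at u)" for j u p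
  proof -
    have u': "u \<in> {-1..1}" using u by auto
    obtain d where d: "d > 0" "(\<sigma> j has_real_derivative d) (at (\<tau> j u) within {a j..b j})"
      using \<sigma>(3)[OF j \<tau>(1)[OF j u']] by blast
    have "velocity k (\<tau> j u) = (\<delta> j * d) *\<^sub>R blinfun_apply (L (c j u)) p"
      by (rule velocity_on_strand[where c = "c j" and \<Phi> = \<Phi> and \<delta> = "\<delta> j", OF d(2) interior[OF j u] \<sigma>(4)[OF j]])
        (use p L(1) U(1) inside[OF j u'] in \<open>auto simp: \<tau>(2)[OF j u']\<close>)
    then show ?thesis using d(1) by blast
  qed
  show ?thesis
    unfolding traces_def
  proof (intro exI[of _ \<tau>] conjI allI impI ballI)
    fix j assume j: "j < m"
    show "\<tau> j u \<in> {a j..b j}" if "u \<in> {-1..1}" for u by (rule \<tau>(1)[OF j that])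
    show "\<tau> j u \<in> {a j<..<b j}" if "u \<in> {-1<..<1}" for u by (rule interior[OF j that])
    show "{a j..b j} \<subseteq> \<tau> j ` {-1..1}" using \<tau>'[OF j] by (metis image_eqI subsetI)
    show "inj_on (\<tau> j) {-1..1}" using \<tau>(2)[OF j] by (metis inj_onI)
  next
    fix i j u v assume *: "i < m" "j < m" "u \<in> {-1..1::real}" "v \<in> {-1..1::real}"
    then have "c i u \<in> U" "c j v \<in> U" using inside U(1) by blast+
    then show "(curve k (\<tau> i u) = curve k (\<tau> j v)) = (c i u = c j v)"
      unfolding curve[OF *(1,3)] curve[OF *(2,4)] using inj_on_eq_iff[OF U(2)] by blast
  next
    fix i j u v assume *: "i < j" "j < m" "u \<in> {-1..1::real}" "v \<in> {-1..1::real}" "c i u = c j v"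
    then have i: "i < m" by simp
    have "curve k (\<tau> i u) = curve k (\<tau> j v)" using *(5) curve[OF i *(3)] curve[OF *(2,4)] by simp
    then show "\<tau> i u \<in> over k"
      using pic *(1,2) \<tau>(1)[OF i *(3)] \<tau>(1)[OF *(2,4)] unfolding shows_picture_def by blast
  next
    fix i j u v p q
    assume *: "i < m" "j < m" "u \<in> {-1<..<1}" "v \<in> {-1<..<1}" "c i u = c j v"
      and p: "(c i has_vector_derivative p) (at u)" and q: "(c j has_vector_derivative q) (at v)"
    obtain d where d: "d > 0" "velocity k (\<tau> i u) = (\<delta> i * d) *\<^sub>R blinfun_apply (L (c i u)) p"
      using velocity[OF *(1,3) p] by blast
    obtain d' where d': "d' > 0" "velocity k (\<tau> j v) = (\<delta> j * d') *\<^sub>R blinfun_apply (L (c i u)) q"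
      using velocity[OF *(2,4) q] unfolding *(5) by blast
    let ?det = "plane_det (blinfun_apply (L (c i u)) 1) (blinfun_apply (L (c i u)) \<i>)"
    have "u \<in> {-1..1}" using *(3) by auto
    then have det: "\<epsilon> * ?det > 0" using L(2) U(1) inside[OF *(1)] by blast
    have "plane_det (velocity k (\<tau> i u)) (velocity k (\<tau> j v)) =
        (\<delta> i * d) * (\<delta> j * d') * (?det * plane_det p q)"
      unfolding d(2) d'(2) plane_det_scaleR
        plane_det_bounded_linear[OF blinfun.bounded_linear_right, of "L (c i u)" p q] ..
    \<comment> \<open>Inserting \<open>\<epsilon> * \<epsilon> = 1\<close> splits off a factor that
      is positive for both orientations.\<close>
    also have "\<dots> = (d * d' * (\<epsilon> * ?det)) * (\<epsilon> * \<delta> i * \<delta> j * plane_det p q)"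
      using \<epsilon> by auto
    finally have eq: "plane_det (velocity k (\<tau> i u)) (velocity k (\<tau> j v)) =
      (d * d' * (\<epsilon> * ?det)) * (\<epsilon> * \<delta> i * \<delta> j * plane_det p q)" .
    have pos_iff: "0 < r * y \<longleftrightarrow> 0 < y" if "r > 0" for r y :: real using that by (simp add: zero_less_mult_iff)
    have "d * d' * (\<epsilon> * ?det) > 0" by (rule mult_pos_pos[OF mult_pos_pos[OF d(1) d'(1)] det])
    then show "(0 < plane_det (velocity k (\<tau> i u)) (velocity k (\<tau> j v))) = (0 < \<epsilon> * \<delta> i * \<delta> j * plane_det p q)"
      unfolding eq by (rule pos_iff)
  qed
qed

text \<open>Locality is read off the tail. In the diagrams considered the head lies on a strand
  exactly when the tail does, because both have the same image point.\<close>

definition local_arrows :: "nat \<Rightarrow> (nat \<Rightarrow> real) \<Rightarrow> (nat \<Rightarrow> real) \<Rightarrow> diagram \<Rightarrow> (real \<times> real \<times> int) set" where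
  "local_arrows m a b k = {arrow k t h | t h. crossing k t h \<and> t \<in> over k \<and> on_strand m a b t}"

definition far_arrows :: "nat \<Rightarrow> (nat \<Rightarrow> real) \<Rightarrow> (nat \<Rightarrow> real) \<Rightarrow> diagram \<Rightarrow> (real \<times> real \<times> int) set" where
  "far_arrows m a b k = {arrow k t h | t h. crossing k t h \<and> t \<in> over k \<and> \<not> on_strand m a b t}"

text \<open>The interface between geometry and counting, from which the disk and its map have
  disappeared. The descriptions before and after a move share \<open>\<epsilon>\<close>,
  \<open>\<delta>\<close>, \<open>a\<close> and \<open>b\<close>.\<close>

definition picture_at ::
  "nat \<Rightarrow> (nat \<Rightarrow> real \<Rightarrow> complex) \<Rightarrow> real \<Rightarrow> (nat \<Rightarrow> real) \<Rightarrow> (nat \<Rightarrow> real) \<Rightarrow> (nat \<Rightarrow> real) \<Rightarrow>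
   diagram \<Rightarrow> (nat \<Rightarrow> real \<Rightarrow> real) \<Rightarrow> bool" where
  "picture_at m c \<epsilon> \<delta> a b k \<tau> \<longleftrightarrow>
     knot_diagram k \<and> strand_intervals m a b \<and> \<epsilon> \<in> {-1, 1} \<and> (\<forall>j<m. \<delta> j \<in> {-1, 1}) \<and>
     (\<forall>t h. crossing k t h \<longrightarrow> (on_strand m a b t \<longleftrightarrow> on_strand m a b h)) \<and> traces m c \<epsilon> \<delta> a b k \<tau>"

text \<open>Off the strands the curve avoids the closed set \<open>D\<close>, also at nearby
  parameters. The two curves agree there, so their velocities and the signs of crossings agree as
  well.\<close>

lemma far_arrows_subset:
  assumes k: "knot_diagram k" and k': "knot_diagram k'" and D: "closed D"
    and on: "\<And>t. on_strand m a b t \<longleftrightarrow> curve k t \<in> D"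
    and agree: "\<And>t. \<not> on_strand m a b t \<Longrightarrow> curve k' t = curve k t \<and> (t \<in> over k' \<longleftrightarrow> t \<in> over k)"
  shows "far_arrows m a b k \<subseteq> far_arrows m a b k'"
proof -
  have vel: "velocity k' t = velocity k t" if "\<not> on_strand m a b t" for t
  proof -
    have "open (curve k -` (- D))"
      using curve_isCont[OF k] D by (intro continuous_open_vimage) auto
    from has_vector_derivative_transform_within_open[OF has_velocity(1)[OF k] this, of t "curve k'"]
    have "(curve k' has_vector_derivative velocity k t) (at t)" using that on agree by auto
    then show ?thesis unfolding velocity_def[of k'] by (rule vector_derivative_at)
  qed
  show ?thesis
  proof
    fix x assume "x \<in> far_arrows m a b k"
    then obtain t h where x: "x = arrow k t h" "crossing k t h" "t \<in> over k" "\<not> on_strand m a b t"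
      unfolding far_arrows_def by blast
    then have h: "\<not> on_strand m a b h" using on unfolding crossing_def by simp
    have "arrow k t h = arrow k' t h" unfolding arrow_def vel[OF x(4)] vel[OF h] ..
    moreover have "crossing k' t h" using x(2) agree[OF x(4)] agree[OF h] unfolding crossing_def by simp
    moreover have "t \<in> over k'" using x(3) agree[OF x(4)] by simp
    ultimately show "x \<in> far_arrows m a b k'" unfolding far_arrows_def x(1) using x(4) by blast
  qed
qed

lemma shows_picture_on_strand:
  assumes k: "knot_diagram k" and pic: "shows_picture m c \<delta> \<Phi> a b k" and \<delta>: "\<And>j. j < m \<Longrightarrow> \<delta> j \<in> {-1, 1}"
    and ab: "\<And>j. j < m \<Longrightarrow> a j < b j"
    and inside: "\<And>j u. j < m \<Longrightarrow> u \<in> {-1..1} \<Longrightarrow> c j u \<in> cball 0 1"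
    and on: "on_strand m a b t"
  shows "curve k t \<in> \<Phi> ` cball 0 1"
proof -
  obtain j z where j: "j < m" "t + of_int z \<in> {a j..b j}" using on unfolding on_strand_def by blast
  obtain \<sigma> where \<sigma>: "\<sigma> (a j) = -1" "\<sigma> (b j) = 1"
    "\<And>t. t \<in> {a j..b j} \<Longrightarrow> \<exists>d>0. (\<sigma> has_real_derivative d) (at t within {a j..b j})"
    "\<And>t. t \<in> {a j..b j} \<Longrightarrow> curve k t = \<Phi> (c j (\<delta> j * \<sigma> t))"
    using pic j(1) unfolding shows_picture_def by blast
  have "\<delta> j * \<sigma> (t + of_int z) \<in> {-1..1}"
    using strand_parameter[OF ab[OF j(1)] \<sigma>(1,2) \<delta>[OF j(1)] \<sigma>(3)] j(2) by blast
  then have "curve k (t + of_int z) \<in> \<Phi> ` cball 0 1"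
    unfolding \<sigma>(4)[OF j(2)] using inside[OF j(1)] by blast
  then show ?thesis by (simp only: knot_diagram_periodic(1)[OF k])
qed

lemma replaces_picture_at:
  assumes k: "knot_diagram k" and k': "knot_diagram k'" and rep: "replaces_picture m c c' a b k k'"
    and inside: "\<And>j u. j < m \<Longrightarrow> u \<in> {-1..1} \<Longrightarrow> c j u \<in> cball 0 1"
    and inside': "\<And>j u. j < m \<Longrightarrow> u \<in> {-1..1} \<Longrightarrow> c' j u \<in> cball 0 1"
  shows "far_arrows m a b k = far_arrows m a b k' \<and>
    (\<exists>\<epsilon> \<delta> \<tau> \<tau>'. picture_at m c \<epsilon> \<delta> a b k \<tau> \<and> picture_at m c' \<epsilon> \<delta> a b k' \<tau>')"
proof -
  have strands: "strand_intervals m a b" using rep unfolding replaces_picture_def by blast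
  then have ab: "\<And>j. j < m \<Longrightarrow> a j < b j" unfolding strand_intervals_def by blast
  obtain \<epsilon> \<delta> \<Phi> \<Phi>' where
    \<epsilon>: "\<epsilon> \<in> {-1, 1}" and \<delta>: "\<forall>j<m. \<delta> j \<in> {-1, 1}" and disk: "disk_diffeo \<epsilon> \<Phi>" "disk_diffeo \<epsilon> \<Phi>'"
    and same: "\<Phi> ` cball 0 1 = \<Phi>' ` cball 0 1"
    and off: "\<forall>t. \<not> on_strand m a b t \<longrightarrow> curve k t \<notin> \<Phi> ` cball 0 1 \<and> curve k' t = curve k t \<and> (t \<in> over k' \<longleftrightarrow> t \<in> over k)"
    and pic: "shows_picture m c \<delta> \<Phi> a b k" "shows_picture m c' \<delta> \<Phi>' a b k'"
    using rep unfolding replaces_picture_def by (elim conjE exE) (rule that)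
  have \<delta>': "\<And>j. j < m \<Longrightarrow> \<delta> j \<in> {-1, 1}" using \<delta> by blast
  \<comment> \<open>Strands run inside the disk and everything else outside, so being on a strand
    depends only on the image point. Hence the two parameters of a crossing are both on strands or
    both off.\<close>
  have on: "on_strand m a b t \<longleftrightarrow> curve k t \<in> \<Phi> ` cball 0 1" for t
    using shows_picture_on_strand[OF k pic(1) \<delta>' ab inside] off by blast
  have on': "on_strand m a b t \<longleftrightarrow> curve k' t \<in> \<Phi> ` cball 0 1" for t
    using shows_picture_on_strand[OF k' pic(2) \<delta>' ab inside'] off same by metis
  obtain U L where U: "cball 0 1 \<subseteq> U"
    and L: "\<And>z. z \<in> U \<Longrightarrow> (\<Phi> has_derivative blinfun_apply (L z)) (at z)"
    using disk(1) unfolding disk_diffeo_def by blast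
  \<comment> \<open>The changing disk is a continuous image of a compact set, hence closed, as the
    comparison of the far arrows requires.\<close>
  have "continuous_on (cball 0 1) \<Phi>"
    by (rule has_derivative_continuous_on) (use U L has_derivative_at_withinI in blast)
  then have "compact (\<Phi> ` cball 0 1)" by (intro compact_continuous_image) auto
  then have "closed (\<Phi> ` cball 0 1)" by (rule compact_imp_closed)
  then have far: "far_arrows m a b k = far_arrows m a b k'"
    using off by (intro equalityI far_arrows_subset[OF k k' _ on] far_arrows_subset[OF k' k _ on']) auto
  have cr: "\<forall>t h. crossing k t h \<longrightarrow> (on_strand m a b t \<longleftrightarrow> on_strand m a b h)"
    unfolding on crossing_def by simp
  have cr': "\<forall>t h. crossing k' t h \<longrightarrow> (on_strand m a b t \<longleftrightarrow> on_strand m a b h)"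
    unfolding on' crossing_def by simp
  obtain \<tau> where "traces m c \<epsilon> \<delta> a b k \<tau>"
    using shows_picture_traces[OF ab \<delta>' \<epsilon> disk(1) pic(1) inside] by blast
  then have "picture_at m c \<epsilon> \<delta> a b k \<tau>"
    unfolding picture_at_def using k strands \<epsilon> \<delta> cr by (intro conjI)
  moreover obtain \<tau>' where "traces m c' \<epsilon> \<delta> a b k' \<tau>'"
    using shows_picture_traces[OF ab \<delta>' \<epsilon> disk(2) pic(2) inside'] by blast
  then have "picture_at m c' \<epsilon> \<delta> a b k' \<tau>'"
    unfolding picture_at_def using k' strands \<epsilon> \<delta> cr' by (intro conjI)
  ultimately show ?thesis using far by blast
qed


section \<open>Signed counts and crossings in the disk\<close>

text \<open>All strands lie in the half-open period starting at \<open>a 0\<close>, on which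
  reduction modulo 1 is injective.\<close>

lemma strand_frac_inj:
  assumes strands: "strand_intervals m a b" and ij: "i < m" "j < m"
    and x: "x \<in> {a i..b i}" and y: "y \<in> {a j..b j}" and eq: "frac x = frac y"
  shows "x = y" "i = j"
proof -
  have "a 0 \<le> x" "x < a 0 + 1" "a 0 \<le> y" "y < a 0 + 1"
    using strands ij x y unfolding strand_intervals_def by force+
  moreover obtain z where z: "x = y + of_int z" using eq unfolding frac_eq_iff_add_int by blast
  ultimately have "of_int z < (1::real)" "(-1::real) < of_int z" by linarith+
  then have "z = 0" by linarith
  then show "x = y" using z by simp
  then show "i = j" using strands ij x y unfolding strand_intervals_def by blast
qed

lemma strand_intervals_length:
  assumes "strand_intervals m a b" "i < m"
  shows "b i < a i + 1" "a i < b i"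
proof -
  have "a 0 \<le> a i \<and> a i < b i \<and> b i < a 0 + 1" using assms unfolding strand_intervals_def by blast
  then show "b i < a i + 1" "a i < b i" by linarith+
qed

lemma on_strand_cong:
  assumes "frac s = frac t"
  shows "on_strand m a b s \<longleftrightarrow> on_strand m a b t"
proof -
  have *: "on_strand m a b t" if on: "on_strand m a b s" and eq: "frac s = frac t" for s t
  proof -
    obtain j z where j: "j < m" "s + of_int z \<in> {a j..b j}" using on unfolding on_strand_def by blast
    obtain w where "s = t + of_int w" using eq unfolding frac_eq_iff_add_int by blast
    then have "t + of_int (w + z) \<in> {a j..b j}" using j(2) by (simp add: add.assoc)
    then show ?thesis using j(1) unfolding on_strand_def by blast
  qed
  then show ?thesis using assms by metis
qed

lemma on_strandI: "j < m \<Longrightarrow> x \<in> {a j..b j} \<Longrightarrow> on_strand m a b x"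
  unfolding on_strand_def by (intro exI[of _ j] conjI exI[of _ 0]) auto

lemma gauss_diagram_split:
  assumes "knot_diagram k"
  shows "gauss_diagram k = far_arrows m a b k \<union> local_arrows m a b k"
    "far_arrows m a b k \<inter> local_arrows m a b k = {}"
proof -
  show "gauss_diagram k = far_arrows m a b k \<union> local_arrows m a b k"
    unfolding gauss_diagram_eq[OF assms] far_arrows_def local_arrows_def by blast
  show "far_arrows m a b k \<inter> local_arrows m a b k = {}"
  proof (rule ccontr)
    assume "far_arrows m a b k \<inter> local_arrows m a b k \<noteq> {}"
    then obtain t h t' h' where "arrow k t h = arrow k t' h'" "\<not> on_strand m a b t" "on_strand m a b t'"
      unfolding far_arrows_def local_arrows_def by blast
    moreover from this have "frac t = frac t'" unfolding arrow_def by simp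
    ultimately show False using on_strand_cong by metis
  qed
qed

lemma frac_far_arrows: "\<forall>(t, h, e)\<in>far_arrows m a b k. frac t = t \<and> frac h = h"
  unfolding far_arrows_def arrow_def by auto

lemma picture_atD:
  assumes "picture_at m c \<epsilon> \<delta> a b k \<tau>"
  shows "knot_diagram k" "strand_intervals m a b" "\<epsilon> \<in> {-1, 1}" "j < m \<Longrightarrow> \<delta> j \<in> {-1, 1}"
    "crossing k t h \<Longrightarrow> on_strand m a b t \<longleftrightarrow> on_strand m a b h"
    "j < m \<Longrightarrow> u \<in> {-1..1} \<Longrightarrow> \<tau> j u \<in> {a j..b j}"
    "j < m \<Longrightarrow> u \<in> {-1<..<1} \<Longrightarrow> \<tau> j u \<in> {a j<..<b j}"
    "j < m \<Longrightarrow> x \<in> {a j..b j} \<Longrightarrow> \<exists>u\<in>{-1..1}. x = \<tau> j u"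
    "j < m \<Longrightarrow> inj_on (\<tau> j) {-1..1}"
    "i < m \<Longrightarrow> j < m \<Longrightarrow> u \<in> {-1..1} \<Longrightarrow> v \<in> {-1..1} \<Longrightarrow> curve k (\<tau> i u) = curve k (\<tau> j v) \<longleftrightarrow> c i u = c j v"
    "i < j \<Longrightarrow> j < m \<Longrightarrow> u \<in> {-1..1} \<Longrightarrow> v \<in> {-1..1} \<Longrightarrow> c i u = c j v \<Longrightarrow> \<tau> i u \<in> over k"
proof -
  note P = assms[unfolded picture_at_def traces_def]
  note T = P[THEN conjunct2, THEN conjunct2, THEN conjunct2, THEN conjunct2, THEN conjunct2]
  show "knot_diagram k" by (rule P[THEN conjunct1])
  show "strand_intervals m a b" by (rule P[THEN conjunct2, THEN conjunct1])
  show "\<epsilon> \<in> {-1, 1}" by (rule P[THEN conjunct2, THEN conjunct2, THEN conjunct1])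
  show "\<delta> j \<in> {-1, 1}" if "j < m"
    by (rule P[THEN conjunct2, THEN conjunct2, THEN conjunct2, THEN conjunct1, rule_format, OF that])
  show "on_strand m a b t \<longleftrightarrow> on_strand m a b h" if "crossing k t h"
    by (rule P[THEN conjunct2, THEN conjunct2, THEN conjunct2, THEN conjunct2, THEN conjunct1, rule_format, OF that])
  note T1 = T[THEN conjunct1, rule_format]
  show "\<tau> j u \<in> {a j..b j}" if "j < m" "u \<in> {-1..1}" using T1[OF that(1)] that(2) by blast
  show "\<tau> j u \<in> {a j<..<b j}" if "j < m" "u \<in> {-1<..<1}" using T1[OF that(1)] that(2) by blast
  show "\<exists>u\<in>{-1..1}. x = \<tau> j u" if "j < m" "x \<in> {a j..b j}" using T1[OF that(1)] that(2) by blast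
  show "inj_on (\<tau> j) {-1..1}" if "j < m" using T1[OF that] by blast
  show "curve k (\<tau> i u) = curve k (\<tau> j v) \<longleftrightarrow> c i u = c j v"
    if "i < m" "j < m" "u \<in> {-1..1}" "v \<in> {-1..1}"
    by (rule T[THEN conjunct2, THEN conjunct1, rule_format, OF that])
  show "\<tau> i u \<in> over k" if "i < j" "j < m" "u \<in> {-1..1}" "v \<in> {-1..1}" "c i u = c j v"
    by (rule T[THEN conjunct2, THEN conjunct2, THEN conjunct1, rule_format, OF that])
qed

lemma picture_at_sign:
  assumes "picture_at m c \<epsilon> \<delta> a b k \<tau>" "i < m" "j < m" "u \<in> {-1<..<1}" "v \<in> {-1<..<1}" "c i u = c j v"
    "(c i has_vector_derivative p) (at u)" "(c j has_vector_derivative q) (at v)"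
  shows "plane_det (velocity k (\<tau> i u)) (velocity k (\<tau> j v)) > 0 \<longleftrightarrow> \<epsilon> * \<delta> i * \<delta> j * plane_det p q > 0"
  by (rule assms(1)[unfolded picture_at_def traces_def, THEN conjunct2, THEN conjunct2, THEN conjunct2,
        THEN conjunct2, THEN conjunct2, THEN conjunct2, THEN conjunct2, THEN conjunct2, rule_format, OF assms(2-)])

lemma strand_lift:
  assumes pic: "picture_at m c \<epsilon> \<delta> a b k \<tau>" and on: "on_strand m a b t"
  shows "\<exists>i u. i < m \<and> u \<in> {-1..1} \<and> frac t = frac (\<tau> i u)"
proof -
  obtain j z where j: "j < m" "t + of_int z \<in> {a j..b j}" using on unfolding on_strand_def by blast
  obtain u where "u \<in> {-1..1}" "t + of_int z = \<tau> j u" using picture_atD(8)[OF pic j] by blast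
  then show ?thesis using j(1) frac_add_int[of t z] by metis
qed

lemma local_crossing:
  assumes pic: "picture_at m c \<epsilon> \<delta> a b k \<tau>" and cr: "crossing k t h" and on: "on_strand m a b t"
  shows "\<exists>i u j v. i < m \<and> j < m \<and> u \<in> {-1..1} \<and> v \<in> {-1..1} \<and> frac t = frac (\<tau> i u) \<and> frac h = frac (\<tau> j v) \<and>
    c i u = c j v \<and> (i, u) \<noteq> (j, v)"
proof -
  note k = picture_atD(1)[OF pic]
  obtain i u where i: "i < m" "u \<in> {-1..1}" "frac t = frac (\<tau> i u)" using strand_lift[OF pic on] by blast
  have "on_strand m a b h" using on picture_atD(5)[OF pic cr] by simp
  then obtain j v where j: "j < m" "v \<in> {-1..1}" "frac h = frac (\<tau> j v)" using strand_lift[OF pic] by blast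
  have "curve k (\<tau> i u) = curve k (\<tau> j v)"
    using cr i(3) j(3) knot_diagram_frac(1)[OF k] unfolding crossing_def by metis
  then have "c i u = c j v" using picture_atD(10)[OF pic i(1) j(1) i(2) j(2)] by blast
  moreover have "(i, u) \<noteq> (j, v)" using cr i(3) j(3) unfolding crossing_def by auto
  ultimately show ?thesis using i j by blast
qed

lemma ends_far_arrows:
  assumes pic: "picture_at m c \<epsilon> \<delta> a b k \<tau>" and on: "on_strand m a b x"
  shows "frac x \<notin> ends (far_arrows m a b k)"
proof
  assume "frac x \<in> ends (far_arrows m a b k)"
  then obtain t h where th: "crossing k t h" "\<not> on_strand m a b t" "frac x = frac t \<or> frac x = frac h"
    unfolding ends_def far_arrows_def arrow_def by auto
  then have "\<not> on_strand m a b h" using picture_atD(5)[OF pic th(1)] by simp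
  then show False using th(2,3) on on_strand_cong by metis
qed

lemma ends_local_arrows:
  assumes pic: "picture_at m c \<epsilon> \<delta> a b k \<tau>" and x: "frac x \<in> ends (local_arrows m a b k)"
  shows "\<exists>i u j v. i < m \<and> j < m \<and> u \<in> {-1..1} \<and> v \<in> {-1..1} \<and> frac x = frac (\<tau> i u) \<and>
    c i u = c j v \<and> (i, u) \<noteq> (j, v)"
proof -
  obtain t h where th: "crossing k t h" "on_strand m a b t" "frac x = frac t \<or> frac x = frac h"
    using x unfolding ends_def local_arrows_def arrow_def by auto
  obtain i u j v where *: "i < m" "j < m" "u \<in> {-1..1}" "v \<in> {-1..1}" "frac t = frac (\<tau> i u)"
    "frac h = frac (\<tau> j v)" "c i u = c j v" "(i, u) \<noteq> (j, v)"
    using local_crossing[OF pic th(1,2)] by blast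
  show ?thesis
  proof (cases "frac x = frac t")
    case True
    then show ?thesis using * by metis
  next
    case False
    then have "frac x = frac (\<tau> j v)" using th(3) *(6) by simp
    then show ?thesis using *(1-4) *(7)[symmetric] *(8)[symmetric] by blast
  qed
qed

text \<open>An endpoint strictly between the two would lie on strand \<open>i\<close>, hence belong
  to a local arrow, and its parameter would be that of a crossing on the curve \<open>c i\<close>;
  by \<open>only\<close> it is one of the two points themselves.\<close>

lemma consecutive_on_strand:
  assumes pic: "picture_at m c \<epsilon> \<delta> a b k \<tau>" and S: "S \<subseteq> gauss_diagram k" and i: "i < m"
    and uv: "u \<in> {-1..1}" "v \<in> {-1..1}" "u \<noteq> v"
    and only: "\<And>w j w'. w \<in> {-1..1} \<Longrightarrow> j < m \<Longrightarrow> w' \<in> {-1..1} \<Longrightarrow> c i w = c j w' \<Longrightarrow> (i, w) \<noteq> (j, w') \<Longrightarrow> w = u \<or> w = v"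
  shows "consecutive S (\<tau> i u) (\<tau> i v)"
  unfolding consecutive_def
proof (intro conjI allI impI notI)
  assume "\<tau> i u = \<tau> i v"
  then show False using inj_onD[OF picture_atD(9)[OF pic i]] uv by blast
next
  fix x assume between: "min (\<tau> i u) (\<tau> i v) < x" "x < max (\<tau> i u) (\<tau> i v)" and x: "frac x \<in> ends S"
  note k = picture_atD(1)[OF pic] and strands = picture_atD(2)[OF pic]
  have "\<tau> i u \<in> {a i..b i}" "\<tau> i v \<in> {a i..b i}" using picture_atD(6)[OF pic i] uv by blast+
  then have xi: "x \<in> {a i..b i}" using between by auto
  then have "frac x \<notin> ends (far_arrows m a b k)" using ends_far_arrows[OF pic on_strandI[OF i]] by blast
  then have "frac x \<in> ends (local_arrows m a b k)"
    using x ends_mono[OF S] unfolding gauss_diagram_split(1)[OF k, of m a b] by auto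
  then obtain i' w j w' where *: "i' < m" "j < m" "w \<in> {-1..1}" "w' \<in> {-1..1}" "frac x = frac (\<tau> i' w)"
    "c i' w = c j w'" "(i', w) \<noteq> (j, w')"
    using ends_local_arrows[OF pic] by blast
  have "\<tau> i' w \<in> {a i'..b i'}" using picture_atD(6)[OF pic *(1,3)] .
  note strand_frac_inj[OF strands i *(1) xi this *(5)]
  then have "x = \<tau> i w" "i' = i" by simp_all
  moreover from this have "w = u \<or> w = v" using only[OF *(3,2,4)] *(6,7) by blast
  ultimately show False using between by auto
qed

text \<open>The over strand comes first, because the smaller index is over. Self-crossings of a
  curve are not listed, so the kink has to be treated separately.\<close>

definition crossing_table :: "nat \<Rightarrow> (nat \<Rightarrow> real \<Rightarrow> complex) \<Rightarrow> (nat \<times> real \<times> nat \<times> real) set" where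
  "crossing_table m c = {(i, u, j, v). i < j \<and> j < m \<and> u \<in> {-1..1} \<and> v \<in> {-1..1} \<and> c i u = c j v}"

definition table_arrow :: "diagram \<Rightarrow> (nat \<Rightarrow> real \<Rightarrow> real) \<Rightarrow> nat \<times> real \<times> nat \<times> real \<Rightarrow> real \<times> real \<times> int" where
  "table_arrow k \<tau> = (\<lambda>(i, u, j, v). arrow k (\<tau> i u) (\<tau> j v))"

text \<open>Injectivity of each curve rules out self-crossings, so every local crossing joins two
  strands and is a row of the table. Distinct rows give distinct arrows because points of strands
  are distinct modulo 1.\<close>

lemma local_arrows_table:
  assumes pic: "picture_at m c \<epsilon> \<delta> a b k \<tau>" and inj: "\<And>j. j < m \<Longrightarrow> inj_on (c j) {-1..1}"
  shows "local_arrows m a b k = table_arrow k \<tau> ` crossing_table m c"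
    "inj_on (table_arrow k \<tau>) (crossing_table m c)"
proof -
  note k = picture_atD(1)[OF pic] and strands = picture_atD(2)[OF pic]
  have \<tau>_inj: "i = j \<and> u = v" if "frac (\<tau> i u) = frac (\<tau> j v)" "i < m" "j < m" "u \<in> {-1..1}" "v \<in> {-1..1}" for i j u v
  proof -
    note strand_frac_inj[OF strands that(2,3) picture_atD(6)[OF pic that(2,4)] picture_atD(6)[OF pic that(3,5)] that(1)]
    then show ?thesis using inj_onD[OF picture_atD(9)[OF pic that(2)] _ that(4,5)] by blast
  qed
  show "local_arrows m a b k = table_arrow k \<tau> ` crossing_table m c"
  proof
    show "local_arrows m a b k \<subseteq> table_arrow k \<tau> ` crossing_table m c"
    proof
      fix x assume "x \<in> local_arrows m a b k"
      then obtain t h where x: "x = arrow k t h" "crossing k t h" "t \<in> over k" "on_strand m a b t"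
        unfolding local_arrows_def by blast
      obtain i u j v where *: "i < m" "j < m" "u \<in> {-1..1}" "v \<in> {-1..1}" "frac t = frac (\<tau> i u)"
        "frac h = frac (\<tau> j v)" "c i u = c j v" "(i, u) \<noteq> (j, v)"
        using local_crossing[OF pic x(2,4)] by blast
      have "velocity k t = velocity k (\<tau> i u)" "velocity k h = velocity k (\<tau> j v)"
        using *(5,6) knot_diagram_frac(3)[OF k] by metis+
      then have "x = arrow k (\<tau> i u) (\<tau> j v)" unfolding x(1) arrow_def *(5,6) by simp
      moreover have "i \<noteq> j" using *(3,4,7,8) inj_onD[OF inj[OF *(1)]] by blast
      \<comment> \<open>Otherwise the picture would put the head \<open>h\<close> over as well, but
        exactly one parameter of a crossing is over.\<close>
      moreover have "\<not> j < i"
      proof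
        assume "j < i"
        then have "\<tau> j v \<in> over k" using picture_atD(11)[OF pic _ *(1,4,3)] *(7) by simp
        then have "h \<in> over k" using *(6) knot_diagram_frac(2)[OF k] by metis
        then show False using crossing_over[OF k x(2)] x(3) by blast
      qed
      ultimately have "x = table_arrow k \<tau> (i, u, j, v)" "(i, u, j, v) \<in> crossing_table m c"
        using * unfolding table_arrow_def crossing_table_def by auto
      then show "x \<in> table_arrow k \<tau> ` crossing_table m c" by blast
    qed
    show "table_arrow k \<tau> ` crossing_table m c \<subseteq> local_arrows m a b k"
    proof
      fix x assume "x \<in> table_arrow k \<tau> ` crossing_table m c"
      then obtain i u j v where x: "x = arrow k (\<tau> i u) (\<tau> j v)" and
        *: "i < j" "j < m" "u \<in> {-1..1}" "v \<in> {-1..1}" "c i u = c j v"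
        unfolding table_arrow_def crossing_table_def by auto
      have i: "i < m" using * by simp
      have "crossing k (\<tau> i u) (\<tau> j v)"
        using \<tau>_inj[OF _ i *(2-4)] *(1,5) picture_atD(10)[OF pic i *(2-4)] unfolding crossing_def by auto
      moreover have "\<tau> i u \<in> over k" by (rule picture_atD(11)[OF pic *])
      moreover have "on_strand m a b (\<tau> i u)" 
        by (rule on_strandI[OF i]) (rule picture_atD(6)[OF pic i *(3)])
      ultimately show "x \<in> local_arrows m a b k" unfolding local_arrows_def x by blast
    qed
  qed
  show "inj_on (table_arrow k \<tau>) (crossing_table m c)"
  proof (rule inj_onI)
    fix x y assume "x \<in> crossing_table m c" "y \<in> crossing_table m c" and eq: "table_arrow k \<tau> x = table_arrow k \<tau> y"
    then obtain i u j v i' u' j' v' where xy: "x = (i, u, j, v)" "y = (i', u', j', v')" and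
      *: "i < m" "j < m" "u \<in> {-1..1}" "v \<in> {-1..1}" "i' < m" "j' < m" "u' \<in> {-1..1}" "v' \<in> {-1..1}"
      unfolding crossing_table_def by (cases x, cases y) auto
    have "frac (\<tau> i u) = frac (\<tau> i' u')" "frac (\<tau> j v) = frac (\<tau> j' v')"
      using eq unfolding xy table_arrow_def arrow_def by simp_all
    then have "i = i' \<and> u = u'" "j = j' \<and> v = v'"
      using \<tau>_inj *(1,5,3,7) \<tau>_inj *(2,6,4,8) by blast+
    then show "x = y" unfolding xy by simp
  qed
qed

text \<open>The signed number of ways to complete one arrow by arrows of \<open>U\<close>, without
  the sign of that arrow; the 1 is a placeholder, as forms disregard signs.\<close>

definition weight :: "nat \<Rightarrow> (nat \<times> nat) set \<Rightarrow> (real \<times> real \<times> int) set \<Rightarrow> real \<Rightarrow> real \<Rightarrow> int" where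
  "weight n X U p q = (\<Sum>S | S \<subseteq> U \<and> has_form n X (insert (frac p, frac q, 1) S). sign_of S)"

text \<open>The arrows of \<open>U\<close> have no endpoints on strands and the two strands are
  disjoint, so every completion survives sliding to the other pair of points and back.\<close>

lemma weight_cong:
  assumes strands: "strand_intervals m a b" and ij: "i < m" "j < m" "i \<noteq> j"
    and p: "p \<in> {a i<..<b i}" "p' \<in> {a i<..<b i}" and q: "q \<in> {a j<..<b j}" "q' \<in> {a j<..<b j}"
    and U: "\<forall>(t, h, e)\<in>U. frac t = t \<and> frac h = h" "\<And>x. on_strand m a b x \<Longrightarrow> frac x \<notin> ends U"
  shows "(\<Sum>S | S \<subseteq> U \<and> has_form n X (insert (frac p, frac q, e) S). sign_of S) = weight n X U p' q'"
proof -
  have disj: "frac ` {a i<..<b i} \<inter> frac ` {a j<..<b j} = {}"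
  proof (rule ccontr)
    assume "frac ` {a i<..<b i} \<inter> frac ` {a j<..<b j} \<noteq> {}"
    then obtain x y where "x \<in> {a i<..<b i}" "y \<in> {a j<..<b j}" "frac x = frac y" by blast
    then have "i = j" by (intro strand_frac_inj(2)[OF strands ij(1,2), of x y]) auto
    then show False using ij(3) by blast
  qed
  have avoid: "ends S \<inter> frac ` {a l<..<b l} = {}" if "S \<subseteq> U" "l < m" for S l
  proof -
    have "frac x \<notin> ends U" if "x \<in> {a l<..<b l}" for x
      using that by (intro U(2) on_strandI[OF \<open>l < m\<close>]) auto
    then show ?thesis using ends_mono[OF that(1)] by blast
  qed
  have "has_form n X (insert (frac p, frac q, e) S) \<longleftrightarrow> has_form n X (insert (frac p', frac q', 1) S)" if "S \<subseteq> U" for S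
  proof -
    have S: "\<forall>(t, h, e)\<in>S. frac t = t \<and> frac h = h" using U(1) that by blast
    note move = has_form_insert_move[OF strand_intervals_length(1)[OF strands ij(1)]
        strand_intervals_length(1)[OF strands ij(2)] _ _ _ _ disj S avoid[OF that ij(1)] avoid[OF that ij(2)]]
    show ?thesis using move[OF p q] move[OF p(2,1) q(2,1)] by blast
  qed
  then show ?thesis unfolding weight_def by (intro sum.cong) auto
qed

text \<open>Endpoints can be moved freely inside their strands without changing the form of a subdiagram,
  so the midpoints of the strands serve as reference points.\<close>

lemma signed_count_picture:
  assumes pic: "picture_at m c \<epsilon> \<delta> a b k \<tau>" and inj: "\<And>j. j < m \<Longrightarrow> inj_on (c j) {-1..1}"
    and fin: "finite (crossing_table m c)"
    and interior: "\<And>i u j v. (i, u, j, v) \<in> crossing_table m c \<Longrightarrow> u \<in> {-1<..<1} \<and> v \<in> {-1<..<1}"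
    and deriv: "\<And>j u. j < m \<Longrightarrow> (c j has_vector_derivative c' j u) (at u)"
    and single: "\<And>S x y. S \<subseteq> gauss_diagram k \<Longrightarrow> has_form n X S \<Longrightarrow> x \<in> crossing_table m c \<Longrightarrow>
      y \<in> crossing_table m c \<Longrightarrow> table_arrow k \<tau> x \<in> S \<Longrightarrow> table_arrow k \<tau> y \<in> S \<Longrightarrow> x = y"
  shows "signed_count n X k = (\<Sum>S | S \<subseteq> far_arrows m a b k \<and> has_form n X S. sign_of S) +
    (\<Sum>(i, u, j, v)\<in>crossing_table m c. (if \<epsilon> * \<delta> i * \<delta> j * plane_det (c' i u) (c' j v) > 0 then 1 else -1) *
       weight n X (far_arrows m a b k) ((a i + b i) / 2) ((a j + b j) / 2))"
proof -
  let ?U = "far_arrows m a b k" and ?L = "local_arrows m a b k" and ?T = "crossing_table m c"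
  note k = picture_atD(1)[OF pic] and strands = picture_atD(2)[OF pic]
  note split = gauss_diagram_split[OF k, of m a b]
  have table: "?L = table_arrow k \<tau> ` ?T" "inj_on (table_arrow k \<tau>) ?T"
    using local_arrows_table[OF pic] inj by blast+
  have "finite ?U" "finite ?L" using finite_gauss_diagram[OF k] unfolding split(1) by simp_all
  moreover have "x = y" if S: "S \<subseteq> ?U \<union> ?L" "has_form n X S" "x \<in> S \<inter> ?L" "y \<in> S \<inter> ?L" for S x y
  proof -
    obtain x' y' where "x' \<in> ?T" "y' \<in> ?T" "x = table_arrow k \<tau> x'" "y = table_arrow k \<tau> y'"
      using S(3,4) unfolding table(1) by blast
    then show ?thesis using single[of S x' y'] S unfolding split(1) by blast
  qed
  ultimately have "signed_count n X k = (\<Sum>S | S \<subseteq> ?U \<and> has_form n X S. sign_of S) +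
    (\<Sum>x\<in>?L. snd (snd x) * (\<Sum>S | S \<subseteq> ?U \<and> has_form n X (insert x S). sign_of S))"
    unfolding signed_count_def split(1) by (intro sum_forms_split split(2))
  also have "(\<Sum>x\<in>?L. snd (snd x) * (\<Sum>S | S \<subseteq> ?U \<and> has_form n X (insert x S). sign_of S)) =
    (\<Sum>y\<in>?T. snd (snd (table_arrow k \<tau> y)) * (\<Sum>S | S \<subseteq> ?U \<and> has_form n X (insert (table_arrow k \<tau> y) S). sign_of S))"
    unfolding table(1) by (subst sum.reindex[OF table(2)]) simp
  also have "\<dots> = (\<Sum>(i, u, j, v)\<in>?T. (if \<epsilon> * \<delta> i * \<delta> j * plane_det (c' i u) (c' j v) > 0 then 1 else -1) *
       weight n X ?U ((a i + b i) / 2) ((a j + b j) / 2))"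
  proof (rule sum.cong)
    fix y assume "y \<in> ?T"
    moreover obtain i u j v where y: "y = (i, u, j, v)" by (cases y)
    ultimately have T: "(i, u, j, v) \<in> ?T" by simp
    then have *: "i < j" "i < m" "j < m" "c i u = c j v" unfolding crossing_table_def by auto
    have uv: "u \<in> {-1<..<1}" "v \<in> {-1<..<1}" using interior[OF T] by auto
    define e :: int where "e = (if \<epsilon> * \<delta> i * \<delta> j * plane_det (c' i u) (c' j v) > 0 then 1 else -1)"
    \<comment> \<open>The sign is now computed from the plane curves, \<open>\<epsilon>\<close> and
      \<open>\<delta>\<close>, so it can be compared across a move.\<close>
    have ta: "table_arrow k \<tau> y = (frac (\<tau> i u), frac (\<tau> j v), e)"
      unfolding y table_arrow_def arrow_def e_def prod.case
        picture_at_sign[OF pic *(2,3) uv *(4) deriv[OF *(2)] deriv[OF *(3)]] ..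
    have "(\<Sum>S | S \<subseteq> ?U \<and> has_form n X (insert (table_arrow k \<tau> y) S). sign_of S) =
      weight n X ?U ((a i + b i) / 2) ((a j + b j) / 2)"
      unfolding ta
    proof (rule weight_cong[OF strands *(2,3)])
      show "i \<noteq> j" using *(1) by simp
      show "\<tau> i u \<in> {a i<..<b i}" "\<tau> j v \<in> {a j<..<b j}"
        using picture_atD(7)[OF pic] *(2,3) uv by blast+
      show "(a i + b i) / 2 \<in> {a i<..<b i}" "(a j + b j) / 2 \<in> {a j<..<b j}"
        using strand_intervals_length(2)[OF strands] *(2,3) by auto
    qed (rule frac_far_arrows ends_far_arrows[OF pic], assumption?)+
    then show "snd (snd (table_arrow k \<tau> y)) * (\<Sum>S | S \<subseteq> ?U \<and> has_form n X (insert (table_arrow k \<tau> y) S). sign_of S) =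
      (case y of (i, u, j, v) \<Rightarrow> (if \<epsilon> * \<delta> i * \<delta> j * plane_det (c' i u) (c' j v) > 0 then 1 else -1) *
       weight n X ?U ((a i + b i) / 2) ((a j + b j) / 2))"
      unfolding y prod.case e_def[symmetric] ta[unfolded y] by simp
  qed simp
  finally show ?thesis .
qed


section \<open>Reidemeister moves\<close>

text \<open>Apart from the straight arc, the pictures lie in rectangles with half sides 3/5 and 4/5,
  which are inscribed in the unit disk.\<close>

lemma Complex_in_cball:
  assumes "\<bar>x\<bar> \<le> p" "\<bar>y\<bar> \<le> q" "p\<^sup>2 + q\<^sup>2 \<le> 1"
  shows "Complex x y \<in> cball 0 1"
proof -
  have "x\<^sup>2 \<le> p\<^sup>2" "y\<^sup>2 \<le> q\<^sup>2" using power_mono[OF assms(1), of 2] power_mono[OF assms(2), of 2] by simp_all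
  then have "(cmod (Complex x y))\<^sup>2 \<le> 1" using assms(3) by (simp add: cmod_power2)
  then have "cmod (Complex x y) \<le> 1" by (simp add: power_le_one_iff abs_square_le_1)
  then show ?thesis by simp
qed

lemma square_le_1: "u \<in> {-1..1} \<Longrightarrow> u\<^sup>2 \<le> (1::real)"
  by (simp add: abs_le_iff abs_square_le_1)

lemma four_squares_bound:
  assumes "u \<in> {-1..1::real}"
  shows "\<bar>4 * u\<^sup>2 - 1\<bar> \<le> 3"
  using square_le_1[OF assms] zero_le_power2[of u] by linarith

lemma straight_arc_inside: "u \<in> {-1..1} \<Longrightarrow> straight_arc j u \<in> cball 0 1"
  by (auto simp: straight_arc_def)

lemma kinked_arc_inside:
  assumes "u \<in> {-1..1}"
  shows "kinked_arc j u \<in> cball 0 1"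
  unfolding kinked_arc_def
proof (rule Complex_in_cball)
  have "\<bar>u\<bar> * \<bar>4 * u\<^sup>2 - 1\<bar> \<le> 1 * 3"
    using four_squares_bound[OF assms] assms by (intro mult_mono) auto
  then show "\<bar>u * (4 * u\<^sup>2 - 1) / 5\<bar> \<le> 3 / 5" by (simp add: abs_mult)
  show "\<bar>4 * u\<^sup>2 / 5\<bar> \<le> 4 / 5" using square_le_1[OF assms] by simp
qed (simp add: power2_eq_square)

lemma disjoint_arcs_inside: "u \<in> {-1..1} \<Longrightarrow> disjoint_arcs j u \<in> cball 0 1"
  unfolding disjoint_arcs_def
  by (rule Complex_in_cball[of _ "4 / 5" _ "3 / 5"]) (auto simp: power2_eq_square)

lemma bigon_arcs_inside:
  assumes "u \<in> {-1..1}"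
  shows "bigon_arcs j u \<in> cball 0 1"
  unfolding bigon_arcs_def
  by (rule Complex_in_cball[of _ "4 / 5" _ "3 / 5"])
    (use assms four_squares_bound[OF assms] in \<open>auto simp: power2_eq_square\<close>)

lemma triangle_arcs_inside:
  assumes "u \<in> {-1..1}" "\<bar>y\<bar> = 3 / 5"
  shows "triangle_arcs y j u \<in> cball 0 1"
proof -
  have "Complex (4 * u / 5) y \<in> cball 0 1"
    by (rule Complex_in_cball[of _ "4 / 5" _ "3 / 5"]) (use assms in \<open>auto simp: power2_eq_square\<close>)
  moreover have "Complex (3 * u / 5) (4 * u / 5) \<in> cball 0 1" "Complex (3 * u / 5) (- 4 * u / 5) \<in> cball 0 1"
    by (rule Complex_in_cball[of _ "3 / 5" _ "4 / 5"]; use assms in \<open>auto simp: power2_eq_square\<close>)+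
  ultimately show ?thesis unfolding triangle_arcs_def by simp
qed

lemma straight_arc_inj: "inj_on (straight_arc j) A"
  by (auto simp: inj_on_def straight_arc_def)

lemma disjoint_arcs_inj: "inj_on (disjoint_arcs j) A"
  by (auto simp: inj_on_def disjoint_arcs_def)

lemma bigon_arcs_inj: "inj_on (bigon_arcs j) A"
  by (auto simp: inj_on_def bigon_arcs_def)

lemma triangle_arcs_inj: "inj_on (triangle_arcs y j) A"
  by (auto simp: inj_on_def triangle_arcs_def)

text \<open>Equal imaginary parts force \<open>v = - u\<close>. The real part is odd, so it
  vanishes, and as \<open>u \<noteq> 0\<close> this leaves \<open>4 * u\<^sup>2 = 1\<close>.\<close>

lemma kinked_arc_crossing:
  assumes "kinked_arc i u = kinked_arc j v" "u \<noteq> v"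
  shows "u = 1 / 2 \<and> v = - 1 / 2 \<or> u = - 1 / 2 \<and> v = 1 / 2"
proof -
  have eqs: "u * (4 * u\<^sup>2 - 1) = v * (4 * v\<^sup>2 - 1)" "u\<^sup>2 = v\<^sup>2"
    using assms(1) unfolding kinked_arc_def complex.inject by (elim conjE, linarith)+
  then have v: "v = - u" using assms(2) by (auto simp: power2_eq_iff)
  then have "u * (4 * u\<^sup>2 - 1) = 0" using eqs(1) by simp
  moreover have "u \<noteq> 0" using assms(2) v by auto
  ultimately have "u\<^sup>2 = (1 / 2)\<^sup>2" by (simp add: power2_eq_square)
  then have "u = 1 / 2 \<or> u = - (1 / 2)" by (simp only: power2_eq_iff)
  then show ?thesis using v by auto
qed

text \<open>Equal real parts give \<open>u = v\<close>, and the arcs are mirror images in the real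
  axis, so they meet on it.\<close>

lemma bigon_arcs_crossing:
  assumes "bigon_arcs i u = bigon_arcs j v" "i < 2" "j < 2" "(i, u) \<noteq> (j, v)"
  shows "u = v \<and> (u = 1 / 2 \<or> u = - 1 / 2)"
proof -
  have "u = v" using assms(1) by (simp add: bigon_arcs_def)
  then have "i = 0 \<longleftrightarrow> j \<noteq> 0" using assms(2-4) by auto
  then have "4 * u\<^sup>2 - 1 = - (4 * u\<^sup>2 - 1)"
    using assms(1) \<open>u = v\<close> by (auto simp: bigon_arcs_def split: if_splits)
  then have "u\<^sup>2 = (1 / 2)\<^sup>2" by (simp add: power2_eq_square)
  then have "u = 1 / 2 \<or> u = - (1 / 2)" by (simp only: power2_eq_iff)
  then show ?thesis using \<open>u = v\<close> by auto
qed

lemma disjoint_arcs_table: "crossing_table 2 disjoint_arcs = {}"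
  by (auto simp: crossing_table_def disjoint_arcs_def split: if_splits)

lemma bigon_arcs_table: "crossing_table 2 bigon_arcs = {(0, 1 / 2, 1, 1 / 2), (0, - 1 / 2, 1, - 1 / 2)}"
proof (intro set_eqI iffI)
  fix x assume "x \<in> crossing_table 2 bigon_arcs"
  then obtain i u j v where x: "x = (i, u, j, v)" "i < j" "j < 2" "bigon_arcs i u = bigon_arcs j v"
    unfolding crossing_table_def by auto
  then show "x \<in> {(0, 1 / 2, 1, 1 / 2), (0, - 1 / 2, 1, - 1 / 2)}"
    using bigon_arcs_crossing[OF x(4)] by auto
qed (auto simp: crossing_table_def bigon_arcs_def power2_eq_square)

text \<open>The factor \<open>r\<close> treats both heights of the top strand at once. The middle
  strand has height \<open>r * (3 / 5)\<close> at \<open>r * (3 / 4)\<close>, with real part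
  \<open>r * (9 / 20)\<close>, which the top strand attains at \<open>r * (9 / 16)\<close>. The
  bottom strand is the mirror image in the real axis, so there both parameters change sign.\<close>

lemma triangle_arcs_crossing:
  assumes "triangle_arcs (r * (3 / 5)) i u = triangle_arcs (r * (3 / 5)) j v" "i < j" "j < 3"
  shows "(i, u, j, v) \<in> {(0, r * (9 / 16), 1, r * (3 / 4)), (0, - r * (9 / 16), 2, - r * (3 / 4)), (1, 0, 2, 0)}"
proof -
  have "(i, j) \<in> {(0, 1), (0, 2), (1, 2)}" using assms(2,3) by auto
  then show ?thesis using assms(1) by (auto simp: triangle_arcs_def)
qed

lemma triangle_arcs_table:
  assumes "r \<in> {-1, 1}"
  shows "crossing_table 3 (triangle_arcs (r * (3 / 5))) =
    {(0, r * (9 / 16), 1, r * (3 / 4)), (0, - r * (9 / 16), 2, - r * (3 / 4)), (1, 0, 2, 0)}"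
proof (intro set_eqI iffI)
  fix x assume "x \<in> crossing_table 3 (triangle_arcs (r * (3 / 5)))"
  then obtain i u j v where "x = (i, u, j, v)" "i < j" "j < 3"
    "triangle_arcs (r * (3 / 5)) i u = triangle_arcs (r * (3 / 5)) j v"
    unfolding crossing_table_def by auto
  then show "x \<in> {(0, r * (9 / 16), 1, r * (3 / 4)), (0, - r * (9 / 16), 2, - r * (3 / 4)), (1, 0, 2, 0)}"
    using triangle_arcs_crossing by metis
qed (use assms in \<open>auto simp: crossing_table_def triangle_arcs_def\<close>)

lemma disjoint_arcs_deriv: "(disjoint_arcs j has_vector_derivative Complex (4 / 5) 0) (at u)"
  unfolding has_vector_derivative_complex_iff disjoint_arcs_def
  by (auto intro!: derivative_eq_intros)

lemma bigon_arcs_deriv: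
  "(bigon_arcs j has_vector_derivative Complex (4 / 5) (if j = 0 then 8 * u / 5 else - 8 * u / 5)) (at u)"
  unfolding has_vector_derivative_complex_iff bigon_arcs_def
  by (auto intro!: derivative_eq_intros)

lemma triangle_arcs_deriv:
  "(triangle_arcs y j has_vector_derivative
      (if j = 0 then Complex (4 / 5) 0 else Complex (3 / 5) (if j = 1 then 4 / 5 else - 4 / 5))) (at u)"
  unfolding has_vector_derivative_complex_iff triangle_arcs_def
  by (auto intro!: derivative_eq_intros)

section \<open>Invariance under the moves\<close>

text \<open>The sum need not be split: once the self-crossing is excluded, the two counts range over
  literally the same subdiagrams of the common far arrows.\<close>

lemma signed_count_omega1:
  assumes k: "knot_diagram k" "knot_diagram k'" and alt: "alternating n X"
    and rep: "replaces_picture 1 straight_arc kinked_arc a b k k'"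
  shows "signed_count n X k = signed_count n X k'"
proof -
  obtain \<epsilon> \<delta> \<tau> \<tau>' where far: "far_arrows 1 a b k = far_arrows 1 a b k'"
    and pic: "picture_at 1 straight_arc \<epsilon> \<delta> a b k \<tau>" "picture_at 1 kinked_arc \<epsilon> \<delta> a b k' \<tau>'"
    using replaces_picture_at[OF k rep straight_arc_inside kinked_arc_inside] by blast
  have "crossing_table 1 straight_arc = {}" unfolding crossing_table_def by auto
  then have local: "local_arrows 1 a b k = {}"
    using local_arrows_table(1)[OF pic(1) straight_arc_inj] by simp
  have "\<not> has_form n X S" if S: "S \<subseteq> gauss_diagram k'" and x: "x \<in> S \<inter> local_arrows 1 a b k'" for S x
  proof
    assume form: "has_form n X S"
    obtain t h where th: "x = arrow k' t h" "crossing k' t h" "on_strand 1 a b t"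
      using x unfolding local_arrows_def by blast
    obtain i u j v where *: "i < 1" "j < 1" "u \<in> {-1..1}" "v \<in> {-1..1}" "frac t = frac (\<tau>' i u)"
      "frac h = frac (\<tau>' j v)" "kinked_arc i u = kinked_arc j v" "(i, u) \<noteq> (j, v)"
      using local_crossing[OF pic(2) th(2,3)] by blast
    then have [simp]: "i = 0" "j = 0" and "u \<noteq> v" by auto
    note uv = kinked_arc_crossing[OF *(7) \<open>u \<noteq> v\<close>]
    have "consecutive S (\<tau>' 0 u) (\<tau>' 0 v)"
    proof (rule consecutive_on_strand[OF pic(2) S _ *(3,4) \<open>u \<noteq> v\<close>])
      fix w j w' assume "j < (1::nat)" "kinked_arc 0 w = kinked_arc j w'" "(0, w) \<noteq> (j, w')"
      then show "w = u \<or> w = v" using kinked_arc_crossing[of 0 w j w'] uv by auto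
    qed simp
    moreover have "(frac (\<tau>' 0 u), frac (\<tau>' 0 v), snd (snd x)) \<in> S"
      using x *(5,6) unfolding th(1) arrow_def by simp
    ultimately show False using no_isolated_arrow[OF form alt] by blast
  qed
  then have "{S. S \<subseteq> gauss_diagram k' \<and> has_form n X S} = {S. S \<subseteq> gauss_diagram k \<and> has_form n X S}"
    unfolding gauss_diagram_split(1)[OF k(1), of 1 a b] gauss_diagram_split(1)[OF k(2), of 1 a b] local far
    by blast
  then show ?thesis unfolding signed_count_def by simp
qed

lemma signed_count_omega2:
  assumes k: "knot_diagram k" "knot_diagram k'" and alt: "alternating n X"
    and rep: "replaces_picture 2 disjoint_arcs bigon_arcs a b k k'"
  shows "signed_count n X k = signed_count n X k'"
proof -
  obtain \<epsilon> \<delta> \<tau> \<tau>' where far: "far_arrows 2 a b k = far_arrows 2 a b k'"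
    and pic: "picture_at 2 disjoint_arcs \<epsilon> \<delta> a b k \<tau>" "picture_at 2 bigon_arcs \<epsilon> \<delta> a b k' \<tau>'"
    using replaces_picture_at[OF k rep disjoint_arcs_inside bigon_arcs_inside] by blast
  have "signed_count n X k = (\<Sum>S | S \<subseteq> far_arrows 2 a b k \<and> has_form n X S. sign_of S)"
    using signed_count_picture[OF pic(1) disjoint_arcs_inj _ _ disjoint_arcs_deriv, of n X]
    unfolding disjoint_arcs_table by simp
  moreover have "signed_count n X k' = (\<Sum>S | S \<subseteq> far_arrows 2 a b k' \<and> has_form n X S. sign_of S) +
    (\<Sum>(i, u, j, v)\<in>crossing_table 2 bigon_arcs.
      (if \<epsilon> * \<delta> i * \<delta> j * plane_det (Complex (4 / 5) (if i = 0 then 8 * u / 5 else - 8 * u / 5))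
          (Complex (4 / 5) (if j = 0 then 8 * v / 5 else - 8 * v / 5)) > 0 then 1 else -1) *
       weight n X (far_arrows 2 a b k') ((a i + b i) / 2) ((a j + b j) / 2))"
  proof (rule signed_count_picture[OF pic(2) bigon_arcs_inj _ _ bigon_arcs_deriv])
    show "finite (crossing_table 2 bigon_arcs)" unfolding bigon_arcs_table by simp
    show "u \<in> {-1<..<1} \<and> v \<in> {-1<..<1}" if "(i, u, j, v) \<in> crossing_table 2 bigon_arcs" for i u j v
      using that unfolding bigon_arcs_table by auto
    fix S x y assume S: "S \<subseteq> gauss_diagram k'" and form: "has_form n X S"
      and xy: "x \<in> crossing_table 2 bigon_arcs" "y \<in> crossing_table 2 bigon_arcs"
        "table_arrow k' \<tau>' x \<in> S" "table_arrow k' \<tau>' y \<in> S"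
    show "x = y"
    proof (rule ccontr)
      assume "x \<noteq> y"
      then have "{x, y} = {(0, 1 / 2, 1, 1 / 2), (0, - 1 / 2, 1, - 1 / 2)}"
        using xy(1,2) unfolding bigon_arcs_table by auto
      then have "table_arrow k' \<tau>' (0, 1 / 2, 1, 1 / 2) \<in> S" "table_arrow k' \<tau>' (0, - 1 / 2, 1, - 1 / 2) \<in> S"
        using xy(3,4) by (metis doubleton_eq_iff)+
      then obtain h e h' e' where "(frac (\<tau>' 0 (1 / 2)), frac h, e) \<in> S" "(frac (\<tau>' 0 (- 1 / 2)), frac h', e') \<in> S"
        unfolding table_arrow_def arrow_def prod.case by blast
      from no_consecutive_tails[OF form alt this] have "\<not> consecutive S (\<tau>' 0 (1 / 2)) (\<tau>' 0 (- 1 / 2))" by simp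
      moreover have "consecutive S (\<tau>' 0 (1 / 2)) (\<tau>' 0 (- 1 / 2))"
      proof (rule consecutive_on_strand[OF pic(2) S])
        fix w j w' assume "j < (2::nat)" "bigon_arcs 0 w = bigon_arcs j w'" "(0, w) \<noteq> (j, w')"
        then show "w = 1 / 2 \<or> w = - 1 / 2" using bigon_arcs_crossing[of 0 w j w'] by auto
      qed auto
      ultimately show False by blast
    qed
  qed
  \<comment> \<open>At the two corners the slopes of the arcs are interchanged, so the determinants
    are opposite, whichever of these values the common factor has. Both rows have the same weight,
    as they join the same midpoints, and the terms cancel.\<close>
  moreover have "\<epsilon> * \<delta> 0 * \<delta> 1 = 1 \<or> \<epsilon> * \<delta> 0 * \<delta> 1 = -1"
    using picture_atD(3)[OF pic(2)] picture_atD(4)[OF pic(2), of 0] picture_atD(4)[OF pic(2), of 1] by auto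
  ultimately show ?thesis unfolding far bigon_arcs_table by (auto simp: plane_det_def)
qed

text \<open>The right-hand side mentions neither \<open>r\<close> nor \<open>\<tau>\<close>, so it
  is the same before and after the move. Alternation excludes two of the three pairs of local
  arrows; \<open>pair\<close> excludes the third, and only there does the cyclic order of the
  strands enter.\<close>

lemma signed_count_omega3:
  assumes r: "r \<in> {-1, 1}" and pic: "picture_at 3 (triangle_arcs (r * (3 / 5))) \<epsilon> \<delta> a b k \<tau>" and alt: "alternating n X"
    and pair: "\<And>S e e'. has_form n X S \<Longrightarrow> (frac (\<tau> 0 (r * (9 / 16))), frac (\<tau> 1 (r * (3 / 4))), e) \<in> S \<Longrightarrow>
      (frac (\<tau> 1 0), frac (\<tau> 2 0), e') \<in> S \<Longrightarrow> \<not> consecutive S (\<tau> 1 (r * (3 / 4))) (\<tau> 1 0)"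
  shows "signed_count n X k = (\<Sum>S | S \<subseteq> far_arrows 3 a b k \<and> has_form n X S. sign_of S) +
    (\<Sum>(i, j)\<in>{(0, 1), (0, 2), (1, 2)}.
      (if \<epsilon> * \<delta> i * \<delta> j *
          plane_det (if i = 0 then Complex (4 / 5) 0 else Complex (3 / 5) (if i = 1 then 4 / 5 else - 4 / 5))
            (if j = 0 then Complex (4 / 5) 0 else Complex (3 / 5) (if j = 1 then 4 / 5 else - 4 / 5)) > 0 then 1 else -1) *
       weight n X (far_arrows 3 a b k) ((a i + b i) / 2) ((a j + b j) / 2))"
proof -
  let ?c = "triangle_arcs (r * (3 / 5))"
  let ?tm = "(0, r * (9 / 16), 1, r * (3 / 4)) :: nat \<times> real \<times> nat \<times> real"
  let ?tb = "(0, - r * (9 / 16), 2, - r * (3 / 4)) :: nat \<times> real \<times> nat \<times> real"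
  let ?mb = "(1, 0, 2, 0) :: nat \<times> real \<times> nat \<times> real"
  have table: "crossing_table 3 ?c = {?tm, ?tb, ?mb}" by (rule triangle_arcs_table[OF r])
  \<comment> \<open>\<open>consecutive_on_strand\<close> asks for the crossings on a given strand,
    whether it is over or under; the table lists only increasing indices.\<close>
  have crossings: "(i, w, j, w') \<in> {?tm, ?tb, ?mb} \<or> (j, w', i, w) \<in> {?tm, ?tb, ?mb}"
    if "i < 3" "j < 3" "?c i w = ?c j w'" "(i, w) \<noteq> (j, w')" for i w j w'
  proof -
    have "i \<noteq> j" using that(3,4) inj_onD[OF triangle_arcs_inj[of "r * (3 / 5)" i UNIV], of w w'] by auto
    show ?thesis
    proof (cases "i < j")
      case True
      show ?thesis by (rule disjI1[OF triangle_arcs_crossing[OF that(3) True that(2)]])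
    next
      case False
      then have "j < i" using \<open>i \<noteq> j\<close> by simp
      show ?thesis by (rule disjI2[OF triangle_arcs_crossing[OF that(3)[symmetric] \<open>j < i\<close> that(1)]])
    qed
  qed
  have "signed_count n X k = (\<Sum>S | S \<subseteq> far_arrows 3 a b k \<and> has_form n X S. sign_of S) +
    (\<Sum>(i, u, j, v)\<in>crossing_table 3 ?c.
      (if \<epsilon> * \<delta> i * \<delta> j *
          plane_det (if i = 0 then Complex (4 / 5) 0 else Complex (3 / 5) (if i = 1 then 4 / 5 else - 4 / 5))
            (if j = 0 then Complex (4 / 5) 0 else Complex (3 / 5) (if j = 1 then 4 / 5 else - 4 / 5)) > 0 then 1 else -1) *
       weight n X (far_arrows 3 a b k) ((a i + b i) / 2) ((a j + b j) / 2))"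
  proof (rule signed_count_picture[OF pic triangle_arcs_inj _ _ triangle_arcs_deriv])
    show "finite (crossing_table 3 ?c)" unfolding table by simp
    show "u \<in> {-1<..<1} \<and> v \<in> {-1<..<1}" if "(i, u, j, v) \<in> crossing_table 3 ?c" for i u j v
      using that r unfolding table by auto
    fix S x y assume S: "S \<subseteq> gauss_diagram k" and form: "has_form n X S"
      and xy: "x \<in> crossing_table 3 ?c" "y \<in> crossing_table 3 ?c" "table_arrow k \<tau> x \<in> S" "table_arrow k \<tau> y \<in> S"
    have "\<not> (table_arrow k \<tau> ?tm \<in> S \<and> table_arrow k \<tau> ?tb \<in> S)"
    proof
      assume "table_arrow k \<tau> ?tm \<in> S \<and> table_arrow k \<tau> ?tb \<in> S"
      then obtain h e h' e' where "(frac (\<tau> 0 (r * (9 / 16))), frac h, e) \<in> S" "(frac (\<tau> 0 (- r * (9 / 16))), frac h', e') \<in> S"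
        unfolding table_arrow_def arrow_def prod.case by (elim conjE) (rule that)
      from no_consecutive_tails[OF form alt this] have "\<not> consecutive S (\<tau> 0 (r * (9 / 16))) (\<tau> 0 (- r * (9 / 16)))" by simp
      moreover have "consecutive S (\<tau> 0 (r * (9 / 16))) (\<tau> 0 (- r * (9 / 16)))"
      proof (rule consecutive_on_strand[OF pic S])
        fix w j w' assume "j < (3::nat)" "?c 0 w = ?c j w'" "(0, w) \<noteq> (j, w')"
        then show "w = r * (9 / 16) \<or> w = - r * (9 / 16)" using crossings[of 0 j w w'] by auto
      qed (use r in auto)
      ultimately show False by blast
    qed
    moreover have "\<not> (table_arrow k \<tau> ?mb \<in> S \<and> table_arrow k \<tau> ?tb \<in> S)"
    proof
      assume "table_arrow k \<tau> ?mb \<in> S \<and> table_arrow k \<tau> ?tb \<in> S"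
      then obtain t e t' e' where "(frac t, frac (\<tau> 2 0), e) \<in> S" "(frac t', frac (\<tau> 2 (- r * (3 / 4))), e') \<in> S"
        unfolding table_arrow_def arrow_def prod.case by (elim conjE) (rule that)
      from no_consecutive_heads[OF form alt this] have "\<not> consecutive S (\<tau> 2 0) (\<tau> 2 (- r * (3 / 4)))" by simp
      moreover have "consecutive S (\<tau> 2 0) (\<tau> 2 (- r * (3 / 4)))"
      proof (rule consecutive_on_strand[OF pic S])
        fix w j w' assume "j < (3::nat)" "?c 2 w = ?c j w'" "(2, w) \<noteq> (j, w')"
        then show "w = 0 \<or> w = - r * (3 / 4)" using crossings[of 2 j w w'] by auto
      qed (use r in auto)
      ultimately show False by blast
    qed
    moreover have "\<not> (table_arrow k \<tau> ?tm \<in> S \<and> table_arrow k \<tau> ?mb \<in> S)"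
    proof
      assume "table_arrow k \<tau> ?tm \<in> S \<and> table_arrow k \<tau> ?mb \<in> S"
      then obtain e e' where "(frac (\<tau> 0 (r * (9 / 16))), frac (\<tau> 1 (r * (3 / 4))), e) \<in> S"
          "(frac (\<tau> 1 0), frac (\<tau> 2 0), e') \<in> S"
        unfolding table_arrow_def arrow_def prod.case by (elim conjE) (rule that)
      from pair[OF form this] have "\<not> consecutive S (\<tau> 1 (r * (3 / 4))) (\<tau> 1 0)" .
      moreover have "consecutive S (\<tau> 1 (r * (3 / 4))) (\<tau> 1 0)"
      proof (rule consecutive_on_strand[OF pic S])
        fix w j w' assume "j < (3::nat)" "?c 1 w = ?c j w'" "(1, w) \<noteq> (j, w')"
        then show "w = r * (3 / 4) \<or> w = 0" using crossings[of 1 j w w'] by auto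
      qed (use r in auto)
      ultimately show False by blast
    qed
    ultimately show "x = y" using xy unfolding table by blast
  qed
  \<comment> \<open>The strands are straight, so their derivatives are constant and the parameters
    drop out of the rows.\<close>
  then show ?thesis unfolding table by simp
qed

lemma strand_order:
  assumes "strand_intervals m a b" "i < m" "j < m" "a i < a j"
  shows "b i < a j"
proof (rule ccontr)
  assume "\<not> b i < a j"
  moreover have "a j < b j" using strand_intervals_length(2)[OF assms(1,3)] .
  ultimately have "a j \<in> {a i..b i} \<inter> {a j..b j}" using assms(4) by auto
  moreover have "i \<noteq> j" using assms(4) by auto
  ultimately show False using assms(1-3) unfolding strand_intervals_def by blast
qed

text \<open>\<open>pair\<close> ranges over arbitrary points of the strands, so it serves both
  pictures with their different lifts \<open>\<tau>\<close> and \<open>\<tau>'\<close>. The cases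
  \<open>r = 1\<close> and \<open>r = -1\<close> then have the same right-hand side.\<close>

lemma signed_count_omega3_eq:
  assumes k: "knot_diagram k" "knot_diagram k'" and alt: "alternating n X"
    and rep: "replaces_picture 3 (triangle_arcs (3 / 5)) (triangle_arcs (- 3 / 5)) a b k k'"
    and pair: "\<And>S t m m' h e e'. has_form n X S \<Longrightarrow> (frac t, frac m, e) \<in> S \<Longrightarrow> (frac m', frac h, e') \<in> S \<Longrightarrow>
      t \<in> {a 0..b 0} \<Longrightarrow> m \<in> {a 1..b 1} \<Longrightarrow> m' \<in> {a 1..b 1} \<Longrightarrow> h \<in> {a 2..b 2} \<Longrightarrow> \<not> consecutive S m m'"
  shows "signed_count n X k = signed_count n X k'"
proof -
  obtain \<epsilon> \<delta> \<tau> \<tau>' where far: "far_arrows 3 a b k = far_arrows 3 a b k'"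
    and pic: "picture_at 3 (triangle_arcs (3 / 5)) \<epsilon> \<delta> a b k \<tau>" "picture_at 3 (triangle_arcs (- 3 / 5)) \<epsilon> \<delta> a b k' \<tau>'"
    using replaces_picture_at[OF k rep triangle_arcs_inside triangle_arcs_inside] by auto
  have pic': "picture_at 3 (triangle_arcs (1 * (3 / 5))) \<epsilon> \<delta> a b k \<tau>" "picture_at 3 (triangle_arcs (-1 * (3 / 5))) \<epsilon> \<delta> a b k' \<tau>'"
    using pic by simp_all
  have mem: "\<tau> j u \<in> {a j..b j}" "\<tau>' j u \<in> {a j..b j}" if "j < 3" "u \<in> {-1..1}" for j u
    using picture_atD(6)[OF pic(1)] picture_atD(6)[OF pic(2)] that by blast+
  have "\<not> consecutive S (\<tau> 1 (1 * (3 / 4))) (\<tau> 1 0)"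
    if "has_form n X S" "(frac (\<tau> 0 (1 * (9 / 16))), frac (\<tau> 1 (1 * (3 / 4))), e) \<in> S"
      "(frac (\<tau> 1 0), frac (\<tau> 2 0), e') \<in> S" for S e e'
    by (rule pair[OF that]; rule mem; simp)
  note 1 = signed_count_omega3[OF _ pic'(1) alt this]
  have "\<not> consecutive S (\<tau>' 1 (-1 * (3 / 4))) (\<tau>' 1 0)"
    if "has_form n X S" "(frac (\<tau>' 0 (-1 * (9 / 16))), frac (\<tau>' 1 (-1 * (3 / 4))), e) \<in> S"
      "(frac (\<tau>' 1 0), frac (\<tau>' 2 0), e') \<in> S" for S e e'
    by (rule pair[OF that]; rule mem; simp)
  note 2 = signed_count_omega3[OF _ pic'(2) alt this]
  show ?thesis using 1 2 unfolding far by simp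
qed

text \<open>Equality is symmetric, which settles the direction of the move, and the count does not
  see the reparametrization.\<close>

lemma signed_count_up_to_direction_and_param:
  assumes k: "knot_diagram k" "knot_diagram k'" and R: "up_to_direction_and_param R k k'"
    and eq: "\<And>k k'. knot_diagram k \<Longrightarrow> knot_diagram k' \<Longrightarrow> R k k' \<Longrightarrow> signed_count n X k = signed_count n X k'"
  shows "signed_count n X k = signed_count n X k'"
proof -
  obtain \<theta> where \<theta>: "circle_diffeo \<theta>" "R k (reparam \<theta> k') \<or> R (reparam \<theta> k') k"
    using R unfolding up_to_direction_and_param_def by blast
  have "knot_diagram (reparam \<theta> k')" by (rule knot_diagram_reparam[OF k(2) \<theta>(1)])
  then have "signed_count n X k = signed_count n X (reparam \<theta> k')" using eq k(1) \<theta>(2) by metis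
  then show ?thesis by (simp add: signed_count_reparam[OF k(2) \<theta>(1)])
qed

lemma signed_count_omega12:
  assumes "knot_diagram k" "knot_diagram k'" "alternating n X" "omega1 k k' \<or> omega2 k k'"
  shows "signed_count n X k = signed_count n X k'"
  using assms(4)
proof
  assume "omega1 k k'"
  from signed_count_up_to_direction_and_param[OF assms(1,2) this[unfolded omega1_def]] show ?thesis
    using signed_count_omega1[OF _ _ assms(3)] by blast
next
  assume "omega2 k k'"
  from signed_count_up_to_direction_and_param[OF assms(1,2) this[unfolded omega2_def]] show ?thesis
    using signed_count_omega2[OF _ _ assms(3)] by blast
qed

lemma A_inv_descending_omega3:
  assumes k: "knot_diagram k" "knot_diagram k'" and n: "n \<ge> 4" and move: "descending_omega3 k k'"
  shows "A_inv n k = A_inv n k'"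
  unfolding A_inv_def
proof (rule signed_count_up_to_direction_and_param[OF k move[unfolded descending_omega3_def]])
  fix k k' assume k: "knot_diagram k" "knot_diagram k'"
    and "\<exists>a b. passes_descending a \<and> replaces_picture 3 (triangle_arcs (3 / 5)) (triangle_arcs (- 3 / 5)) a b k k'"
  then obtain a b where a: "a 0 < a 1" "a 1 < a 2"
    and rep: "replaces_picture 3 (triangle_arcs (3 / 5)) (triangle_arcs (- 3 / 5)) a b k k'"
    unfolding passes_descending_def by blast
  have strands: "strand_intervals 3 a b" using rep unfolding replaces_picture_def by blast
  \<comment> \<open>Strands are disjoint, so the order of their starting points is an order of whole
    intervals.\<close>
  have order: "b 0 < a 1" "b 1 < a 2" using strand_order[OF strands] a by simp_all
  have "b 2 < a 0 + 1" using strands unfolding strand_intervals_def by simp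
  note alt = alternating_a_arrows[OF n]
  show "signed_count n (a_arrows n) k = signed_count n (a_arrows n) k'"
  proof (rule signed_count_omega3_eq[OF k alt rep], rule notI)
    fix S t m m' h e e'
    assume form: "has_form n (a_arrows n) S" and arrows: "(frac t, frac m, e) \<in> S" "(frac m', frac h, e') \<in> S"
      and mem: "t \<in> {a 0..b 0}" "m \<in> {a 1..b 1}" "m' \<in> {a 1..b 1}" "h \<in> {a 2..b 2}" and cons: "consecutive S m m'"
    have "t < m" "t < m'" "m < h" "m' < h" "h < t + 1" using mem order \<open>b 2 < a 0 + 1\<close> by auto
    then show False by (rule no_descending_pair_a[OF form alt n arrows]) (rule cons)
  qed
qed

lemma D_inv_ascending_omega3:
  assumes k: "knot_diagram k" "knot_diagram k'" and n: "n \<ge> 4" and move: "ascending_omega3 k k'"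
  shows "D_inv n k = D_inv n k'"
  unfolding D_inv_def
proof (rule signed_count_up_to_direction_and_param[OF k move[unfolded ascending_omega3_def]])
  fix k k' assume k: "knot_diagram k" "knot_diagram k'"
    and "\<exists>a b. \<not> passes_descending a \<and> replaces_picture 3 (triangle_arcs (3 / 5)) (triangle_arcs (- 3 / 5)) a b k k'"
  then obtain a b where a: "\<not> (a 0 < a 1 \<and> a 1 < a 2)"
    and rep: "replaces_picture 3 (triangle_arcs (3 / 5)) (triangle_arcs (- 3 / 5)) a b k k'"
    unfolding passes_descending_def by blast
  have strands: "strand_intervals 3 a b" using rep unfolding replaces_picture_def by blast
  have distinct: "a i \<noteq> a j" if "i < 3" "j < 3" "i \<noteq> j" for i j
  proof
    assume "a i = a j"
    then have "a i \<in> {a i..b i} \<inter> {a j..b j}"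
      using strand_intervals_length(2)[OF strands that(1)] strand_intervals_length(2)[OF strands that(2)] by simp
    then show False using strands that unfolding strand_intervals_def by blast
  qed
  have "a 0 \<le> a 1" "a 0 \<le> a 2" "b 1 < a 0 + 1" using strands unfolding strand_intervals_def by simp_all
  \<comment> \<open>Strand 0 starts the period and the starting points are distinct, so failure of
    the descending order leaves only top, bottom, middle.\<close>
  then have "a 0 < a 2" "a 2 < a 1" using a distinct[of 0 1] distinct[of 0 2] distinct[of 1 2] by auto
  then have order: "b 0 < a 2" "b 2 < a 1" using strand_order[OF strands] by simp_all
  note alt = alternating_d_arrows[OF n]
  show "signed_count n (d_arrows n) k = signed_count n (d_arrows n) k'"
  proof (rule signed_count_omega3_eq[OF k alt rep], rule notI)
    fix S t m m' h e e'
    assume form: "has_form n (d_arrows n) S" and arrows: "(frac t, frac m, e) \<in> S" "(frac m', frac h, e') \<in> S"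
      and mem: "t \<in> {a 0..b 0}" "m \<in> {a 1..b 1}" "m' \<in> {a 1..b 1}" "h \<in> {a 2..b 2}" and cons: "consecutive S m m'"
    have "t < h" "h < m" "h < m'" "m < t + 1" "m' < t + 1" using mem order \<open>b 1 < a 0 + 1\<close> by auto
    then show False by (rule no_ascending_pair_d[OF form alt n arrows]) (rule cons)
  qed
qed

theorem proposition4:
  fixes k k' :: diagram
  assumes "knot_diagram k" and "knot_diagram k'"
  shows
    "(\<forall>n\<ge>4. omega1 k k' \<or> omega2 k k' \<longrightarrow> A_inv n k = A_inv n k' \<and> D_inv n k = D_inv n k') \<and>
     (\<forall>n\<ge>3. odd n \<longrightarrow> omega1 k k' \<or> omega2 k k' \<longrightarrow> W_inv n k = W_inv n k') \<and>
     (\<forall>n\<ge>4. descending_omega3 k k' \<longrightarrow> A_inv n k = A_inv n k') \<and>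
     (\<forall>n\<ge>4. ascending_omega3 k k' \<longrightarrow> D_inv n k = D_inv n k')"
  using A_inv_descending_omega3[OF assms] D_inv_ascending_omega3[OF assms]
    signed_count_omega12[OF assms] alternating_a_arrows alternating_d_arrows alternating_w_arrows
  unfolding A_inv_def D_inv_def W_inv_def by simp

end
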